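(* Let $m$ be sufficiently large and $n = m/2$. Starting from an array of size $m$ containing $m/4$ elements (arranged by the initial call $\mathrm{CreateSubtree}$ on the whole array), the See-Saw Algorithm is a valid list-labeling algorithm that supports any (obliviously chosen) sequence of $m/4$ insertions with amortized expected cost $O((\log n)(\log\log n)^3)$ per insertion.
   Context: List labeling: elements from a totally ordered universe must always be stored in sorted order in an array of $m$ slots; the cost of an insertion is the number of elements moved; the input is fixed in advance independently of the algorithm's randomness; amortized expected cost $C$ means the expected total cost of the first $i$ operations is $O(iC)$ for every $i$. The See-Saw Algorithm. Parameters: $\alpha = C_\alpha(\log\log n)^2$, $\beta = C_\beta(\log\log n)^2$ where $C_\alpha, C_\beta, C_\alpha/C_\beta$ are sufficiently large positive constants; $k_{\max} = 2\log\log n$; $p_k = 2^{-(k+1)}(1+k/k_{\max})$ for $k\in[1,k_{\max}]$ and $p_0 = 1-\sum_{k=1}^{k_{\max}}p_k$. (Rounding is ignored.) The array is organized as a dynamic binary tree of subproblems; a subproblem $\pi$ owns a contiguous subarray $A_\pi$ of size $m_\pi$, and a non-leaf $\pi$ has children $L(\pi), R(\pi)$ with $A_\pi$ the concatenation of $A_{L(\pi)}$ and $A_{R(\pi)}$. An insertion $x$ arriving at non-leaf $\pi$ goes to $L(\pi)$ if $L(\pi)$ contains an element and its maximum element exceeds $x$, and otherwise to $R(\pi)$. A newly created subproblem is a leaf if its initial density (elements$/m_\pi$) exceeds $3/4$ or $m_\pi \le 2^{\sqrt{\log n}}$; leaves handle their insertions with the classical Itai–Konheim–Rodeh algorithm inside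 $A_\pi$. $\mathrm{CreateSubtree}(A',S')$ spreads the element set $S'$ evenly over subarray $A'$, creates a subproblem on $A'$ and, if it is not a leaf, recursively creates its children on the two halves of $A'$ (via the same procedure, without further moving elements). When a non-leaf $\pi$ is created it draws $k_\pi$ with $\Pr[k_\pi = k]=p_k$ and sets window size $w_\pi = m_\pi/(\alpha 2^{k_\pi})$; the insertions reaching $\pi$ are divided into consecutive windows of $w_\pi$ insertions. When window $j$ ends and window $j+1$ begins, $\pi$ rebuilds: it terminates its descendants, and recreates its children by $\mathrm{CreateSubtree}$ on new subarrays of sizes $m_\pi/2 - r$ (left) and $m_\pi/2 + r$ (right), each child keeping the same set of elements it held before; here $r = 0$ if $j+1$ is odd, and $r = m_\pi D_j/(\beta w_\pi)$ if $j+1$ is even, where $D_j$ is the number of insertions in window $j$ sent right minus the number sent left. Additionally, whenever a subproblem $\pi$ has received $m_\pi/\alpha$ insertions during its lifetime it is reset: it and its descendants are terminated and replaced by $\mathrm{CreateSubtree}$ on the same subarray with the same elements. *)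

theory Defs
  imports "HOL-Probability.Probability"
begin

section \<open>Arrays, moves, and the list-labeling invariant\<close>

text \<open>Slots are numbered from 0. The size of an array is not part of its type; \<open>stores_sorted\<close> forces
  all slots beyond the first \<open>m\<close> to be empty.\<close>

type_synonym 'a slots = "nat \<Rightarrow> 'a option"

definition stores_sorted :: "nat \<Rightarrow> 'a::linorder set \<Rightarrow> 'a slots \<Rightarrow> bool" where
  "stores_sorted m S a \<longleftrightarrow>
     (\<forall>i\<ge>m. a i = None) \<and>
     {x. \<exists>i. a i = Some x} = S \<and>
     (\<forall>i j x y. i < j \<longrightarrow> a i = Some x \<longrightarrow> a j = Some y \<longrightarrow> x < y)"

text \<open>Elements stored in the slots \<open>lo, \<dots>, lo + len - 1\<close>, in slot order.\<close>

definition contents :: "'a slots \<Rightarrow> nat \<Rightarrow> nat \<Rightarrow> 'a list" where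
  "contents a lo len = List.map_filter a [lo..<lo + len]"

text \<open>The \<open>j\<close>-th of \<open>s\<close> elements goes to relative slot \<open>\<lfloor>j len / s\<rfloor>\<close>. These slots are distinct if
  \<open>s \<le> len\<close>; otherwise elements are lost, so \<open>stores_sorted\<close> fails afterwards.\<close>

definition spread :: "nat \<Rightarrow> nat \<Rightarrow> 'a list \<Rightarrow> 'a slots \<Rightarrow> 'a slots" where
  "spread lo len xs a = (\<lambda>i.
     if lo \<le> i \<and> i < lo + len
     then map_of (map (\<lambda>j. (lo + j * len div length xs, xs ! j)) [0..<length xs]) i
     else a i)"

text \<open>Elements are pairwise distinct, so an element is moved (or newly placed) by a rewrite exactly if
  it ends up in a slot that did not contain it before.\<close>

definition moves :: "'a slots \<Rightarrow> 'a slots \<Rightarrow> nat" where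
  "moves a a' = card {i. a' i \<noteq> None \<and> a' i \<noteq> a i}"

text \<open>A memory is an array together with the number of moves made so far. All writes go through
  \<open>place\<close>, so an element that is moved several times during one insertion is charged each time.\<close>

type_synonym 'a memory = "'a slots \<times> nat"

definition place :: "nat \<Rightarrow> nat \<Rightarrow> 'a list \<Rightarrow> 'a memory \<Rightarrow> 'a memory" where
  "place lo len xs = (\<lambda>(a, c). let a' = spread lo len xs a in (a', c + moves a a'))"


section \<open>The Itai--Konheim--Rodeh algorithm on a subarray\<close>

text \<open>The subarray of size \<open>len\<close> is cut into \<open>2 ^ H\<close> segments of size \<open>\<Theta>(log len)\<close>, segment \<open>j\<close> being
  the relative slots from \<open>\<lfloor>j len / 2 ^ H\<rfloor>\<close> up to (excluding) \<open>\<lfloor>(j + 1) len / 2 ^ H\<rfloor>\<close>. A window of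
  height \<open>h\<close> is an aligned block of \<open>2 ^ h\<close> segments. The density threshold decreases linearly from 1
  for segments to 9/10 for the whole subarray; the latter only has to be a constant below 1 that
  exceeds the densities (slightly above 3/4) at which leaves operate.\<close>

definition ikr_levels :: "nat \<Rightarrow> nat" where
  "ikr_levels len = nat \<lfloor>log 2 (real len / log 2 (real len))\<rfloor>"

definition ikr_bound :: "nat \<Rightarrow> nat \<Rightarrow> nat" where
  "ikr_bound len j = j * len div 2 ^ ikr_levels len"

definition ikr_threshold :: "nat \<Rightarrow> nat \<Rightarrow> real" where
  "ikr_threshold len h = 1 - real h / (10 * real (ikr_levels len))"

definition ikr_segment :: "nat \<Rightarrow> nat \<Rightarrow> nat" where
  "ikr_segment len q = Max {j. j < 2 ^ ikr_levels len \<and> ikr_bound len j \<le> q}"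

text \<open>Relative start and size of the window of height \<open>h\<close> containing the relative slot \<open>q\<close>.\<close>

definition ikr_start :: "nat \<Rightarrow> nat \<Rightarrow> nat \<Rightarrow> nat" where
  "ikr_start len q h = ikr_bound len (ikr_segment len q div 2 ^ h * 2 ^ h)"

definition ikr_size :: "nat \<Rightarrow> nat \<Rightarrow> nat \<Rightarrow> nat" where
  "ikr_size len q h =
     ikr_bound len ((ikr_segment len q div 2 ^ h + 1) * 2 ^ h) - ikr_start len q h"

text \<open>Relative slot of the predecessor of \<open>x\<close>, or the first slot if there is none.\<close>

definition ikr_slot :: "'a::linorder slots \<Rightarrow> nat \<Rightarrow> nat \<Rightarrow> 'a \<Rightarrow> nat" where
  "ikr_slot a lo len x =
     (let P = {q. q < len \<and> (\<exists>y. a (lo + q) = Some y \<and> y < x)} in if P = {} then 0 else Max P)"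

text \<open>The smallest window around the predecessor whose density, counting the new element, is within
  its threshold is rewritten evenly with the new element included.\<close>

definition ikr_insert :: "nat \<Rightarrow> nat \<Rightarrow> 'a::linorder \<Rightarrow> 'a memory \<Rightarrow> 'a memory" where
  "ikr_insert lo len x \<sigma> =
     (let a = fst \<sigma>;
          q = ikr_slot a lo len x;
          win = (\<lambda>h. contents a (lo + ikr_start len q h) (ikr_size len q h));
          h = (LEAST h. h = ikr_levels len \<or>
                 real (length (win h) + 1) \<le> ikr_threshold len h * real (ikr_size len q h))
      in place (lo + ikr_start len q h) (ikr_size len q h) (insort x (win h)) \<sigma>)"


section \<open>The See-Saw Algorithm\<close>

text \<open>\<open>skew\<close> is the random value \<open>k\<close>. \<open>imbalance\<close> is the number of insertions sent right minus the
  number sent left during the current window; \<open>received\<close> counts insertions since creation.\<close>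

datatype subproblem =
    Leaf (off: nat) (width: nat) (received: nat)
  | Node (off: nat) (width: nat) (skew: nat) (received: nat) (imbalance: int)
      (left: subproblem) (right: subproblem)

locale see_saw =
  fixes C\<alpha> C\<beta> :: real and m :: nat
begin

definition n :: real where "n = real m / 2"

definition \<alpha> :: real where "\<alpha> = C\<alpha> * (log 2 (log 2 n))\<^sup>2"

definition \<beta> :: real where "\<beta> = C\<beta> * (log 2 (log 2 n))\<^sup>2"

definition k_max :: nat where "k_max = nat \<lceil>2 * log 2 (log 2 n)\<rceil>"

definition p :: "nat \<Rightarrow> real" where
  "p k = (let q = (\<lambda>k. (1 / 2) ^ (k + 1) * (1 + real k / real k_max)) in
     if k = 0 then 1 - (\<Sum>j = 1..k_max. q j) else if k \<le> k_max then q k else 0)"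

definition skew_pmf :: "nat pmf" where "skew_pmf = embed_pmf p"

lemma p_nonneg: "p k \<ge> 0"
proof -
  have "(\<Sum>j = 1..N. (1 / 2) ^ (j + 1) * (1 + real j / real k_max)) \<le> 1 - (1 / 2) ^ N"
    if "N \<le> k_max" for N
    using that
  proof (induction N)
    case (Suc N)
    have "(1 / 2) ^ (Suc N + 1) * (1 + real (Suc N) / real k_max) \<le> (1 / 2 :: real) ^ (Suc N + 1) * 2"
      using Suc.prems by (intro mult_left_mono) auto
    also have "\<dots> = (1 / 2) ^ N - (1 / 2) ^ Suc N" by simp
    finally show ?case using Suc by (simp del: power_Suc)
  qed simp
  from this[of k_max] have "(\<Sum>j = 1..k_max. (1 / 2) ^ (j + 1) * (1 + real j / real k_max)) \<le> 1"
    by (smt (verit) le_refl zero_le_power divide_nonneg_nonneg)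
  then show ?thesis by (simp add: p_def Let_def)
qed

lemma pmf_skew_pmf: "pmf skew_pmf k = p k"
  unfolding skew_pmf_def
proof (rule pmf_embed_pmf)
  have "(\<integral>\<^sup>+ k. ennreal (p k) \<partial>count_space UNIV) = (\<Sum>k\<in>{..k_max}. ennreal (p k))"
    by (rule nn_integral_count_space') (auto simp: p_def Let_def)
  also have "\<dots> = ennreal (\<Sum>k\<in>{..k_max}. p k)"
    by (simp add: p_nonneg)
  also have "{..k_max} = insert 0 {1..k_max}" by auto
  also have "(\<Sum>k\<in>insert 0 {1..k_max}. p k) = p 0 + (\<Sum>k = 1..k_max. p k)"
    by simp
  also have "(\<Sum>k = 1..k_max. p k) = 1 - p 0"
    by (simp add: p_def Let_def)
  finally show "(\<integral>\<^sup>+ k. ennreal (p k) \<partial>count_space UNIV) = 1" by simp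
qed (rule p_nonneg)

text \<open>\<open>len / \<alpha>\<close> is rounded down to a multiple of \<open>2 ^ k_max\<close>. Thus a lifetime consists of exactly
  \<open>2 ^ k\<close> windows and its length does not depend on the random choice of \<open>k\<close>.\<close>

definition min_window :: "nat \<Rightarrow> nat" where
  "min_window len = nat \<lfloor>real len / (\<alpha> * 2 ^ k_max)\<rfloor>"

definition lifetime :: "nat \<Rightarrow> nat" where
  "lifetime len = 2 ^ k_max * min_window len"

definition window :: "nat \<Rightarrow> nat \<Rightarrow> nat" where
  "window len k = 2 ^ (k_max - k) * min_window len"

text \<open>The disjunct \<open>len \<le> 1\<close> is implied by the second one if \<open>n \<ge> 1\<close>; it makes the recursion below
  terminate for all parameters.\<close>

definition is_leaf_case :: "nat \<Rightarrow> nat \<Rightarrow> bool" where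
  "is_leaf_case s len \<longleftrightarrow>
     real s / real len > 3 / 4 \<or> real len \<le> 2 powr sqrt (log 2 n) \<or> len \<le> 1"

text \<open>Creates the tree of subproblems for a subarray whose elements are already in place.\<close>

function grow :: "'a slots \<Rightarrow> nat \<Rightarrow> nat \<Rightarrow> subproblem pmf" where
  "grow a lo len =
     (if is_leaf_case (length (contents a lo len)) len
      then return_pmf (Leaf lo len 0)
      else do {
        k \<leftarrow> skew_pmf;
        l \<leftarrow> grow a lo (len div 2);
        r \<leftarrow> grow a (lo + len div 2) (len - len div 2);
        return_pmf (Node lo len k 0 0 l r)
      })"
  by pat_completeness auto
termination
  by (relation "Wellfounded.measure (\<lambda>(a, lo, len). len)") (auto simp: is_leaf_case_def)

definition create_subtree ::
  "nat \<Rightarrow> nat \<Rightarrow> 'a list \<Rightarrow> 'a memory \<Rightarrow> (subproblem \<times> 'a memory) pmf" where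
  "create_subtree lo len xs \<sigma> =
     (let \<sigma>' = place lo len xs \<sigma> in map_pmf (\<lambda>t. (t, \<sigma>')) (grow (fst \<sigma>') lo len))"

definition reset :: "subproblem \<Rightarrow> 'a memory \<Rightarrow> (subproblem \<times> 'a memory) pmf" where
  "reset t \<sigma> = create_subtree (off t) (width t) (contents (fst \<sigma>) (off t) (width t)) \<sigma>"

text \<open>The amount \<open>r\<close> by which the children deviate from half of the subarray in window \<open>j + 1\<close>, where
  \<open>D\<close> is the imbalance of window \<open>j\<close>.\<close>

definition shift :: "nat \<Rightarrow> nat \<Rightarrow> nat \<Rightarrow> int \<Rightarrow> real" where
  "shift len k j D =
     (if odd (j + 1) then 0 else real len * real_of_int D / (\<beta> * real (window len k)))"

text \<open>Applied to a non-leaf when a window has just ended and another one follows. Both element lists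
  are read before either child is rewritten.\<close>

definition rebuild :: "subproblem \<Rightarrow> 'a memory \<Rightarrow> (subproblem \<times> 'a memory) pmf" where
  "rebuild t \<sigma> =
     (let lo = off t; len = width t; k = skew t; c = received t;
          xs = contents (fst \<sigma>) (off (left t)) (width (left t));
          ys = contents (fst \<sigma>) (off (right t)) (width (right t));
          j = c div window len k;
          len\<^sub>l = nat \<lfloor>real len / 2 - shift len k j (imbalance t)\<rfloor>
      in do {
        (l, \<sigma>\<^sub>1) \<leftarrow> create_subtree lo len\<^sub>l xs \<sigma>;
        (r, \<sigma>\<^sub>2) \<leftarrow> create_subtree (lo + len\<^sub>l) (len - len\<^sub>l) ys \<sigma>\<^sub>1;
        return_pmf (Node lo len k c 0 l r, \<sigma>\<^sub>2)
      })"

definition finish_insertion :: "subproblem \<Rightarrow> 'a memory \<Rightarrow> (subproblem \<times> 'a memory) pmf" where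
  "finish_insertion t \<sigma> =
     (if received t = lifetime (width t) then reset t \<sigma>
      else case t of
        Leaf _ _ _ \<Rightarrow> return_pmf (t, \<sigma>)
      | Node _ len k c _ _ _ \<Rightarrow>
          if window len k dvd c then rebuild t \<sigma> else return_pmf (t, \<sigma>))"

definition goes_left :: "'a::linorder slots \<Rightarrow> subproblem \<Rightarrow> 'a \<Rightarrow> bool" where
  "goes_left a l x =
     (let S = set (contents a (off l) (width l)) in S \<noteq> {} \<and> x < Max S)"

fun process :: "'a::linorder \<Rightarrow> subproblem \<Rightarrow> 'a memory \<Rightarrow> (subproblem \<times> 'a memory) pmf" where
  "process x (Leaf lo len c) \<sigma> =
     finish_insertion (Leaf lo len (c + 1)) (ikr_insert lo len x \<sigma>)"
| "process x (Node lo len k c D l r) \<sigma> =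
     (if goes_left (fst \<sigma>) l x
      then do {
        (l', \<sigma>') \<leftarrow> process x l \<sigma>;
        finish_insertion (Node lo len k (c + 1) (D - 1) l' r) \<sigma>'
      }
      else do {
        (r', \<sigma>') \<leftarrow> process x r \<sigma>;
        finish_insertion (Node lo len k (c + 1) (D + 1) l r') \<sigma>'
      })"

text \<open>The moves made while arranging the initial elements are not charged.\<close>

definition init :: "'a::linorder set \<Rightarrow> (subproblem \<times> 'a memory) pmf" where
  "init S = map_pmf (\<lambda>(t, (a, c)). (t, (a, 0)))
     (create_subtree 0 m (sorted_list_of_set S) (\<lambda>_. None, 0))"

definition run :: "'a::linorder set \<Rightarrow> 'a list \<Rightarrow> (subproblem \<times> 'a memory) pmf" where
  "run S xs = foldl (\<lambda>st x. st \<bind> (\<lambda>(t, \<sigma>). process x t \<sigma>)) (init S) xs"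

definition array_after :: "'a::linorder set \<Rightarrow> 'a list \<Rightarrow> 'a slots pmf" where
  "array_after S xs = map_pmf (\<lambda>(t, (a, c)). a) (run S xs)"

definition total_cost :: "'a::linorder set \<Rightarrow> 'a list \<Rightarrow> nat pmf" where
  "total_cost S xs = map_pmf (\<lambda>(t, (a, c)). c) (run S xs)"

end

text \<open>\<open>xs\<close> is a sequence of insertions into an array initially holding \<open>S\<close>. Being fixed before the
  algorithm is run, it cannot depend on the algorithm's random choices.\<close>

definition insertion_sequence :: "'a set \<Rightarrow> 'a list \<Rightarrow> bool" where
  "insertion_sequence S xs \<longleftrightarrow> distinct xs \<and> set xs \<inter> S = {}"

end

theory Submission
  imports Defs "HOL-Real_Asymp.Real_Asymp"
begin

text \<open>
  Three costs have to be paid. Rebuilding \<open>\<pi>\<close> with skew \<open>k\<close> costs \<open>O(\<alpha> 2\<^sup>k)\<close> per insertion reaching \<open>\<pi>\<close>,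
  on average \<open>O(\<alpha> k_max) = O((log log n)\<^sup>3)\<close> because \<open>p k \<le> 2 ^ -k\<close>, and there are \<open>O(log n)\<close> levels.
  A leaf of size at most \<open>2 ^ sqrt (log n)\<close> pays \<open>O(log n)\<close> per insertion. A larger leaf pays \<open>O(log\<^sup>2 n)\<close>,
  but its density exceeds 3/4, whereas the density of the whole array is at most 1/2.

  That such leaves are rare follows from the exponential moment of the current density with parameter
  \<open>\<mu> = \<Theta>(log log n)\<close>. Let \<open>S\<^sub>k\<close> be the sum of the squared imbalances of the windows of a lifetime for
  skew \<open>k\<close>. Since \<open>2ab = (a + b)\<^sup>2 - a\<^sup>2 - b\<^sup>2\<close>, shifting the boundary in every second window by the imbalance
  of the window before it decreases the density seen by the insertions by a multiple of
  \<open>S\<^bsub>k-1\<^esub> - S\<^sub>k\<close>. The weights \<open>p k \<sim> 2 ^ -k (1 + k / k_max)\<close> turn the sum over all \<open>k\<close> into a gain of order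
  \<open>S\<^sub>0 + (\<Sum>k. S\<^sub>k) / k_max\<close>, up to the negligible \<open>S\<^bsub>k_max\<^esub>\<close>. The first summand pays for the drift caused by the
  insertions themselves (here \<open>\<alpha> / \<beta>\<close> has to be large), the second one for all second-order terms
  (here \<open>\<alpha>, \<beta> \<ge> C (log log n)\<^sup>2\<close> is needed). So the exponential moment does not increase along a path.

  Formally, every state carries a budget that bounds its expected future cost, where future children
  that do not exist yet are accounted for by a bound depending only on their size and number of
  elements. One insertion does not increase the expectation of cost plus budget, so no independence
  argument is needed.
\<close>

section \<open>Arrays and even spreading\<close>

text \<open>The average over the skew can be taken for a fixed sequence of directions because
  routing does not see the skew. An element sent left is below the maximum of the left child, one
  sent right is above it, so between creation and reset of a node this maximum never changes, and
  rebuilds preserve it. The directions are thus determined by the array at creation. The gain is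
  proportional to the density, hence too weak in sparse nodes. Below density 3/10 at creation the
  drift is not estimated at all: children there have density at most 1/3 and receive an additive
  allowance exp (\<mu> / 3) per level. The value \<open>\<mu> = 8 * ln (log 2 n)\<close> makes both
  parts fit. From density 1/2 to 3/4 the moment loses exp (- \<mu> / 4) = (log n)^-2, which cancels
  the (log n)^2 paid in a large leaf; the allowance is smaller by a further log n, the order of the
  number of levels over which it is summed. All errors of one level, rounding included, are kept
  within a factor 1 + 1 / log n, whose product over O(log n) levels is bounded.\<close>

lemma map_filter_eq: "List.map_filter f xs = map (\<lambda>x. the (f x)) (filter (\<lambda>x. f x \<noteq> None) xs)"
  by (induction xs) (auto split: option.splits)

lemma contents_append: "contents a lo (p + q) = contents a lo p @ contents a (lo + p) q"
proof -
  have "[lo..<lo + (p + q)] = [lo..<lo + p] @ [lo + p..<lo + p + q]"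
    using upt_add_eq_append[of lo "lo + p" q] by (simp add: add.assoc)
  then show ?thesis by (simp add: contents_def map_filter_eq)
qed

lemma contents_split:
  assumes "lo \<le> p" "p + q \<le> lo + len"
  shows "contents a lo len = contents a lo (p - lo) @ contents a p q @ contents a (p + q) (lo + len - (p + q))"
proof -
  have "contents a lo len = contents a lo ((p - lo) + (q + (lo + len - (p + q))))" using assms by simp
  also have "\<dots> = contents a lo (p - lo) @ contents a p q @ contents a (p + q) (lo + len - (p + q))"
    using assms by (simp only: contents_append) simp
  finally show ?thesis .
qed

lemma contents_cong:
  assumes "\<And>i. lo \<le> i \<Longrightarrow> i < lo + len \<Longrightarrow> a i = b i"
  shows "contents a lo len = contents b lo len"
  unfolding contents_def map_filter_eq using assms by (intro map_cong filter_cong) auto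

lemma set_contents: "set (contents a lo len) = {x. \<exists>i. lo \<le> i \<and> i < lo + len \<and> a i = Some x}"
  unfolding contents_def map_filter_eq by force

lemma length_contents_card: "length (contents a lo len) = card {i. lo \<le> i \<and> i < lo + len \<and> a i \<noteq> None}"
proof -
  have "length (contents a lo len) = length (filter (\<lambda>i. a i \<noteq> None) [lo..<lo + len])"
    by (simp add: contents_def map_filter_eq)
  also have "\<dots> = card (set (filter (\<lambda>i. a i \<noteq> None) [lo..<lo + len]))"
    by (simp add: distinct_card del: set_filter)
  also have "set (filter (\<lambda>i. a i \<noteq> None) [lo..<lo + len]) = {i. lo \<le> i \<and> i < lo + len \<and> a i \<noteq> None}"
    by auto
  finally show ?thesis .
qed

lemma sorted_contents_iff:
  "sorted_wrt (<) (contents a lo len) \<longleftrightarrow>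
     (\<forall>i j x y. lo \<le> i \<longrightarrow> i < j \<longrightarrow> j < lo + len \<longrightarrow> a i = Some x \<longrightarrow> a j = Some y \<longrightarrow> x < (y::'a::linorder))"
proof (induction len)
  case 0
  then show ?case by (simp add: contents_def map_filter_eq)
next
  case (Suc len)
  have "contents a lo (Suc len) = contents a lo len @ contents a (lo + len) 1"
    using contents_append[of a lo len 1] by simp
  moreover have "contents a (lo + len) 1 = (case a (lo + len) of None \<Rightarrow> [] | Some x \<Rightarrow> [x])"
    by (auto simp: contents_def map_filter_eq split: option.splits)
  ultimately show ?case using Suc
    by (auto simp: sorted_wrt_append set_contents less_Suc_eq split: option.splits)
qed

lemma stores_sorted_contents:
  assumes "\<And>i. i \<ge> m \<Longrightarrow> a i = None" and "sorted_wrt (<) (contents a 0 m)"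
    and "set (contents a 0 m) = S"
  shows "stores_sorted m S a"
proof -
  have "i < m" if "a i = Some x" for i x using assms(1) that by (metis not_le option.distinct(1))
  then show ?thesis
    using assms unfolding stores_sorted_def sorted_contents_iff set_contents by auto
qed

text \<open>The hypothesis on \<open>x\<close> is the routing test of \<open>goes_left\<close>: some
  element of \<open>xs\<close> lies above \<open>x\<close>, so the insertion stops before it reaches
  \<open>ys\<close>.\<close>

lemma sorted_insort_append_left:
  assumes "sorted_wrt (<) (xs @ ys)" "xs \<noteq> []" "x < Max (set xs)"
  shows "insort x (xs @ ys) = insort x xs @ ys"
  using assms
proof (induction xs)
  case (Cons z xs)
  show ?case
  proof (cases "xs = []")
    case False
    then have "z < Max (set xs)"
      using Cons.prems(1) Max_in[of "set xs"] by simp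
    then have "Max (set (z # xs)) = Max (set xs)" using False by (simp add: max_def less_imp_le)
    then show ?thesis using Cons False by auto
  qed (use Cons in auto)
qed simp

lemma insort_append_right:
  fixes x :: "'a::linorder"
  assumes "\<forall>z\<in>set xs. z < x"
  shows "insort x (xs @ ys) = xs @ insort x ys"
  using assms by (induction xs) auto

lemma insort_append_left:
  fixes x :: "'a::linorder"
  assumes "\<forall>z\<in>set ys. x < z"
  shows "insort x (xs @ ys) = insort x xs @ ys"
  using assms by (induction xs; cases ys) auto

lemma sorted_wrt_insort:
  fixes x :: "'a::linorder"
  assumes "sorted_wrt (<) xs" "x \<notin> set xs"
  shows "sorted_wrt (<) (insort x xs)"
  using assms by (induction xs) (auto simp: set_insort_key)

section \<open>Even spreading over a subarray\<close>

definition spread_pos :: "nat \<Rightarrow> nat \<Rightarrow> nat \<Rightarrow> nat \<Rightarrow> nat" where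
  "spread_pos lo len s j = lo + j * len div s"

text \<open>Consecutive multiples of \<open>len\<close> are at least \<open>s\<close> apart, so
  their quotients by \<open>s\<close> differ. The case \<open>j = s\<close> is included because it
  yields the right end of the subarray.\<close>

lemma spread_pos_strict:
  assumes "s \<le> len" "i < j" "j \<le> s"
  shows "spread_pos lo len s i < spread_pos lo len s j"
proof -
  have s: "s > 0" using assms by simp
  have "i * len + s \<le> j * len"
    using assms by (metis Suc_leI add.commute add_le_mono1 le_trans mult_Suc mult_le_mono1)
  then have "(i * len + s) div s \<le> j * len div s" by (rule div_le_mono)
  then show ?thesis using s by (simp add: spread_pos_def)
qed

lemma spread_pos_bounds:
  assumes "s \<le> len" "j < s"
  shows "lo \<le> spread_pos lo len s j" "spread_pos lo len s j < lo + len"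
  using spread_pos_strict[OF assms(1), of j s lo] assms by (auto simp: spread_pos_def)

lemma spread_pos_inj: "s \<le> len \<Longrightarrow> inj_on (spread_pos lo len s) {..<s}"
  by (rule inj_onI) (metis lessThan_iff less_imp_le linorder_neqE_nat nat_less_le spread_pos_strict)

lemma spread_outside: "i < lo \<or> lo + len \<le> i \<Longrightarrow> spread lo len xs a i = a i"
  by (auto simp: spread_def)

lemma spread_at:
  assumes "length xs \<le> len" "j < length xs"
  shows "spread lo len xs a (spread_pos lo len (length xs) j) = Some (xs ! j)"
proof -
  let ?ps = "map (\<lambda>j. (lo + j * len div length xs, xs ! j)) [0..<length xs]"
  have "distinct (map fst ?ps)"
    using spread_pos_inj[OF assms(1), of lo]
    by (auto simp: distinct_map spread_pos_def[abs_def] o_def atLeast0LessThan)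
  then have "map_of ?ps (spread_pos lo len (length xs) j) = Some (xs ! j)"
    using assms by (intro map_of_is_SomeI) (auto simp: spread_pos_def)
  then show ?thesis using spread_pos_bounds[OF assms] by (simp add: spread_def)
qed

lemma spread_inside:
  assumes "length xs \<le> len" "lo \<le> i" "i < lo + len"
  shows "spread lo len xs a i \<noteq> None \<longleftrightarrow> i \<in> spread_pos lo len (length xs) ` {..<length xs}"
proof
  assume "spread lo len xs a i \<noteq> None"
  then obtain y where "map_of (map (\<lambda>j. (lo + j * len div length xs, xs ! j)) [0..<length xs]) i = Some y"
    using assms by (auto simp: spread_def)
  from map_of_SomeD[OF this] show "i \<in> spread_pos lo len (length xs) ` {..<length xs}"
    by (auto simp: spread_pos_def)
qed (use spread_at[OF assms(1)] in auto)

lemma contents_spread: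
  assumes "length xs \<le> len"
  shows "contents (spread lo len xs a) lo len = xs"
proof -
  let ?s = "length xs" and ?a = "spread lo len xs a"
  let ?p = "spread_pos lo len (length xs)"
  have "filter (\<lambda>i. ?a i \<noteq> None) [lo..<lo + len] = map ?p [0..<?s]"
  proof (rule sorted_distinct_set_unique)
    show "sorted (map ?p [0..<?s])" "distinct (map ?p [0..<?s])"
      using spread_pos_strict[OF assms, of _ _ lo] spread_pos_inj[OF assms, of lo]
      by (auto simp: sorted_wrt_iff_nth_less less_imp_le distinct_map atLeast0LessThan)
    show "set (filter (\<lambda>i. ?a i \<noteq> None) [lo..<lo + len]) = set (map ?p [0..<?s])"
      using spread_inside[OF assms, of lo _ a] spread_pos_bounds[OF assms, of _ lo]
      by (auto simp: atLeast0LessThan)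
  qed (auto simp: sorted_wrt_filter)
  then have "contents ?a lo len = map (\<lambda>i. the (?a i)) (map ?p [0..<?s])"
    by (simp only: contents_def map_filter_eq)
  also have "\<dots> = map (\<lambda>j. xs ! j) [0..<?s]"
    using spread_at[OF assms, of _ lo a] by simp
  finally show ?thesis by (simp add: map_nth)
qed

lemma moves_spread_le:
  assumes "length xs \<le> len"
  shows "moves a (spread lo len xs a) \<le> length xs"
proof -
  have "{i. spread lo len xs a i \<noteq> None \<and> spread lo len xs a i \<noteq> a i}
          \<subseteq> spread_pos lo len (length xs) ` {..<length xs}"
    using spread_inside[OF assms, of lo _ a] spread_outside[of _ lo len xs a]
    by (auto simp: not_le not_less) (metis not_le)
  then have "moves a (spread lo len xs a) \<le> card (spread_pos lo len (length xs) ` {..<length xs})"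
    unfolding moves_def by (intro card_mono) auto
  also have "\<dots> \<le> length xs" by (metis card_image_le card_lessThan finite_lessThan)
  finally show ?thesis .
qed

text \<open>The additive error 1 holds for every interval with one common density, so a subarray
  inherits the property with the same \<open>\<rho>\<close>. Recursive creation needs this, since it
  forms children without moving elements.\<close>

definition evenly :: "real \<Rightarrow> 'a slots \<Rightarrow> nat \<Rightarrow> nat \<Rightarrow> bool" where
  "evenly \<rho> a lo len \<longleftrightarrow> 0 \<le> \<rho> \<and> \<rho> \<le> 1 \<and>
     (\<forall>p q. p + q \<le> len \<longrightarrow> \<bar>real (length (contents a (lo + p) q)) - \<rho> * real q\<bar> \<le> 1)"

lemma evenlyD:
  "evenly \<rho> a lo len \<Longrightarrow> p + q \<le> len \<Longrightarrow> \<bar>real (length (contents a (lo + p) q)) - \<rho> * real q\<bar> \<le> 1"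
  by (simp add: evenly_def)

lemma evenly_sub:
  assumes "evenly \<rho> a lo len" "p + q \<le> len"
  shows "evenly \<rho> a (lo + p) q"
  using assms unfolding evenly_def by (auto simp: add.assoc)

text \<open>Since floor (j len / s) < q exactly if j len < q s, this counts the elements placed in
  the first \<open>q\<close> slots: there are ceil (q s / len) of them.\<close>

lemma card_multiples_below:
  assumes "q \<le> len" "s > 0" "len > 0"
  shows "real (card {j. j < s \<and> j * len < q * s}) \<ge> real q * real s / real len"
    and "real (card {j. j < s \<and> j * len < q * s}) \<le> real q * real s / real len + 1"
proof -
  define N where "N = nat \<lceil>real q * real s / real len\<rceil>"
  have N: "real N \<ge> real q * real s / real len" "real N < real q * real s / real len + 1"
    unfolding N_def using assms by (auto simp: of_nat_ceiling) linarith
  have lt: "j * len < q * s \<longleftrightarrow> j < N" for j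
  proof -
    have "j * len < q * s \<longleftrightarrow> real j * real len < real q * real s"
      by (metis of_nat_less_iff of_nat_mult)
    also have "\<dots> \<longleftrightarrow> real j < real q * real s / real len"
      using assms by (simp add: pos_less_divide_eq)
    also have "\<dots> \<longleftrightarrow> j < N" using N by (auto simp: N_def less_ceiling_iff zless_nat_eq_int_zless)
    finally show ?thesis .
  qed
  have "j < s" if "j * len < q * s" for j
    using that mult_le_mono1[OF assms(1), of s] by (metis less_le_trans mult.commute mult_less_cancel2)
  then have "{j. j < s \<and> j * len < q * s} = {..<N}"
    using lt by blast
  then show "real (card {j. j < s \<and> j * len < q * s}) \<ge> real q * real s / real len"
    "real (card {j. j < s \<and> j * len < q * s}) \<le> real q * real s / real len + 1"
    using N by auto
qed

text \<open>The counts in two prefixes are each rounded up from the exact share, so the count in the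
  interval between them errs by at most 1.\<close>

lemma evenly_spread:
  assumes "length xs \<le> len" "len > 0"
  shows "evenly (real (length xs) / real len) (spread lo len xs a) lo len"
  unfolding evenly_def
proof (intro conjI allI impI)
  fix p q assume pq: "p + q \<le> len"
  let ?s = "length xs"
  show "\<bar>real (length (contents (spread lo len xs a) (lo + p) q)) - real ?s / real len * real q\<bar> \<le> 1"
  proof (cases "?s = 0")
    case True
    then have "{i. lo + p \<le> i \<and> i < lo + p + q \<and> spread lo len xs a i \<noteq> None} = {}"
      using pq by (auto simp: spread_def)
    then show ?thesis using True by (simp only: length_contents_card) simp
  next
    case False
    define A where "A = (\<lambda>q. {j. j < ?s \<and> j * len < q * ?s})"
    have "{i. lo + p \<le> i \<and> i < lo + p + q \<and> spread lo len xs a i \<noteq> None}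
        = spread_pos lo len ?s ` {j. j < ?s \<and> p \<le> j * len div ?s \<and> j * len div ?s < p + q}"
    proof (intro set_eqI)
      fix i
      show "i \<in> {i. lo + p \<le> i \<and> i < lo + p + q \<and> spread lo len xs a i \<noteq> None} \<longleftrightarrow>
        i \<in> spread_pos lo len ?s ` {j. j < ?s \<and> p \<le> j * len div ?s \<and> j * len div ?s < p + q}"
        using spread_inside[OF assms(1), of lo i a] pq
        by (cases "lo + p \<le> i \<and> i < lo + p + q") (auto simp: spread_pos_def image_iff)
    qed
    also have "{j. j < ?s \<and> p \<le> j * len div ?s \<and> j * len div ?s < p + q} = A (p + q) - A p"
      using False by (auto simp: A_def div_less_iff_less_mult less_eq_div_iff_mult_less_eq not_less)
    finally have "length (contents (spread lo len xs a) (lo + p) q) = card (spread_pos lo len ?s ` (A (p + q) - A p))"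
      by (simp add: length_contents_card)
    also have "\<dots> = card (A (p + q) - A p)"
      using spread_pos_inj[OF assms(1), of lo] by (intro card_image) (auto simp: A_def inj_on_def)
    also have "\<dots> = card (A (p + q)) - card (A p)"
      by (rule card_Diff_subset) (auto simp: A_def intro: less_le_trans mult_le_mono1)
    finally have len: "length (contents (spread lo len xs a) (lo + p) q) = card (A (p + q)) - card (A p)" .
    have "card (A p) \<le> card (A (p + q))"
      by (rule card_mono) (auto simp: A_def intro: less_le_trans mult_le_mono1)
    then have "real (length (contents (spread lo len xs a) (lo + p) q)) = real (card (A (p + q))) - real (card (A p))"
      using len by simp
    moreover have "real (p + q) * real ?s / real len = real p * real ?s / real len + real ?s / real len * real q"
      using assms by (simp add: field_simps)
    moreover have "p \<le> len" "?s > 0" using pq False by auto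
    ultimately show ?thesis
      using card_multiples_below[OF pq \<open>?s > 0\<close> assms(2)] card_multiples_below[OF \<open>p \<le> len\<close> \<open>?s > 0\<close> assms(2)]
      unfolding A_def abs_le_iff by auto
  qed
qed (use assms in auto)

section \<open>Amortized analysis of leaves\<close>

text \<open>Aligned blocks are nested: the block of height \<open>h\<close> around segment
  \<open>s\<close> lies inside the one of height \<open>h'\<close>.\<close>

lemma div_power_mono:
  fixes s :: nat
  assumes "h \<le> h'"
  shows "s div 2 ^ h' * 2 ^ h' \<le> s div 2 ^ h * 2 ^ h"
    and "(s div 2 ^ h + 1) * 2 ^ h \<le> (s div 2 ^ h' + 1) * 2 ^ h'"
proof -
  define d where "d = h' - h"
  have h': "h' = h + d" using assms by (simp add: d_def)
  have s: "s div 2 ^ h' = s div 2 ^ h div 2 ^ d"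
    by (simp add: h' power_add div_mult2_eq)
  have "s div 2 ^ h div 2 ^ d * 2 ^ d \<le> s div 2 ^ h" by simp
  then show "s div 2 ^ h' * 2 ^ h' \<le> s div 2 ^ h * 2 ^ h"
    unfolding s unfolding h' power_add by (metis mult.assoc mult.commute mult_le_mono1)
  have "s div 2 ^ h < (s div 2 ^ h div 2 ^ d + 1) * 2 ^ d"
    by (metis add.commute add_mult_distrib dividend_less_times_div mult.commute mult_1
        plus_1_eq_Suc pos2 zero_less_power)
  then have "s div 2 ^ h + 1 \<le> (s div 2 ^ h div 2 ^ d + 1) * 2 ^ d" by simp
  then show "(s div 2 ^ h + 1) * 2 ^ h \<le> (s div 2 ^ h' + 1) * 2 ^ h'"
    unfolding s unfolding h' power_add by (metis mult.assoc mult.commute mult_le_mono1)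
qed

text \<open>Below height 7 the rounding errors of \<^const>\<open>spread\<close> are not dominated by the gaps between
  consecutive thresholds, but the windows are so small that no amortization is needed.\<close>

definition ikr_block_size :: "nat \<Rightarrow> nat \<Rightarrow> nat \<Rightarrow> nat" where
  "ikr_block_size len h b = ikr_bound len ((b + 1) * 2 ^ h) - ikr_bound len (b * 2 ^ h)"

definition ikr_block_count :: "'a slots \<Rightarrow> nat \<Rightarrow> nat \<Rightarrow> nat \<Rightarrow> nat \<Rightarrow> nat" where
  "ikr_block_count a lo len h b =
     length (contents a (lo + ikr_bound len (b * 2 ^ h)) (ikr_block_size len h b))"

text \<open>The reference density lies halfway between the thresholds of heights \<open>h\<close>
  and \<open>h + 1\<close>. Up to rounding, a block that overflows is half a gap above it, and a
  block inside a freshly rewritten larger window at least half a gap below it.\<close>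

definition ikr_excess :: "'a slots \<Rightarrow> nat \<Rightarrow> nat \<Rightarrow> nat \<Rightarrow> nat \<Rightarrow> real" where
  "ikr_excess a lo len h b = max 0 (real (ikr_block_count a lo len h b)
     - (1 - (real h + 1 / 2) / (10 * real (ikr_levels len))) * real (ikr_block_size len h b))"

text \<open>Let H be the number of levels. An overflowing block of size z has excess about z / (20
  H); with the factor 100 H this releases about 5 z, enough to rewrite its parent of size about 2
  z.\<close>

definition ikr_potential :: "'a slots \<Rightarrow> nat \<Rightarrow> nat \<Rightarrow> real" where
  "ikr_potential a lo len = (\<Sum>h\<in>{7..<ikr_levels len}. 100 * real (ikr_levels len) *
     (\<Sum>b<2 ^ (ikr_levels len - h). ikr_excess a lo len h b))"

text \<open>A quarter of this is the growth of the potential, 100 H on each of at most H levels. The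
  rest covers windows of height at most 7, which are rewritten without help from the
  potential.\<close>

definition ikr_cost :: "nat \<Rightarrow> real" where
  "ikr_cost len = 400 * (log 2 (real len))\<^sup>2"

lemma ikr_potential_nonneg: "ikr_potential a lo len \<ge> 0"
  by (auto simp: ikr_potential_def ikr_excess_def intro!: sum_nonneg mult_nonneg_nonneg)

lemma ikr_potential_cong:
  assumes "\<And>i. lo \<le> i \<Longrightarrow> i < lo + len \<Longrightarrow> b i = a i"
  shows "ikr_potential b lo len = ikr_potential a lo len"
proof -
  let ?H = "ikr_levels len"
  have "ikr_block_count b lo len h j = ikr_block_count a lo len h j" if "h \<in> {7..<?H}" "j < 2 ^ (?H - h)" for h j
  proof -
    have "(j + 1) * 2 ^ h \<le> 2 ^ (?H - h) * 2 ^ h" using that by (intro mult_right_mono) auto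
    also have "\<dots> = 2 ^ ?H" using that by (simp flip: power_add)
    finally have "ikr_bound len ((j + 1) * 2 ^ h) \<le> 2 ^ ?H * len div 2 ^ ?H"
      unfolding ikr_bound_def by (intro div_le_mono mult_right_mono) auto
    then have "ikr_bound len ((j + 1) * 2 ^ h) \<le> len" by simp
    then show ?thesis
      unfolding ikr_block_count_def ikr_block_size_def using assms
      by (intro arg_cong[where f = length] contents_cong) auto
  qed
  then show ?thesis
    unfolding ikr_potential_def ikr_excess_def by (intro sum.cong refl arg_cong2[where f = "(*)"]) auto
qed

section \<open>Geometry of the segments of a leaf\<close>

locale ikr_region =
  fixes len :: nat
  assumes log_ge: "log 2 (real len) \<ge> 1" and log_le: "2 * log 2 (real len) \<le> real len"
begin

abbreviation (input) "H \<equiv> ikr_levels len"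
abbreviation (input) "bd \<equiv> ikr_bound len"
abbreviation (input) "seg_len \<equiv> real len / 2 ^ H"

lemma len_pos: "len > 0"
  using log_ge log_le by (cases len) auto

lemma levels_bounds:
  "H \<ge> 1" "real H \<le> log 2 (real len)" "log 2 (real len) \<le> seg_len" "seg_len \<le> 2 * log 2 (real len)"
proof -
  let ?l = "log 2 (real len)" and ?x = "real len / log 2 (real len)"
  have x: "?x \<ge> 2" using log_ge log_le by (simp add: field_simps)
  then have "log 2 ?x \<ge> log 2 2" by (subst log_le_cancel_iff) auto
  then have l1: "log 2 ?x \<ge> 1" by simp
  then have H: "real H \<le> log 2 ?x" "log 2 ?x < real H + 1"
    unfolding ikr_levels_def by linarith+
  show "H \<ge> 1" using l1 H by linarith
  have "?x \<le> real len" using log_ge divide_left_mono[of 1 ?l "real len"] by simp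
  then have "log 2 ?x \<le> ?l" using x len_pos by (subst log_le_cancel_iff) auto
  then show "real H \<le> ?l" using H by simp
  have "2 powr real H \<le> ?x" using H x by (subst powr_le_iff) auto
  then have 1: "2 ^ H \<le> ?x" by (simp add: powr_realpow)
  have "?x < 2 powr (real H + 1)" using H x by (subst less_powr_iff) auto
  then have 2: "?x < 2 * 2 ^ H" by (simp add: powr_add powr_realpow)
  show "?l \<le> seg_len" using 1 log_ge by (simp add: field_simps)
  show "seg_len \<le> 2 * ?l" using 2 log_ge by (simp add: field_simps)
qed

lemma bound_mono: "i \<le> j \<Longrightarrow> bd i \<le> bd j"
  by (simp add: ikr_bound_def div_le_mono)

lemma bound_0 [simp]: "bd 0 = 0"
  by (simp add: ikr_bound_def)

lemma bound_full [simp]: "bd (2 ^ H) = len"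
  by (simp add: ikr_bound_def)

lemma bound_real: "real (bd j) \<le> real j * seg_len" "real j * seg_len < real (bd j) + 1"
proof -
  have "real (bd j) = real_of_int \<lfloor>real (j * len) / real (2 ^ H)\<rfloor>"
    by (simp add: ikr_bound_def floor_divide_of_nat_eq del: of_nat_mult of_nat_power)
  then have "real (bd j) = real_of_int \<lfloor>real j * seg_len\<rfloor>" by simp
  then show "real (bd j) \<le> real j * seg_len" "real j * seg_len < real (bd j) + 1" by linarith+
qed

lemma block_size_bounds:
  "real (ikr_block_size len h b) > 2 ^ h * seg_len - 1"
  "real (ikr_block_size len h b) < 2 ^ h * seg_len + 1"
proof -
  have "bd (b * 2 ^ h) \<le> bd ((b + 1) * 2 ^ h)" by (rule bound_mono) simp
  then have "real (ikr_block_size len h b) = real (bd ((b + 1) * 2 ^ h)) - real (bd (b * 2 ^ h))"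
    by (simp add: ikr_block_size_def)
  moreover have "real ((b + 1) * 2 ^ h) * seg_len - real (b * 2 ^ h) * seg_len = 2 ^ h * seg_len"
    by (simp add: algebra_simps add_divide_distrib)
  ultimately show "real (ikr_block_size len h b) > 2 ^ h * seg_len - 1"
    "real (ikr_block_size len h b) < 2 ^ h * seg_len + 1"
    using bound_real[of "(b + 1) * 2 ^ h"] bound_real[of "b * 2 ^ h"] by linarith+
qed

text \<open>Half a gap between thresholds is worth z / (20 H) elements in a block of size z, so from
  this height on it absorbs the rounding error 1 of \<open>spread\<close>.\<close>

lemma large_block:
  assumes "h \<ge> 7"
  shows "real (ikr_block_size len h b) \<ge> 20 * real H"
proof -
  have "(2::real) ^ 7 \<le> 2 ^ h" using assms by (intro power_increasing) auto
  then have "2 ^ 7 * seg_len \<le> 2 ^ h * seg_len" by (intro mult_right_mono) auto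
  then show ?thesis
    using block_size_bounds[of h b] levels_bounds log_ge by simp
qed

lemma segment:
  assumes "q < len"
  defines "s \<equiv> ikr_segment len q"
  shows "s < 2 ^ H" "bd s \<le> q" "q < bd (s + 1)"
proof -
  let ?J = "{j. j < 2 ^ H \<and> bd j \<le> q}"
  have fin: "finite ?J" by (rule finite_subset[of _ "{..<2 ^ H}"]) auto
  have "0 \<in> ?J" unfolding mem_Collect_eq by (simp only: bound_0) simp
  then have "s \<in> ?J" unfolding s_def ikr_segment_def using fin by (intro Max_in) blast+
  then show s: "s < 2 ^ H" "bd s \<le> q" by auto
  show "q < bd (s + 1)"
  proof (rule ccontr)
    assume n: "\<not> q < bd (s + 1)"
    show False
    proof (cases "s + 1 < 2 ^ H")
      case True
      then have "s + 1 \<in> ?J" using n by simp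
      then have "s + 1 \<le> s" unfolding s_def ikr_segment_def using fin by (intro Max_ge) auto
      then show False by simp
    next
      case False
      then have "s + 1 = 2 ^ H" using s by simp
      then show False using n assms by simp
    qed
  qed
qed

lemma block_in_region:
  assumes "s < 2 ^ H" "h \<le> H"
  shows "s div 2 ^ h < 2 ^ (H - h)" "bd ((s div 2 ^ h + 1) * 2 ^ h) \<le> len"
proof -
  have "s < 2 ^ (H - h) * 2 ^ h" using assms by (simp flip: power_add)
  then show 1: "s div 2 ^ h < 2 ^ (H - h)" by (simp add: div_less_iff_less_mult)
  then have "(s div 2 ^ h + 1) * 2 ^ h \<le> 2 ^ (H - h) * 2 ^ h" by (intro mult_right_mono) auto
  also have "\<dots> = 2 ^ H" using assms by (simp flip: power_add)
  finally have "bd ((s div 2 ^ h + 1) * 2 ^ h) \<le> bd (2 ^ H)" by (rule bound_mono)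
  then show "bd ((s div 2 ^ h + 1) * 2 ^ h) \<le> len" by simp
qed

text \<open>Up to one element per block, the density is at most 0.851 everywhere, while all
  reference densities are at least 9/10. The lower bound on \<open>len\<close> absorbs the rounding
  in \<open>\<rho>\<close>.\<close>

lemma potential_evenly_zero:
  assumes even: "evenly \<rho> a lo len" and dens: "real (length (contents a lo len)) \<le> 17 / 20 * real len"
    and len: "len \<ge> 1000"
  shows "ikr_potential a lo len = 0"
proof -
  have H: "real H > 0" using levels_bounds(1) by simp
  have "\<bar>real (length (contents a (lo + 0) len)) - \<rho> * real len\<bar> \<le> 1"
    using evenlyD[OF even, of 0 len] by simp
  then have "\<rho> * real len \<le> 17 / 20 * real len + 1" using dens by simp
  also have "\<dots> \<le> 851 / 1000 * real len" using len by simp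
  finally have \<rho>: "\<rho> \<le> 851 / 1000" using len by simp
  have "ikr_excess a lo len h b = 0" if "h \<in> {7..<H}" "b < 2 ^ (H - h)" for h b
  proof -
    let ?z = "real (ikr_block_size len h b)"
    have "(b + 1) * 2 ^ h \<le> 2 ^ (H - h) * 2 ^ h" using that by (intro mult_right_mono) auto
    also have "\<dots> = 2 ^ H" using that by (simp flip: power_add)
    finally have "bd ((b + 1) * 2 ^ h) \<le> bd (2 ^ H)" by (rule bound_mono)
    moreover have "bd (b * 2 ^ h) \<le> bd ((b + 1) * 2 ^ h)" by (rule bound_mono) simp
    ultimately have "bd (b * 2 ^ h) + ikr_block_size len h b \<le> len"
      by (simp add: ikr_block_size_def)
    then have "\<bar>real (ikr_block_count a lo len h b) - \<rho> * ?z\<bar> \<le> 1"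
      using evenlyD[OF even] unfolding ikr_block_count_def by blast
    then have "real (ikr_block_count a lo len h b) \<le> \<rho> * ?z + 1" by linarith
    also have "\<rho> * ?z \<le> 851 / 1000 * ?z" using \<rho> by (intro mult_right_mono) auto
    finally have c: "real (ikr_block_count a lo len h b) \<le> 851 / 1000 * ?z + 1" by simp
    have "real h + 1 / 2 \<le> real H" using that by simp
    then have "(real h + 1 / 2) / (10 * real H) \<le> 1 / 10" using H by (simp add: field_simps)
    then have "9 / 10 * ?z \<le> (1 - (real h + 1 / 2) / (10 * real H)) * ?z" by (intro mult_right_mono) auto
    moreover have "?z \<ge> 140"
      using large_block[of h b] that by simp
    ultimately have "real (ikr_block_count a lo len h b) \<le> (1 - (real h + 1 / 2) / (10 * real H)) * ?z"
      using c by linarith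
    then show ?thesis by (simp add: ikr_excess_def)
  qed
  then show ?thesis by (simp add: ikr_potential_def)
qed

section \<open>One insertion into a leaf\<close>

context
  fixes a a' :: "'a::linorder slots" and lo c c' :: nat and x :: 'a
  assumes sorted: "sorted_wrt (<) (contents a lo len)" and new: "x \<notin> set (contents a lo len)"
    and dens: "real (length (contents a lo len)) + 1 \<le> 17 / 20 * real len"
    and result: "ikr_insert lo len x (a, c) = (a', c')"
begin

text \<open>\<open>q\<close> is the slot of the predecessor and \<open>s\<close> its segment.
  \<open>W h\<close> is the current contents of the window of height \<open>h\<close>;
  \<open>h\<^sub>0\<close>, \<open>w\<^sub>0\<close>, \<open>z\<^sub>0\<close> are height, relative
  start and size of the window that gets rewritten.\<close>

definition q where "q = ikr_slot a lo len x"
definition s where "s = ikr_segment len q"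
definition W where "W h = contents a (lo + bd (s div 2 ^ h * 2 ^ h)) (ikr_block_size len h (s div 2 ^ h))"
definition h\<^sub>0 where "h\<^sub>0 = (LEAST h. h = H \<or>
   real (length (W h) + 1) \<le> ikr_threshold len h * real (ikr_block_size len h (s div 2 ^ h)))"
definition w\<^sub>0 where "w\<^sub>0 = bd (s div 2 ^ h\<^sub>0 * 2 ^ h\<^sub>0)"
definition z\<^sub>0 where "z\<^sub>0 = ikr_block_size len h\<^sub>0 (s div 2 ^ h\<^sub>0)"

lemma W_eq: "W h\<^sub>0 = contents a (lo + w\<^sub>0) z\<^sub>0"
  by (simp add: W_def w\<^sub>0_def z\<^sub>0_def)

lemma insert_eq: "(a', c') = place (lo + w\<^sub>0) z\<^sub>0 (insort x (W h\<^sub>0)) (a, c)"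
  using result unfolding ikr_insert_def Let_def ikr_size_def ikr_start_def fst_conv
    q_def[symmetric] s_def[symmetric] ikr_block_size_def[symmetric] W_def[symmetric]
    h\<^sub>0_def[symmetric] w\<^sub>0_def[symmetric] z\<^sub>0_def[symmetric] W_eq by (rule sym)

lemma slot_less: "q < len"
proof -
  let ?P = "{q. q < len \<and> (\<exists>y. a (lo + q) = Some y \<and> y < x)}"
  have "Max ?P \<in> ?P" if "?P \<noteq> {}" using that by (intro Max_in) auto
  then show ?thesis unfolding q_def ikr_slot_def Let_def using len_pos by auto
qed

lemma slot_above:
  assumes "q < i" "i < len" "a (lo + i) = Some y"
  shows "x < y"
proof (rule ccontr)
  let ?P = "{q. q < len \<and> (\<exists>y. a (lo + q) = Some y \<and> y < x)}"
  assume "\<not> x < y"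
  moreover have "y \<in> set (contents a lo len)"
    unfolding set_contents using assms by (auto intro!: exI[of _ "lo + i"])
  then have "y \<noteq> x" using new by auto
  ultimately have i: "i \<in> ?P" using assms by auto
  then have "q = Max ?P" unfolding q_def ikr_slot_def Let_def by auto
  moreover have "i \<le> Max ?P" using i by (intro Max_ge) auto
  ultimately show False using assms by simp
qed

text \<open>A slot left of \<open>q\<close> excludes the default \<open>q = 0\<close> of an empty
  set of predecessors, so \<open>q\<close> holds an element below \<open>x\<close>, and sortedness
  does the rest.\<close>

lemma slot_below:
  assumes "i < q" "a (lo + i) = Some y"
  shows "y < x"
proof -
  let ?P = "{q. q < len \<and> (\<exists>y. a (lo + q) = Some y \<and> y < x)}"
  have P: "?P \<noteq> {}" "q = Max ?P" using assms unfolding q_def ikr_slot_def Let_def by (auto split: if_splits)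
  then have "q \<in> ?P" using Max_in[of ?P] by auto
  then obtain z where z: "q < len" "a (lo + q) = Some z" "z < x" by auto
  then have "y < z" using sorted assms unfolding sorted_contents_iff by (meson add_less_cancel_left le_add1)
  then show ?thesis using z by simp
qed

lemma height: "h\<^sub>0 \<le> H"
  "h\<^sub>0 = H \<or> real (length (W h\<^sub>0) + 1) \<le> ikr_threshold len h\<^sub>0 * real z\<^sub>0"
  "h < h\<^sub>0 \<Longrightarrow> real (length (W h) + 1) > ikr_threshold len h * real (ikr_block_size len h (s div 2 ^ h))"
proof -
  let ?P = "\<lambda>h. h = H \<or> real (length (W h) + 1) \<le> ikr_threshold len h * real (ikr_block_size len h (s div 2 ^ h))"
  have "?P H" by simp
  then show "h\<^sub>0 \<le> H" unfolding h\<^sub>0_def by (rule Least_le)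
  show "h\<^sub>0 = H \<or> real (length (W h\<^sub>0) + 1) \<le> ikr_threshold len h\<^sub>0 * real z\<^sub>0"
    unfolding z\<^sub>0_def h\<^sub>0_def by (rule LeastI[of ?P H]) simp
  show "real (length (W h) + 1) > ikr_threshold len h * real (ikr_block_size len h (s div 2 ^ h))" if "h < h\<^sub>0"
    using not_less_Least[of h ?P] that unfolding h\<^sub>0_def[symmetric] by auto
qed

lemma window_end: "w\<^sub>0 + z\<^sub>0 = bd ((s div 2 ^ h\<^sub>0 + 1) * 2 ^ h\<^sub>0)"
proof -
  have "bd (s div 2 ^ h\<^sub>0 * 2 ^ h\<^sub>0) \<le> bd ((s div 2 ^ h\<^sub>0 + 1) * 2 ^ h\<^sub>0)" by (rule bound_mono) simp
  then show ?thesis by (simp add: w\<^sub>0_def z\<^sub>0_def ikr_block_size_def)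
qed

lemma window: "w\<^sub>0 \<le> q" "q < w\<^sub>0 + z\<^sub>0" "w\<^sub>0 + z\<^sub>0 \<le> len"
proof -
  note seg = segment[OF slot_less, folded s_def]
  have "w\<^sub>0 \<le> bd s" unfolding w\<^sub>0_def by (rule bound_mono) simp
  then show "w\<^sub>0 \<le> q" using seg by simp
  have "s + 1 \<le> (s div 2 ^ h\<^sub>0 + 1) * 2 ^ h\<^sub>0"
    using div_power_mono(2)[of 0 h\<^sub>0 s] by simp
  from bound_mono[OF this] show "q < w\<^sub>0 + z\<^sub>0" using seg window_end by simp
  show "w\<^sub>0 + z\<^sub>0 \<le> len" using block_in_region(2)[OF seg(1) height(1)] window_end by simp
qed

text \<open>At the top the search may have ended merely by default. There the window is the whole
  leaf, and the density hypothesis 17/20 lies below the threshold 9/10.\<close>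

lemma threshold: "real (length (W h\<^sub>0) + 1) \<le> ikr_threshold len h\<^sub>0 * real z\<^sub>0"
proof (cases "h\<^sub>0 = H")
  case True
  have seg: "s < 2 ^ H" using segment[OF slot_less, folded s_def] by simp
  then have "w\<^sub>0 = 0" "z\<^sub>0 = len"
    by (simp_all add: w\<^sub>0_def z\<^sub>0_def True ikr_block_size_def)
  then have "W h\<^sub>0 = contents a lo len" by (simp add: W_eq)
  moreover have "ikr_threshold len h\<^sub>0 = 9 / 10"
    using levels_bounds(1) by (simp add: ikr_threshold_def True)
  ultimately show ?thesis using dens by (simp only: \<open>z\<^sub>0 = len\<close>)
qed (use height in auto)

lemma fits: "length (insort x (W h\<^sub>0)) \<le> z\<^sub>0"
proof -
  have "ikr_threshold len h\<^sub>0 * real z\<^sub>0 \<le> 1 * real z\<^sub>0"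
    by (intro mult_right_mono) (auto simp: ikr_threshold_def)
  then show ?thesis using threshold by simp
qed

lemma a'_eq: "a' = spread (lo + w\<^sub>0) z\<^sub>0 (insort x (W h\<^sub>0)) a"
  and c'_le: "c' \<le> c + z\<^sub>0"
  using insert_eq fits moves_spread_le[OF fits, of a "lo + w\<^sub>0"] by (auto simp: place_def Let_def)

lemma outside_window: "i < lo + w\<^sub>0 \<or> lo + w\<^sub>0 + z\<^sub>0 \<le> i \<Longrightarrow> a' i = a i"
  unfolding a'_eq by (rule spread_outside)

lemma outside_region: "i < lo \<or> lo + len \<le> i \<Longrightarrow> a' i = a i"
  using window by (intro outside_window) auto

lemma window_contents: "contents a' (lo + w\<^sub>0) z\<^sub>0 = insort x (W h\<^sub>0)"
  unfolding a'_eq using fits by (rule contents_spread)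

lemma insert_contents: "contents a' lo len = insort x (contents a lo len)"
proof -
  let ?A = "contents a lo w\<^sub>0" and ?B = "contents a (lo + w\<^sub>0 + z\<^sub>0) (len - (w\<^sub>0 + z\<^sub>0))"
  have split: "contents b lo len = contents b lo w\<^sub>0 @ contents b (lo + w\<^sub>0) z\<^sub>0
      @ contents b (lo + w\<^sub>0 + z\<^sub>0) (len - (w\<^sub>0 + z\<^sub>0))" for b :: "'a slots"
    using contents_split[of lo "lo + w\<^sub>0" z\<^sub>0 len b] window by (simp add: diff_diff_add add.assoc)
  have A: "contents a' lo w\<^sub>0 = ?A" and B: "contents a' (lo + w\<^sub>0 + z\<^sub>0) (len - (w\<^sub>0 + z\<^sub>0)) = ?B"
    by (auto intro!: contents_cong outside_window)
  have "\<forall>y\<in>set ?A. y < x"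
  proof
    fix y assume "y \<in> set ?A"
    then obtain i where "lo \<le> i" "i < lo + w\<^sub>0" "a i = Some y" by (auto simp: set_contents)
    then show "y < x" using slot_below[of "i - lo" y] window by simp
  qed
  moreover have "\<forall>y\<in>set ?B. x < y"
  proof
    fix y assume "y \<in> set ?B"
    then obtain i where "lo + w\<^sub>0 + z\<^sub>0 \<le> i" "i < lo + len" "a i = Some y"
      using window by (auto simp: set_contents)
    then show "x < y" using slot_above[of "i - lo" y] window by simp
  qed
  ultimately have "insort x (?A @ W h\<^sub>0 @ ?B) = ?A @ insort x (W h\<^sub>0) @ ?B"
    by (simp add: insort_append_right insort_append_left)
  then show ?thesis unfolding split[of a'] split[of a] A B window_contents W_eq[symmetric] by simp
qed

lemma count_disjoint:
  assumes "(b + 1) * 2 ^ h \<le> s div 2 ^ h\<^sub>0 * 2 ^ h\<^sub>0 \<or> (s div 2 ^ h\<^sub>0 + 1) * 2 ^ h\<^sub>0 \<le> b * 2 ^ h"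
  shows "ikr_block_count a' lo len h b = ikr_block_count a lo len h b"
proof -
  have le: "bd (b * 2 ^ h) \<le> bd ((b + 1) * 2 ^ h)" by (rule bound_mono) simp
  from assms have "bd ((b + 1) * 2 ^ h) \<le> w\<^sub>0 \<or> w\<^sub>0 + z\<^sub>0 \<le> bd (b * 2 ^ h)"
    unfolding w\<^sub>0_def[symmetric] window_end unfolding w\<^sub>0_def using bound_mono by blast
  then show ?thesis unfolding ikr_block_count_def ikr_block_size_def using le
    by (intro arg_cong[where f = length] contents_cong outside_window) auto
qed

lemma count_containing:
  assumes "b * 2 ^ h \<le> s div 2 ^ h\<^sub>0 * 2 ^ h\<^sub>0" "(s div 2 ^ h\<^sub>0 + 1) * 2 ^ h\<^sub>0 \<le> (b + 1) * 2 ^ h"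
  shows "ikr_block_count a' lo len h b = ikr_block_count a lo len h b + 1"
proof -
  let ?l = "bd (b * 2 ^ h)" and ?z = "ikr_block_size len h b"
  have le: "?l \<le> bd ((b + 1) * 2 ^ h)" by (rule bound_mono) simp
  have 1: "?l \<le> w\<^sub>0" unfolding w\<^sub>0_def using assms(1) by (rule bound_mono)
  have 2: "w\<^sub>0 + z\<^sub>0 \<le> ?l + ?z"
    using bound_mono[OF assms(2)] le by (simp add: window_end ikr_block_size_def)
  have split: "contents b' (lo + ?l) ?z = contents b' (lo + ?l) (w\<^sub>0 - ?l) @ contents b' (lo + w\<^sub>0) z\<^sub>0
      @ contents b' (lo + w\<^sub>0 + z\<^sub>0) (?l + ?z - (w\<^sub>0 + z\<^sub>0))" for b' :: "'a slots"
    using contents_split[of "lo + ?l" "lo + w\<^sub>0" z\<^sub>0 ?z b'] 1 2 by (simp add: diff_diff_add add.assoc)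
  have A: "contents a' (lo + ?l) (w\<^sub>0 - ?l) = contents a (lo + ?l) (w\<^sub>0 - ?l)"
    and B: "contents a' (lo + w\<^sub>0 + z\<^sub>0) (?l + ?z - (w\<^sub>0 + z\<^sub>0)) = contents a (lo + w\<^sub>0 + z\<^sub>0) (?l + ?z - (w\<^sub>0 + z\<^sub>0))"
    using 1 by (auto intro!: contents_cong outside_window)
  show ?thesis
    unfolding ikr_block_count_def split[of a'] split[of a] A B window_contents W_eq[symmetric] by simp
qed

text \<open>The rewritten window meets the threshold of \<open>h\<^sub>0\<close>, hence that of
  \<open>h + 1\<close>, which is half a gap below the reference density of height \<open>h\<close>;
  the half gap outweighs the rounding error.\<close>

lemma excess_inside:
  assumes "h \<ge> 7" "h < h\<^sub>0"
    and "s div 2 ^ h\<^sub>0 * 2 ^ h\<^sub>0 \<le> b * 2 ^ h" "(b + 1) * 2 ^ h \<le> (s div 2 ^ h\<^sub>0 + 1) * 2 ^ h\<^sub>0"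
  shows "ikr_excess a' lo len h b = 0"
proof -
  let ?l = "bd (b * 2 ^ h)" and ?z = "ikr_block_size len h b"
  define \<rho> where "\<rho> = real (length (insort x (W h\<^sub>0))) / real z\<^sub>0"
  have z0: "z\<^sub>0 > 0" using fits by (cases z\<^sub>0) auto
  have H: "real H > 0" using levels_bounds(1) by simp
  have le: "?l \<le> bd ((b + 1) * 2 ^ h)" by (rule bound_mono) simp
  have 1: "w\<^sub>0 \<le> ?l" unfolding w\<^sub>0_def using assms(3) by (rule bound_mono)
  have 2: "?l + ?z \<le> w\<^sub>0 + z\<^sub>0"
    using bound_mono[OF assms(4)] le by (simp add: window_end ikr_block_size_def)
  have "evenly \<rho> a' (lo + w\<^sub>0) z\<^sub>0"
    unfolding a'_eq \<rho>_def using fits z0 by (rule evenly_spread)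
  then have "\<bar>real (length (contents a' (lo + w\<^sub>0 + (?l - w\<^sub>0)) ?z)) - \<rho> * real ?z\<bar> \<le> 1"
    using 1 2 by (intro evenlyD) auto
  then have c: "real (ikr_block_count a' lo len h b) \<le> \<rho> * real ?z + 1"
    using 1 by (simp add: ikr_block_count_def)
  have "\<rho> \<le> ikr_threshold len h\<^sub>0"
    using threshold z0 by (simp add: \<rho>_def field_simps)
  also have "\<dots> \<le> 1 - (real h + 1) / (10 * real H)"
    using assms(2) H by (simp add: ikr_threshold_def divide_right_mono)
  finally have "\<rho> * real ?z \<le> (1 - (real h + 1) / (10 * real H)) * real ?z"
    by (rule mult_right_mono) simp
  also have "\<dots> = (1 - (real h + 1 / 2) / (10 * real H)) * real ?z - real ?z / (20 * real H)"
    using H by (simp add: field_simps)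
  also have "\<dots> \<le> (1 - (real h + 1 / 2) / (10 * real H)) * real ?z - 1"
    using large_block[OF assms(1), of b] H by (simp add: field_simps)
  finally show ?thesis using c by (simp add: ikr_excess_def)
qed

lemma excess_step: "ikr_block_count a' lo len h b \<le> ikr_block_count a lo len h b + d \<Longrightarrow>
    ikr_excess a' lo len h b \<le> ikr_excess a lo len h b + real d"
  unfolding ikr_excess_def by (smt (verit) of_nat_add of_nat_le_iff of_nat_0_le_iff)

text \<open>Windows are aligned, so at or above \<open>h\<^sub>0\<close> one block of a level
  contains the rewritten window and gains one element, while all others are untouched.\<close>

lemma level_above:
  assumes "h\<^sub>0 \<le> h" "h \<le> H"
  shows "(\<Sum>b<2 ^ (H - h). ikr_excess a' lo len h b) \<le> (\<Sum>b<2 ^ (H - h). ikr_excess a lo len h b) + 1"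
proof -
  let ?b = "s div 2 ^ h"
  have seg: "s < 2 ^ H" using segment[OF slot_less, folded s_def] by simp
  note mono = div_power_mono[OF assms(1), of s]
  have "ikr_excess a' lo len h b \<le> ikr_excess a lo len h b + (if b = ?b then 1 else 0)" for b
  proof (cases "b = ?b")
    case True
    then show ?thesis using excess_step[of h b 1] count_containing[of b h] mono by simp
  next
    case False
    then consider "b + 1 \<le> ?b" | "?b + 1 \<le> b" by linarith
    then have "(b + 1) * 2 ^ h \<le> s div 2 ^ h\<^sub>0 * 2 ^ h\<^sub>0 \<or> (s div 2 ^ h\<^sub>0 + 1) * 2 ^ h\<^sub>0 \<le> b * 2 ^ h"
    proof cases
      case 1
      then show ?thesis using mono(1) mult_le_mono1[OF 1, of "2 ^ h"] by linarith
    next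
      case 2
      then show ?thesis using mono(2) mult_le_mono1[OF 2, of "2 ^ h"] by linarith
    qed
    then show ?thesis using excess_step[of h b 0] count_disjoint[of b h] False by simp
  qed
  then have "(\<Sum>b<2 ^ (H - h). ikr_excess a' lo len h b)
      \<le> (\<Sum>b<2 ^ (H - h). ikr_excess a lo len h b + (if b = ?b then 1 else 0))"
    by (rule sum_mono)
  also have "\<dots> \<le> (\<Sum>b<2 ^ (H - h). ikr_excess a lo len h b) + 1"
    by (simp add: sum.distrib)
  finally show ?thesis .
qed

lemma excess_below:
  assumes "7 \<le> h" "h < h\<^sub>0"
  shows "ikr_excess a' lo len h b \<le> ikr_excess a lo len h b"
proof -
  define d where "d = h\<^sub>0 - h"
  let ?S = "s div 2 ^ h\<^sub>0"
  have p: "(2::nat) ^ h\<^sub>0 = 2 ^ d * 2 ^ h" using assms by (simp add: d_def flip: power_add)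
  have S: "?S * 2 ^ h\<^sub>0 = (?S * 2 ^ d) * 2 ^ h" "(?S + 1) * 2 ^ h\<^sub>0 = ((?S + 1) * 2 ^ d) * 2 ^ h"
    by (simp_all only: p mult.assoc)
  consider "b + 1 \<le> ?S * 2 ^ d" | "(?S + 1) * 2 ^ d \<le> b" | "?S * 2 ^ d \<le> b" "b + 1 \<le> (?S + 1) * 2 ^ d"
    by linarith
  then show ?thesis
  proof cases
    case 1
    then have "ikr_block_count a' lo len h b = ikr_block_count a lo len h b"
      using mult_le_mono1[OF 1, of "2 ^ h"] by (intro count_disjoint) (simp only: S simp_thms)
    then show ?thesis using excess_step[of h b 0] by simp
  next
    case 2
    then have "ikr_block_count a' lo len h b = ikr_block_count a lo len h b"
      using mult_le_mono1[OF 2, of "2 ^ h"] by (intro count_disjoint) (simp only: S simp_thms)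
    then show ?thesis using excess_step[of h b 0] by simp
  next
    case 3
    then have "ikr_excess a' lo len h b = 0"
      using mult_le_mono1[OF 3(1), of "2 ^ h"] mult_le_mono1[OF 3(2), of "2 ^ h"] assms
      by (intro excess_inside) (simp_all only: S)
    then show ?thesis by (simp add: ikr_excess_def)
  qed
qed

text \<open>The window of height \<open>h\<^sub>0 - 1\<close> around the predecessor was refused
  because it would overflow, and the rewriting clears its excess. The potential released this way
  pays for the window of about twice the size.\<close>

lemma level_released:
  assumes "8 \<le> h\<^sub>0"
  shows "100 * real H * (\<Sum>b<2 ^ (H - (h\<^sub>0 - 1)). ikr_excess a' lo len (h\<^sub>0 - 1) b) + real z\<^sub>0
    \<le> 100 * real H * (\<Sum>b<2 ^ (H - (h\<^sub>0 - 1)). ikr_excess a lo len (h\<^sub>0 - 1) b)"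
proof -
  define h where "h = h\<^sub>0 - 1"
  have h: "7 \<le> h" "h < h\<^sub>0" "h \<le> H" "h\<^sub>0 = Suc h" using assms height(1) by (auto simp: h_def)
  let ?b = "s div 2 ^ h"
  let ?z = "real (ikr_block_size len h ?b)"
  have H: "real H > 0" using levels_bounds(1) by simp
  have seg: "s < 2 ^ H" using segment[OF slot_less, folded s_def] by simp
  have b: "?b < 2 ^ (H - h)" using block_in_region(1)[OF seg h(3)] .
  note mono = div_power_mono[of h h\<^sub>0 s]
  have zero: "ikr_excess a' lo len h ?b = 0"
    using h mono by (intro excess_inside) auto
  have "W h = contents a (lo + bd (?b * 2 ^ h)) (ikr_block_size len h ?b)" by (simp add: W_def)
  then have "real (ikr_block_count a lo len h ?b) + 1 > (1 - real h / (10 * real H)) * ?z"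
    using height(3)[OF h(2)] by (simp add: ikr_threshold_def ikr_block_count_def)
  then have "ikr_excess a lo len h ?b \<ge> (1 - real h / (10 * real H)) * ?z - (1 - (real h + 1 / 2) / (10 * real H)) * ?z - 1"
    unfolding ikr_excess_def by linarith
  also have "(1 - real h / (10 * real H)) * ?z - (1 - (real h + 1 / 2) / (10 * real H)) * ?z - 1 = ?z / (20 * real H) - 1"
    using H by (simp add: field_simps)
  finally have "100 * real H * (?z / (20 * real H) - 1) \<le> 100 * real H * ikr_excess a lo len h ?b"
    by (intro mult_left_mono) auto
  moreover have "100 * real H * (?z / (20 * real H) - 1) = 5 * ?z - 100 * real H"
    using H by (simp add: right_diff_distrib)
  ultimately have rel: "5 * ?z - 100 * real H \<le> 100 * real H * ikr_excess a lo len h ?b"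
    by simp
  have "(2::real) ^ 7 \<le> 2 ^ h" using h by (intro power_increasing) auto
  then have "2 ^ 7 * seg_len \<le> 2 ^ h * seg_len" by (intro mult_right_mono) auto
  moreover have "real z\<^sub>0 < 2 * 2 ^ h * seg_len + 1"
    using block_size_bounds(2)[of h\<^sub>0 "s div 2 ^ h\<^sub>0"] by (simp add: z\<^sub>0_def h(4))
  \<comment> \<open>With B = 2 ^ h * seg_len, the left side is about 2 B and 5 \<open>?z\<close>
    about 5 B. Since B is at least 128 log len, the difference 3 B dominates 100 H and the
    roundings.\<close>
  ultimately have "real z\<^sub>0 \<le> 5 * ?z - 100 * real H"
    using block_size_bounds(1)[of h ?b] levels_bounds log_ge by simp
  then have rel: "real z\<^sub>0 \<le> 100 * real H * ikr_excess a lo len h ?b" using rel by simp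
  have "(\<Sum>b<2 ^ (H - h). ikr_excess a' lo len h b)
      \<le> (\<Sum>b<2 ^ (H - h). ikr_excess a lo len h b - (if b = ?b then ikr_excess a lo len h ?b else 0))"
    using zero excess_below[OF h(1,2)] by (intro sum_mono) auto
  also have "\<dots> = (\<Sum>b<2 ^ (H - h). ikr_excess a lo len h b) - ikr_excess a lo len h ?b"
    using b by (simp add: sum_subtractf)
  finally have "100 * real H * (\<Sum>b<2 ^ (H - h). ikr_excess a' lo len h b)
     \<le> 100 * real H * ((\<Sum>b<2 ^ (H - h). ikr_excess a lo len h b) - ikr_excess a lo len h ?b)"
    by (intro mult_left_mono) auto
  then show ?thesis using rel unfolding h_def[symmetric] by (simp add: right_diff_distrib)
qed

text \<open>Each level rises by at most 100 H, and for \<open>h\<^sub>0 \<ge> 8\<close> the level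
  just below the window releases \<open>z\<^sub>0\<close>, which bounds the moves. Lower windows
  have O(log len) slots and are paid directly.\<close>

lemma insert_cost: "real c' + ikr_potential a' lo len \<le> real c + ikr_potential a lo len + ikr_cost len"
proof -
  let ?l = "log 2 (real len)"
  define F where "F = (\<lambda>a :: 'a slots. \<lambda>h. 100 * real H * (\<Sum>b<2 ^ (H - h). ikr_excess a lo len h b))"
  have pot: "ikr_potential b lo len = (\<Sum>h\<in>{7..<H}. F b h)" for b :: "'a slots"
    by (simp add: ikr_potential_def F_def)
  have step: "F a' h \<le> F a h + 100 * real H - (if h\<^sub>0 = Suc h then real z\<^sub>0 else 0)" if h: "h \<in> {7..<H}" for h
  proof (cases "h\<^sub>0 \<le> h")
    case True
    then have "(\<Sum>b<2 ^ (H - h). ikr_excess a' lo len h b) \<le> (\<Sum>b<2 ^ (H - h). ikr_excess a lo len h b) + 1"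
      using h by (intro level_above) auto
    then have "F a' h \<le> 100 * real H * ((\<Sum>b<2 ^ (H - h). ikr_excess a lo len h b) + 1)"
      unfolding F_def by (intro mult_left_mono) auto
    then show ?thesis using True by (simp add: F_def distrib_left)
  next
    case False
    then have "(\<Sum>b<2 ^ (H - h). ikr_excess a' lo len h b) \<le> (\<Sum>b<2 ^ (H - h). ikr_excess a lo len h b)"
      using h by (intro sum_mono excess_below) auto
    then have "F a' h \<le> F a h" unfolding F_def by (intro mult_left_mono) auto
    moreover have "F a' h + real z\<^sub>0 \<le> F a h" if "h\<^sub>0 = Suc h"
      using level_released that h by (simp add: F_def)
    ultimately show ?thesis by auto
  qed
  have "(\<Sum>h\<in>{7..<H}. F a' h) \<le> (\<Sum>h\<in>{7..<H}. F a h + 100 * real H - (if h\<^sub>0 = Suc h then real z\<^sub>0 else 0))"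
    by (intro sum_mono step)
  also have "\<dots> = (\<Sum>h\<in>{7..<H}. F a h) + real (H - 7) * (100 * real H) - (\<Sum>h\<in>{7..<H}. if h\<^sub>0 = Suc h then real z\<^sub>0 else 0)"
    by (simp add: sum.distrib sum_subtractf)
  moreover have "(\<Sum>h\<in>{7..<H}. if h\<^sub>0 = Suc h then real z\<^sub>0 else 0) \<ge> (if h\<^sub>0 \<ge> 8 then real z\<^sub>0 else 0)"
  proof (cases "h\<^sub>0 \<ge> 8")
    case True
    then have "h\<^sub>0 - 1 \<in> {7..<H}" using height(1) by auto
    then have "(\<Sum>h\<in>{7..<H}. if h\<^sub>0 = Suc h then real z\<^sub>0 else 0) \<ge> (if h\<^sub>0 = Suc (h\<^sub>0 - 1) then real z\<^sub>0 else 0)"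
      by (intro member_le_sum[where f = "\<lambda>h. if h\<^sub>0 = Suc h then real z\<^sub>0 else 0"]) auto
    then show ?thesis using True by simp
  qed (auto intro: sum_nonneg)
  ultimately have pot_le: "ikr_potential a' lo len \<le> ikr_potential a lo len + real (H - 7) * (100 * real H)
      - (if h\<^sub>0 \<ge> 8 then real z\<^sub>0 else 0)"
    by (simp add: pot)
  have "real (H - 7) * (100 * real H) \<le> ?l * (100 * ?l)"
    using levels_bounds log_ge by (intro mult_mono) auto
  define r where "r = real (H - 7) * (100 * real H)"
  from \<open>_ \<le> ?l * (100 * ?l)\<close> have 1: "real (H - 7) * (100 * real H) \<le> 100 * ?l\<^sup>2" by (simp add: power2_eq_square)
  have 2: "real z\<^sub>0 \<le> 300 * ?l\<^sup>2" if "\<not> h\<^sub>0 \<ge> 8"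
  proof -
    have "(2::real) ^ h\<^sub>0 \<le> 2 ^ 7" using that by (intro power_increasing) auto
    then have "2 ^ h\<^sub>0 * seg_len \<le> 2 ^ 7 * seg_len" by (intro mult_right_mono) auto
    then have "real z\<^sub>0 \<le> 300 * ?l"
      using block_size_bounds(2)[of h\<^sub>0 "s div 2 ^ h\<^sub>0"] levels_bounds log_ge
      unfolding z\<^sub>0_def[symmetric] by simp
    also have "?l \<le> ?l\<^sup>2" using log_ge by (simp add: power2_eq_square)
    finally show ?thesis by simp
  qed
  have "real c' \<le> real c + real z\<^sub>0" using c'_le by (metis of_nat_add of_nat_le_iff)
  moreover have "r \<le> 400 * ?l\<^sup>2" using 1[folded r_def] zero_le_power2[of ?l] by linarith
  ultimately show ?thesis
    using pot_le[folded r_def] 1[folded r_def] 2 unfolding ikr_cost_def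
    by (cases "8 \<le> h\<^sub>0") auto
qed

end

end

section \<open>Dyadic energies of a sequence of directions\<close>

definition walk :: "(nat \<Rightarrow> real) \<Rightarrow> nat \<Rightarrow> real" where
  "walk \<sigma> t = (\<Sum>u<t. \<sigma> u)"

text \<open>Direction 0 stands for the absence of an insertion, so a prefix is again a sequence of
  full length and every result on full lifetimes applies to it.\<close>

definition truncate :: "nat \<Rightarrow> (nat \<Rightarrow> real) \<Rightarrow> nat \<Rightarrow> real" where
  "truncate v \<sigma> t = (if t < v then \<sigma> t else 0)"

lemma walk_0 [simp]: "walk \<sigma> 0 = 0"
  by (simp add: walk_def)

lemma walk_Suc: "walk \<sigma> (Suc t) = walk \<sigma> t + \<sigma> t"
  by (simp add: walk_def)

lemma walk_diff: "s \<le> t \<Longrightarrow> walk \<sigma> t - walk \<sigma> s = (\<Sum>u\<in>{s..<t}. \<sigma> u)"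
  by (simp add: walk_def sum_diff_nat_ivl flip: atLeast0LessThan)

lemma walk_truncate: "walk (truncate v \<sigma>) t = walk \<sigma> (min t v)"
  by (induction t) (auto simp: walk_Suc truncate_def min_def not_le less_Suc_eq)

lemma walk_abs_le: "(\<And>t. \<bar>\<sigma> t\<bar> \<le> 1) \<Longrightarrow> \<bar>walk \<sigma> t\<bar> \<le> real t"
proof -
  assume b: "\<And>t. \<bar>\<sigma> t\<bar> \<le> 1"
  have "\<bar>walk \<sigma> t\<bar> \<le> (\<Sum>u<t. \<bar>\<sigma> u\<bar>)" unfolding walk_def by (rule sum_abs)
  also have "\<dots> \<le> real (card {..<t}) * 1" using b by (intro sum_bounded_above) auto
  finally show ?thesis by simp
qed

text \<open>\<open>K\<close> is the largest skew and \<open>q\<close> the length of the shortest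
  window; \<open>win 0\<close> is then a whole lifetime.\<close>

locale dyadic =
  fixes K q :: nat
  assumes q_pos: "q > 0"
begin

definition win :: "nat \<Rightarrow> nat" where "win k = 2 ^ (K - k) * q"

definition block :: "(nat \<Rightarrow> real) \<Rightarrow> nat \<Rightarrow> nat \<Rightarrow> real" where
  "block \<sigma> k j = walk \<sigma> ((j + 1) * win k) - walk \<sigma> (j * win k)"

definition energy :: "(nat \<Rightarrow> real) \<Rightarrow> nat \<Rightarrow> real" where
  "energy \<sigma> k = (\<Sum>j<2 ^ k. (block \<sigma> k j)\<^sup>2)"

lemma win_pos: "win k > 0"
  using q_pos by (simp add: win_def)

lemma win_Suc: "k < K \<Longrightarrow> win k = 2 * win (Suc k)"
  by (simp add: win_def Suc_diff_Suc flip: power_Suc)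

lemma win_total: "k \<le> K \<Longrightarrow> 2 ^ k * win k = win 0"
  by (simp add: win_def flip: power_add)

lemma win_le: "k \<le> K \<Longrightarrow> win k \<le> win 0"
  by (simp add: win_def)

lemma real_win: "k \<le> K \<Longrightarrow> real (win k) = real (win 0) / 2 ^ k"
  by (metis win_total of_nat_mult of_nat_power of_nat_numeral nonzero_mult_div_cancel_left
      power_not_zero zero_neq_numeral)

lemma energy_nonneg: "energy \<sigma> k \<ge> 0"
  by (simp add: energy_def sum_nonneg)

lemma sum_even_odd: "(\<Sum>j<2 * N. f j) = (\<Sum>j<N. f (2 * j) + f (2 * j + 1 :: nat) :: real)"
  by (induction N) auto

lemma sum_lessThan_add: "(\<Sum>i<a + b. f i) = (\<Sum>i<a. f i) + (\<Sum>i<b. f (a + i :: nat) :: real)"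
  by (induction b) auto

lemma block_split:
  assumes "k < K"
  shows "block \<sigma> k j = block \<sigma> (Suc k) (2 * j) + block \<sigma> (Suc k) (2 * j + 1)"
  unfolding block_def win_Suc[OF assms] by (simp add: algebra_simps)

text \<open>The product of the imbalances of two sibling windows is what the odd windows gain; it
  telescopes over the levels because of \<open>2ab = (a + b)\<^sup>2 - a\<^sup>2 - b\<^sup>2\<close>.\<close>

lemma energy_diff:
  assumes "k < K"
  shows "energy \<sigma> k - energy \<sigma> (Suc k)
       = (\<Sum>j<2 ^ k. 2 * block \<sigma> (Suc k) (2 * j) * block \<sigma> (Suc k) (2 * j + 1))"
  unfolding energy_def power_Suc sum_even_odd block_split[OF assms]
  by (simp add: power2_eq_square algebra_simps sum.distrib flip: sum_subtractf)

lemma block_sum: "block \<sigma> k j = (\<Sum>u\<in>{j * win k..<j * win k + win k}. \<sigma> u)"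
  unfolding block_def by (subst walk_diff) (auto simp: algebra_simps)

lemma sum_blocks:
  "k \<le> K \<Longrightarrow> (\<Sum>j<2 ^ k. \<Sum>u\<in>{j * win k..<j * win k + win k}. f u) = (\<Sum>u<win 0. f u :: real)"
  using sum.nat_group[of f "win k" "2 ^ k"] win_total[of k] by simp

text \<open>The last summand accounts for the motion inside windows of level \<open>K\<close>, below
  which no energy is recorded.\<close>

definition total_energy :: "(nat \<Rightarrow> real) \<Rightarrow> nat \<Rightarrow> real" where
  "total_energy \<sigma> \<tau> = (\<Sum>i\<le>K. energy \<sigma> i) + real \<tau> * real (win K)"

text \<open>Squared distance walked since the current window of level \<open>k\<close> began, summed
  over time. It is the price of cutting sequences in the middle of a window; for
  \<open>k = 0\<close> it is the sum of the squares of the walk itself.\<close>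

definition deviation :: "(nat \<Rightarrow> real) \<Rightarrow> nat \<Rightarrow> real" where
  "deviation \<sigma> k = (\<Sum>u<win 0. (walk \<sigma> u - walk \<sigma> (u div win k * win k))\<^sup>2)"

lemma deviation_blocks:
  assumes "k \<le> K"
  shows "deviation \<sigma> k
       = (\<Sum>j<2 ^ k. \<Sum>i<win k. (walk \<sigma> (j * win k + i) - walk \<sigma> (j * win k))\<^sup>2)"
proof -
  have "(\<Sum>u\<in>{j * win k..<j * win k + win k}. (walk \<sigma> u - walk \<sigma> (u div win k * win k))\<^sup>2)
      = (\<Sum>i<win k. (walk \<sigma> (j * win k + i) - walk \<sigma> (j * win k))\<^sup>2)" for j
  proof -
    have "(\<Sum>u\<in>{j * win k..<j * win k + win k}. f u) = (\<Sum>i<win k. f (j * win k + i))" for f :: "nat \<Rightarrow> real"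
      using sum.shift_bounds_nat_ivl[of f 0 "j * win k" "win k"] by (simp add: add.commute atLeast0LessThan)
    then have "(\<Sum>u\<in>{j * win k..<j * win k + win k}. (walk \<sigma> u - walk \<sigma> (u div win k * win k))\<^sup>2)
        = (\<Sum>i<win k. (walk \<sigma> (j * win k + i) - walk \<sigma> ((j * win k + i) div win k * win k))\<^sup>2)" .
    also have "\<dots> = (\<Sum>i<win k. (walk \<sigma> (j * win k + i) - walk \<sigma> (j * win k))\<^sup>2)"
      using win_pos[of k] by (intro sum.cong) auto
    finally show ?thesis .
  qed
  then show ?thesis
    unfolding deviation_def by (simp add: sum_blocks[OF assms, symmetric])
qed

text \<open>One factor of the square is bounded by the window length, the other by the number of
  active times in the window. The bound thus scales with the number of insertions that really
  happen.\<close>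

lemma walk_increment_sq:
  assumes "\<And>t. \<bar>\<sigma> t\<bar> \<le> 1" "i \<le> w"
  shows "(walk \<sigma> (s + i) - walk \<sigma> s)\<^sup>2 \<le> real w * (\<Sum>u\<in>{s..<s + w}. \<bar>\<sigma> u\<bar>)"
proof -
  define x where "x = (\<Sum>u\<in>{s..<s + w}. \<bar>\<sigma> u\<bar>)"
  have "\<bar>walk \<sigma> (s + i) - walk \<sigma> s\<bar> \<le> (\<Sum>u\<in>{s..<s + i}. \<bar>\<sigma> u\<bar>)"
    by (simp add: walk_diff)
  also have "\<dots> \<le> x" unfolding x_def using assms(2) by (intro sum_mono2) auto
  finally have 1: "\<bar>walk \<sigma> (s + i) - walk \<sigma> s\<bar> \<le> x" .
  have "x \<le> real (card {s..<s + w}) * 1"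
    unfolding x_def using assms(1) by (intro sum_bounded_above) auto
  then have 2: "x \<le> real w" by simp
  have "\<bar>walk \<sigma> (s + i) - walk \<sigma> s\<bar> * \<bar>walk \<sigma> (s + i) - walk \<sigma> s\<bar> \<le> real w * x"
    using 1 2 by (intro mult_mono) auto
  then show ?thesis by (simp add: x_def power2_eq_square)
qed

lemma sum_active:
  assumes "\<And>t. \<bar>\<sigma> t\<bar> \<le> 1" "\<And>t. t \<ge> \<tau> \<Longrightarrow> \<sigma> t = 0"
  shows "(\<Sum>u<N. \<bar>\<sigma> u\<bar>) \<le> real \<tau>"
proof -
  have "(\<Sum>u<N. \<bar>\<sigma> u\<bar>) \<le> (\<Sum>u<N. if u < \<tau> then 1 else 0)"
    using assms by (intro sum_mono) auto
  also have "\<dots> = real (card {u. u < N \<and> u < \<tau>})" by (simp add: sum.If_cases Int_def)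
  also have "\<dots> \<le> real (card {..<\<tau>})" by (intro of_nat_mono card_mono) auto
  finally show ?thesis by simp
qed

section \<open>Bounds for sequences that stop at time \<tau>\<close>

context
  fixes \<sigma> :: "nat \<Rightarrow> real" and \<tau> :: nat
  assumes bounded: "\<And>t. \<bar>\<sigma> t\<bar> \<le> 1" and inactive: "\<And>t. t \<ge> \<tau> \<Longrightarrow> \<sigma> t = 0"
begin

lemma energy_finest: "energy \<sigma> K \<le> real \<tau> * real (win K)"
proof -
  have "energy \<sigma> K \<le> (\<Sum>j<2 ^ K. real (win K) * (\<Sum>u\<in>{j * win K..<j * win K + win K}. \<bar>\<sigma> u\<bar>))"
    unfolding energy_def block_def
  proof (intro sum_mono)
    fix j
    show "(walk \<sigma> ((j + 1) * win K) - walk \<sigma> (j * win K))\<^sup>2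
        \<le> real (win K) * (\<Sum>u\<in>{j * win K..<j * win K + win K}. \<bar>\<sigma> u\<bar>)"
      using walk_increment_sq[of \<sigma> "win K" "win K" "j * win K", OF bounded] by (simp add: add.commute)
  qed
  also have "\<dots> = real (win K) * (\<Sum>u<win 0. \<bar>\<sigma> u\<bar>)"
    by (simp add: sum_blocks flip: sum_distrib_left)
  also have "\<dots> \<le> real (win K) * real \<tau>"
    by (intro mult_left_mono sum_active bounded inactive) auto
  finally show ?thesis by (simp add: mult.commute)
qed

lemma deviation_finest: "deviation \<sigma> K \<le> real (win K) * (real \<tau> * real (win K))"
proof -
  have "deviation \<sigma> K \<le> (\<Sum>j<2 ^ K. \<Sum>i<win K. real (win K) * (\<Sum>u\<in>{j * win K..<j * win K + win K}. \<bar>\<sigma> u\<bar>))"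
    unfolding deviation_blocks[OF order_refl] by (intro sum_mono walk_increment_sq bounded) auto
  also have "\<dots> = real (win K) * (real (win K) * (\<Sum>u<win 0. \<bar>\<sigma> u\<bar>))"
    by (simp add: sum_blocks flip: sum_distrib_left)
  also have "\<dots> \<le> real (win K) * (real (win K) * real \<tau>)"
    by (intro mult_left_mono sum_active bounded inactive) auto
  finally show ?thesis by (simp add: mult.commute)
qed

text \<open>In the second half of a window the base point is moved to the midpoint by (x - z)^2
  \<le> 2 (x - y)^2 + 2 (y - z)^2. The increment up to the midpoint is a block of the next
  level.\<close>

lemma deviation_step:
  assumes "k < K"
  shows "deviation \<sigma> k \<le> 2 * deviation \<sigma> (Suc k) + real (win k) * energy \<sigma> (Suc k)"
proof -
  let ?w = "win (Suc k)"
  define F where "F = (\<lambda>k j. \<Sum>i<win k. (walk \<sigma> (j * win k + i) - walk \<sigma> (j * win k))\<^sup>2)"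
  have step: "F k j \<le> F (Suc k) (2 * j) + (2 * F (Suc k) (2 * j + 1) + real (win k) * (block \<sigma> (Suc k) (2 * j))\<^sup>2)" for j
  proof -
    let ?s = "j * win k"
    have s: "2 * j * ?w = ?s" "(2 * j + 1) * ?w = ?s + ?w"
      by (simp_all add: win_Suc[OF assms])
    have "F k j = (\<Sum>i<?w. (walk \<sigma> (?s + i) - walk \<sigma> ?s)\<^sup>2) + (\<Sum>i<?w. (walk \<sigma> (?s + (?w + i)) - walk \<sigma> ?s)\<^sup>2)"
      unfolding F_def using sum_lessThan_add[of "\<lambda>i. (walk \<sigma> (?s + i) - walk \<sigma> ?s)\<^sup>2" ?w ?w]
      by (simp add: win_Suc[OF assms] flip: mult_2)
    moreover have "(\<Sum>i<?w. (walk \<sigma> (?s + (?w + i)) - walk \<sigma> ?s)\<^sup>2)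
        \<le> (\<Sum>i<?w. 2 * (walk \<sigma> (?s + ?w + i) - walk \<sigma> (?s + ?w))\<^sup>2 + 2 * (walk \<sigma> (?s + ?w) - walk \<sigma> ?s)\<^sup>2)"
    proof (intro sum_mono)
      fix i
      have "(x - z)\<^sup>2 \<le> 2 * (x - y)\<^sup>2 + 2 * (y - z)\<^sup>2" for x y z :: real
        using zero_le_power2[of "x - 2 * y + z"] by (simp add: power2_eq_square algebra_simps)
      then show "(walk \<sigma> (?s + (?w + i)) - walk \<sigma> ?s)\<^sup>2
        \<le> 2 * (walk \<sigma> (?s + ?w + i) - walk \<sigma> (?s + ?w))\<^sup>2 + 2 * (walk \<sigma> (?s + ?w) - walk \<sigma> ?s)\<^sup>2"
        by (simp add: add.assoc)
    qed
    moreover have "(\<Sum>i<?w. 2 * (walk \<sigma> (?s + ?w + i) - walk \<sigma> (?s + ?w))\<^sup>2 + 2 * (walk \<sigma> (?s + ?w) - walk \<sigma> ?s)\<^sup>2)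
        = 2 * (\<Sum>i<?w. (walk \<sigma> (?s + ?w + i) - walk \<sigma> (?s + ?w))\<^sup>2)
        + real (2 * ?w) * (walk \<sigma> (?s + ?w) - walk \<sigma> ?s)\<^sup>2"
      by (simp only: sum.distrib sum_distrib_left[symmetric]) simp
    moreover have "walk \<sigma> (?s + ?w) - walk \<sigma> ?s = block \<sigma> (Suc k) (2 * j)"
      unfolding block_def s by simp
    ultimately show ?thesis
      unfolding F_def s win_Suc[OF assms] by simp
  qed
  have "deviation \<sigma> k = (\<Sum>j<2 ^ k. F k j)"
    using assms by (simp add: deviation_blocks F_def)
  also have "\<dots> \<le> (\<Sum>j<2 ^ k. F (Suc k) (2 * j) + (2 * F (Suc k) (2 * j + 1) + real (win k) * (block \<sigma> (Suc k) (2 * j))\<^sup>2))"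
    by (intro sum_mono step)
  also have "\<dots> \<le> (\<Sum>j<2 ^ k. 2 * (F (Suc k) (2 * j) + F (Suc k) (2 * j + 1))
       + real (win k) * ((block \<sigma> (Suc k) (2 * j))\<^sup>2 + (block \<sigma> (Suc k) (2 * j + 1))\<^sup>2))"
    by (intro sum_mono) (auto simp: F_def distrib_left intro!: add_nonneg_nonneg sum_nonneg)
  also have "\<dots> = 2 * deviation \<sigma> (Suc k) + real (win k) * energy \<sigma> (Suc k)"
    using assms unfolding energy_def power_Suc sum_even_odd
    by (simp add: deviation_blocks F_def sum_even_odd sum.distrib flip: sum_distrib_left)
  finally show ?thesis .
qed

text \<open>The factor 2 of \<open>deviation_step\<close> matches
  \<open>win k = 2 * win (Suc k)\<close>. Divided by the window length the recursion has coefficient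
  1, so the finer energies simply add up.\<close>

lemma deviation_le:
  assumes "k \<le> K"
  shows "deviation \<sigma> k \<le> real (win k) * ((\<Sum>i\<in>{Suc k..K}. energy \<sigma> i) + real \<tau> * real (win K))"
  using assms
proof (induction rule: inc_induct)
  case base
  show ?case using deviation_finest by simp
next
  case (step k)
  have "deviation \<sigma> k \<le> 2 * deviation \<sigma> (Suc k) + real (win k) * energy \<sigma> (Suc k)"
    using step by (intro deviation_step) auto
  also have "\<dots> \<le> 2 * (real (win (Suc k)) * ((\<Sum>i\<in>{Suc (Suc k)..K}. energy \<sigma> i) + real \<tau> * real (win K)))
      + real (win k) * energy \<sigma> (Suc k)"
    using step by simp
  also have "real (win k) = 2 * real (win (Suc k))"
    using step win_Suc[of k] by simp
  then have "2 * (real (win (Suc k)) * ((\<Sum>i\<in>{Suc (Suc k)..K}. energy \<sigma> i) + real \<tau> * real (win K)))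
      + real (win k) * energy \<sigma> (Suc k)
    = real (win k) * ((\<Sum>i\<in>{Suc (Suc k)..K}. energy \<sigma> i) + energy \<sigma> (Suc k) + real \<tau> * real (win K))"
    by (simp add: algebra_simps)
  also have "(\<Sum>i\<in>{Suc (Suc k)..K}. energy \<sigma> i) + energy \<sigma> (Suc k) = (\<Sum>i\<in>{Suc k..K}. energy \<sigma> i)"
    using step by (simp add: sum.atLeast_Suc_atMost[of "Suc k" K])
  finally show ?case .
qed

lemma total_energy_nonneg: "total_energy \<sigma> \<tau> \<ge> 0"
  by (auto simp: total_energy_def intro!: add_nonneg_nonneg sum_nonneg energy_nonneg)

lemma deviation_le_total:
  assumes "k \<le> K"
  shows "deviation \<sigma> k \<le> real (win k) * total_energy \<sigma> \<tau>"
proof -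
  have "(\<Sum>i\<in>{Suc k..K}. energy \<sigma> i) \<le> (\<Sum>i\<le>K. energy \<sigma> i)"
    by (intro sum_mono2) (auto intro: energy_nonneg)
  then have "real (win k) * ((\<Sum>i\<in>{Suc k..K}. energy \<sigma> i) + real \<tau> * real (win K)) \<le> real (win k) * total_energy \<sigma> \<tau>"
    unfolding total_energy_def by (intro mult_left_mono) auto
  then show ?thesis using deviation_le[OF assms] by linarith
qed

lemma walk_sq_sum_le:
  assumes "\<tau> \<le> win 0"
  shows "(\<Sum>t<\<tau>. (walk \<sigma> t)\<^sup>2) \<le> real (win 0) * total_energy \<sigma> \<tau>"
proof -
  have "(\<Sum>t<\<tau>. (walk \<sigma> t)\<^sup>2) = (\<Sum>t<\<tau>. (walk \<sigma> t - walk \<sigma> (t div win 0 * win 0))\<^sup>2)"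
    using assms by (intro sum.cong) auto
  also have "\<dots> \<le> deviation \<sigma> 0"
    unfolding deviation_def using assms by (intro sum_mono2) auto
  finally show ?thesis using deviation_le_total[of 0] by simp
qed

lemma energy_le_total: "k \<le> K \<Longrightarrow> energy \<sigma> k \<le> total_energy \<sigma> \<tau>"
  unfolding total_energy_def
  using member_le_sum[of k "{..K}" "energy \<sigma>"] energy_nonneg by (simp add: add_increasing2)

end

text \<open>Only the window containing \<open>v\<close> is cut, and what remains of it contributes
  the square of the distance walked since it began.\<close>

lemma energy_truncate:
  assumes "k \<le> K" "v \<le> win 0"
  shows "energy (truncate v \<sigma>) k \<le> energy \<sigma> k + (walk \<sigma> v - walk \<sigma> (v div win k * win k))\<^sup>2"
proof -
  let ?d = "(walk \<sigma> v - walk \<sigma> (v div win k * win k))\<^sup>2"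
  have "(block (truncate v \<sigma>) k j)\<^sup>2 \<le> (block \<sigma> k j)\<^sup>2 + (if j = v div win k then ?d else 0)" for j
  proof -
    consider "(j + 1) * win k \<le> v" | "v \<le> j * win k" | "j * win k < v" "v < (j + 1) * win k" by linarith
    then show ?thesis
    proof cases
      case 1
      then have "block (truncate v \<sigma>) k j = block \<sigma> k j" by (simp add: block_def walk_truncate)
      then show ?thesis by simp
    next
      case 2
      then have "block (truncate v \<sigma>) k j = 0" by (simp add: block_def walk_truncate min_def)
      then show ?thesis by simp
    next
      case 3
      then have j: "j = v div win k"
        by (intro div_nat_eqI[symmetric]) (auto simp: mult.commute)
      have "block (truncate v \<sigma>) k j = walk \<sigma> v - walk \<sigma> (j * win k)"
        using 3 by (simp add: block_def walk_truncate min_def)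
      then show ?thesis using j by simp
    qed
  qed
  then have "energy (truncate v \<sigma>) k \<le> (\<Sum>j<2 ^ k. (block \<sigma> k j)\<^sup>2 + (if j = v div win k then ?d else 0))"
    unfolding energy_def by (rule sum_mono)
  also have "\<dots> \<le> energy \<sigma> k + ?d"
    by (auto simp: energy_def sum.distrib)
  finally show ?thesis .
qed

text \<open>Relative change of the width of the right child: the boundary moves by len * tilt / 2.
  Windows are numbered from 0 here, so the shifted ones are the odd ones, and the subtraction never
  truncates.\<close>

definition tilt :: "real \<Rightarrow> (nat \<Rightarrow> real) \<Rightarrow> nat \<Rightarrow> nat \<Rightarrow> real" where
  "tilt \<beta> \<sigma> k t =
     (if odd (t div win k) then 2 * block \<sigma> k (t div win k - 1) / (\<beta> * real (win k)) else 0)"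

text \<open>The tilt in force at time \<open>t\<close> comes from a window that has already ended,
  so cutting off the future does not change it.\<close>

lemma tilt_truncate:
  assumes "t < v"
  shows "tilt \<beta> (truncate v \<sigma>) k t = tilt \<beta> \<sigma> k t"
proof (cases "odd (t div win k)")
  case True
  then have "t div win k - 1 + 1 = t div win k" by (cases "t div win k") auto
  then have "(t div win k - 1 + 1) * win k \<le> t" by simp
  then have le: "(t div win k - 1 + 1) * win k \<le> v" using assms by linarith
  then have "(t div win k - 1) * win k \<le> v" by (simp add: algebra_simps)
  then have "block (truncate v \<sigma>) k (t div win k - 1) = block \<sigma> k (t div win k - 1)"
    using le by (simp only: block_def walk_truncate min_absorb1)
  then show ?thesis by (simp add: tilt_def)
qed (simp add: tilt_def)

text \<open>The tilt is constant on an odd window, so the directions there add up to a block and the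
  sum becomes the product of sibling blocks in \<open>energy_diff\<close>.\<close>

lemma tilt_sum_full:
  assumes "k < K"
  shows "(\<Sum>t<win 0. \<sigma> t * tilt \<beta> \<sigma> (Suc k) t)
       = (energy \<sigma> k - energy \<sigma> (Suc k)) / (\<beta> * real (win (Suc k)))"
proof -
  let ?w = "win (Suc k)"
  define c where "c = (\<lambda>j. if odd j then 2 * block \<sigma> (Suc k) (j - 1) / (\<beta> * real ?w) else 0)"
  have "(\<Sum>t<win 0. \<sigma> t * tilt \<beta> \<sigma> (Suc k) t)
      = (\<Sum>j<2 ^ Suc k. \<Sum>t\<in>{j * ?w..<j * ?w + ?w}. \<sigma> t * tilt \<beta> \<sigma> (Suc k) t)"
    using assms by (subst sum_blocks) auto
  also have "\<dots> = (\<Sum>j<2 ^ Suc k. \<Sum>t\<in>{j * ?w..<j * ?w + ?w}. \<sigma> t * c j)"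
  proof (intro sum.cong refl)
    fix j t assume "t \<in> {j * ?w..<j * ?w + ?w}"
    then have "t div ?w = j" by (intro div_nat_eqI) (auto simp: mult.commute)
    then show "\<sigma> t * tilt \<beta> \<sigma> (Suc k) t = \<sigma> t * c j" by (simp add: tilt_def c_def)
  qed
  also have "\<dots> = (\<Sum>j<2 * 2 ^ k. block \<sigma> (Suc k) j * c j)"
    by (simp add: block_sum sum_distrib_right)
  also have "\<dots> = (\<Sum>j<2 ^ k. 2 * block \<sigma> (Suc k) (2 * j) * block \<sigma> (Suc k) (2 * j + 1) / (\<beta> * real ?w))"
    unfolding sum_even_odd by (intro sum.cong) (auto simp: c_def)
  also have "\<dots> = (energy \<sigma> k - energy \<sigma> (Suc k)) / (\<beta> * real ?w)"
    unfolding energy_diff[OF assms] by (simp add: sum_divide_distrib)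
  finally show ?thesis .
qed

lemma tilt_sum:
  assumes "k < K" "v \<le> win 0"
  shows "(\<Sum>t<v. \<sigma> t * tilt \<beta> \<sigma> (Suc k) t)
       = (energy (truncate v \<sigma>) k - energy (truncate v \<sigma>) (Suc k)) / (\<beta> * real (win (Suc k)))"
proof -
  have "(\<Sum>t<v. \<sigma> t * tilt \<beta> \<sigma> (Suc k) t)
      = (\<Sum>t<v. truncate v \<sigma> t * tilt \<beta> (truncate v \<sigma>) (Suc k) t)"
    by (intro sum.cong) (auto simp: tilt_truncate truncate_def)
  also have "\<dots> = (\<Sum>t<win 0. truncate v \<sigma> t * tilt \<beta> (truncate v \<sigma>) (Suc k) t)"
    using assms by (intro sum.mono_neutral_left) (auto simp: truncate_def)
  finally show ?thesis using tilt_sum_full[OF assms(1)] by simp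
qed

lemma tilt_sq_sum:
  assumes "k \<le> K" "v \<le> win 0" "\<beta> > 0"
  shows "(\<Sum>t<v. (tilt \<beta> \<sigma> k t)\<^sup>2) \<le> 4 * energy \<sigma> k / (\<beta>\<^sup>2 * real (win k))"
proof -
  let ?w = "win k"
  define c where "c = (\<lambda>j. if odd j then 4 * (block \<sigma> k (j - 1))\<^sup>2 / (\<beta> * real ?w)\<^sup>2 else 0)"
  have "(\<Sum>t<v. (tilt \<beta> \<sigma> k t)\<^sup>2) \<le> (\<Sum>t<win 0. (tilt \<beta> \<sigma> k t)\<^sup>2)"
    using assms by (intro sum_mono2) auto
  also have "\<dots> = (\<Sum>j<2 ^ k. \<Sum>t\<in>{j * ?w..<j * ?w + ?w}. (tilt \<beta> \<sigma> k t)\<^sup>2)"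
    using assms by (subst sum_blocks) auto
  also have "\<dots> = (\<Sum>j<2 ^ k. \<Sum>t\<in>{j * ?w..<j * ?w + ?w}. c j)"
  proof (intro sum.cong refl)
    fix j t assume "t \<in> {j * ?w..<j * ?w + ?w}"
    then have "t div ?w = j" by (intro div_nat_eqI) (auto simp: mult.commute)
    then show "(tilt \<beta> \<sigma> k t)\<^sup>2 = c j" by (simp add: tilt_def c_def power_divide power_mult_distrib)
  qed
  also have "\<dots> = real ?w * (\<Sum>j<2 ^ k. c j)" by (simp add: sum_distrib_left)
  also have "(\<Sum>j<2 ^ k. c j) \<le> 4 * energy \<sigma> k / (\<beta> * real ?w)\<^sup>2"
  proof (cases k)
    case 0
    then show ?thesis by (simp add: c_def energy_nonneg)
  next
    case (Suc k')
    have "(\<Sum>j<2 ^ k. c j) = (\<Sum>j<2 ^ k'. 4 * (block \<sigma> k (2 * j))\<^sup>2 / (\<beta> * real ?w)\<^sup>2)"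
      unfolding Suc power_Suc sum_even_odd by (intro sum.cong) (auto simp: c_def Suc)
    also have "\<dots> \<le> (\<Sum>j<2 ^ k'. 4 * ((block \<sigma> k (2 * j))\<^sup>2 + (block \<sigma> k (2 * j + 1))\<^sup>2) / (\<beta> * real ?w)\<^sup>2)"
      by (intro sum_mono divide_right_mono) auto
    also have "\<dots> = 4 * energy \<sigma> k / (\<beta> * real ?w)\<^sup>2"
      unfolding energy_def Suc power_Suc sum_even_odd
      by (simp add: sum_distrib_left sum_divide_distrib)
    finally show ?thesis .
  qed
  then have "real ?w * (\<Sum>j<2 ^ k. c j) \<le> real ?w * (4 * energy \<sigma> k / (\<beta> * real ?w)\<^sup>2)"
    by (intro mult_left_mono) auto
  also have "\<dots> = 4 * energy \<sigma> k / (\<beta>\<^sup>2 * real ?w)"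
    using win_pos[of k] assms by (simp add: field_simps power2_eq_square)
  finally show ?thesis .
qed

definition weight :: "nat \<Rightarrow> real" where
  "weight k = (1 / 2) ^ (k + 1) * (1 + real k / real K)"

lemma weight_nonneg: "weight k \<ge> 0"
  by (simp add: weight_def)

text \<open>The slope \<open>1 / K\<close> of the factor \<open>1 + k / K\<close> makes every level contribute after summation by
  parts.\<close>

lemma weighted_telescope:
  "(\<Sum>k<N. (1 + real (Suc k) * c) * (s k - s (Suc k)))
     = s 0 + c * (\<Sum>k<N. s k) - (1 + real N * c) * (s N :: real)"
  by (induction N) (auto simp: algebra_simps)

text \<open>Average over the skew of the correlation between directions and tilts. Skew 0 is missing
  because its only window is never tilted.\<close>

definition gain :: "real \<Rightarrow> (nat \<Rightarrow> real) \<Rightarrow> nat \<Rightarrow> real" where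
  "gain \<beta> \<sigma> v = (\<Sum>t<v. \<Sum>k<K. weight (Suc k) * (\<sigma> t * tilt \<beta> \<sigma> (Suc k) t))"

lemma gain_eq:
  assumes "v \<le> win 0" "\<beta> > 0" "K > 0"
  shows "gain \<beta> \<sigma> v = (energy (truncate v \<sigma>) 0
     + (\<Sum>k<K. energy (truncate v \<sigma>) k) / real K - 2 * energy (truncate v \<sigma>) K) / (2 * \<beta> * real (win 0))"
proof -
  let ?s = "energy (truncate v \<sigma>)" and ?T = "real (win 0)"
  have "gain \<beta> \<sigma> v = (\<Sum>k<K. weight (Suc k) * (\<Sum>t<v. \<sigma> t * tilt \<beta> \<sigma> (Suc k) t))"
    unfolding gain_def by (subst sum.swap) (simp add: sum_distrib_left)
  also have "\<dots> = (\<Sum>k<K. (1 + real (Suc k) * (1 / real K)) * (?s k - ?s (Suc k)) / (2 * \<beta> * ?T))"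
  proof (intro sum.cong refl)
    fix k assume "k \<in> {..<K}"
    then have k: "k < K" by simp
    \<comment> \<open>The window length \<open>win 0 / 2 ^ Suc k\<close> cancels the power of 2 in
      the weight. Every level enters on the same scale, distinguished only by the slope
      factor.\<close>
    have "weight (Suc k) * (\<Sum>t<v. \<sigma> t * tilt \<beta> \<sigma> (Suc k) t)
        = weight (Suc k) * ((?s k - ?s (Suc k)) / (\<beta> * (?T / 2 ^ Suc k)))"
      using k real_win[of "Suc k"] by (subst tilt_sum[OF k assms(1)]) simp
    also have "\<dots> = (1 + real (Suc k) * (1 / real K)) * (?s k - ?s (Suc k)) / (2 * \<beta> * ?T)"
      using assms(2,3) win_pos[of 0] by (simp add: weight_def field_simps)
    finally show "weight (Suc k) * (\<Sum>t<v. \<sigma> t * tilt \<beta> \<sigma> (Suc k) t)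
      = (1 + real (Suc k) * (1 / real K)) * (?s k - ?s (Suc k)) / (2 * \<beta> * ?T)" .
  qed
  also have "\<dots> = (\<Sum>k<K. (1 + real (Suc k) * (1 / real K)) * (?s k - ?s (Suc k))) / (2 * \<beta> * ?T)"
    by (simp add: sum_divide_distrib)
  also have "\<dots> = (?s 0 + (1 / real K) * (\<Sum>k<K. ?s k) - (1 + real K * (1 / real K)) * ?s K) / (2 * \<beta> * ?T)"
    unfolding weighted_telescope ..
  finally show ?thesis using assms by simp
qed

text \<open>Abel summation. It puts the gains of prefixes, whose exact value is known, in place of
  single terms, about which nothing is known.\<close>

lemma sum_by_parts:
  "(\<Sum>t<N. g t * (a t :: real)) = g N * (\<Sum>t<N. a t) - (\<Sum>t<N. (g (Suc t) - g t) * (\<Sum>u<Suc t. a u))"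
  by (induction N) (auto simp: algebra_simps)

context
  fixes \<sigma> :: "nat \<Rightarrow> real" and \<tau> :: nat and \<beta> :: real
  assumes bounded: "\<And>t. \<bar>\<sigma> t\<bar> \<le> 1" and inactive: "\<And>t. t \<ge> \<tau> \<Longrightarrow> \<sigma> t = 0"
    and K_pos: "K > 0" and \<beta>_ge: "\<beta> \<ge> 1" and \<tau>_le: "\<tau> \<le> win 0"
begin

text \<open>In summation by parts the increments of \<open>g\<close> meet the gains of prefixes,
  which must not be too large in total. A prefix ending inside a window may have extra energy
  \<open>P k v\<close>; summed over all ends this is the deviation of level
  \<open>k\<close>.\<close>

lemma gain_upper_sum:
  "(\<Sum>t<\<tau>. max 0 (gain \<beta> \<sigma> (Suc t))) \<le> 2 * total_energy \<sigma> \<tau> / \<beta>"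
proof -
  let ?T = "real (win 0)" and ?Z = "total_energy \<sigma> \<tau>"
  define P where "P = (\<lambda>k v. (walk \<sigma> v - walk \<sigma> (v div win k * win k))\<^sup>2)"
  define X where "X = (\<lambda>v. energy \<sigma> 0 + P 0 v + (\<Sum>k<K. energy \<sigma> k + P k v) / real K)"
  have X: "max 0 (gain \<beta> \<sigma> v) \<le> X v / (2 * \<beta> * ?T)" if "v \<le> win 0" for v
  proof -
    have tr: "energy (truncate v \<sigma>) k \<le> energy \<sigma> k + P k v" if "k \<le> K" for k
      unfolding P_def by (rule energy_truncate) fact+
    have "energy (truncate v \<sigma>) 0 + (\<Sum>k<K. energy (truncate v \<sigma>) k) / real K - 2 * energy (truncate v \<sigma>) K
        \<le> energy \<sigma> 0 + P 0 v + (\<Sum>k<K. energy \<sigma> k + P k v) / real K"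
      using tr[of 0] energy_nonneg[of "truncate v \<sigma>" K]
      by (intro add_mono divide_right_mono sum_mono diff_le_eq[THEN iffD2] add_increasing2 tr) auto
    then have "gain \<beta> \<sigma> v \<le> X v / (2 * \<beta> * ?T)"
      using \<beta>_ge K_pos that unfolding X_def by (subst gain_eq) (auto intro!: divide_right_mono)
    moreover have "X v \<ge> 0"
      unfolding X_def P_def by (intro add_nonneg_nonneg divide_nonneg_nonneg sum_nonneg energy_nonneg) auto
    ultimately show ?thesis using \<beta>_ge by auto
  qed
  have P_T: "P k (win 0) = 0" if "k \<le> K" for k
    using win_pos[of k] by (simp add: P_def flip: win_total[OF that])
  have P_sum: "(\<Sum>t<\<tau>. P k (Suc t)) \<le> ?T * ?Z" if "k \<le> K" for k
  proof -
    have "(\<Sum>t<\<tau>. P k (Suc t)) \<le> (\<Sum>t<win 0. P k (Suc t))"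
      using \<tau>_le by (intro sum_mono2) (auto simp: P_def)
    \<comment> \<open>The ends run over 1, ..., T and the deviation over 0, ..., T - 1. Both
      boundary terms vanish, as 0 and T are ends of windows on every level.\<close>
    also have "\<dots> = (\<Sum>t<Suc (win 0). P k t)"
      unfolding sum.lessThan_Suc_shift by (simp add: P_def)
    also have "\<dots> = deviation \<sigma> k"
      using P_T[OF that] by (simp add: deviation_def P_def)
    also have "\<dots> \<le> real (win k) * ?Z"
      using deviation_le_total[OF bounded inactive that] by simp
    also have "\<dots> \<le> ?T * ?Z"
      using total_energy_nonneg[OF bounded inactive]
      by (intro mult_right_mono of_nat_mono win_le that) simp
    finally show ?thesis .
  qed
  have e: "energy \<sigma> k \<le> ?Z" if "k \<le> K" for k
    using energy_le_total[OF bounded inactive that] by simp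
  have Z: "?Z \<ge> 0" using total_energy_nonneg[OF bounded inactive] by simp
  have "(\<Sum>t<\<tau>. X (Suc t)) = real \<tau> * energy \<sigma> 0 + (\<Sum>t<\<tau>. P 0 (Suc t))
      + (\<Sum>k<K. real \<tau> * energy \<sigma> k + (\<Sum>t<\<tau>. P k (Suc t))) / real K"
    unfolding X_def by (simp add: sum.distrib sum_distrib_left sum.swap[of _ "{..<K}"] flip: sum_divide_distrib)
  also have "\<dots> \<le> ?T * ?Z + ?T * ?Z + (\<Sum>k<K. ?T * ?Z + ?T * ?Z) / real K"
    using \<tau>_le by (intro add_mono divide_right_mono sum_mono P_sum mult_mono e energy_nonneg) auto
  also have "\<dots> = 4 * ?T * ?Z" using K_pos by simp
  finally have XX: "(\<Sum>t<\<tau>. X (Suc t)) \<le> 4 * ?T * ?Z" .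
  have "(\<Sum>t<\<tau>. max 0 (gain \<beta> \<sigma> (Suc t))) \<le> (\<Sum>t<\<tau>. X (Suc t) / (2 * \<beta> * ?T))"
    using \<tau>_le by (intro sum_mono X) auto
  also have "\<dots> = (\<Sum>t<\<tau>. X (Suc t)) / (2 * \<beta> * ?T)" by (simp add: sum_divide_distrib)
  also have "\<dots> \<le> 4 * ?T * ?Z / (2 * \<beta> * ?T)"
    using XX \<beta>_ge by (intro divide_right_mono) auto
  also have "\<dots> = 2 * ?Z / \<beta>" using win_pos[of 0] \<beta>_ge by (simp add: field_simps)
  finally show ?thesis .
qed

text \<open>The weight is at most \<open>2 ^ -k\<close>, which cancels the growth of 1 /
  \<open>win k\<close>: each level contributes its energy with the same factor.\<close>

lemma tilt_second_moment:
  "(\<Sum>t<\<tau>. \<Sum>k<K. weight (Suc k) * (tilt \<beta> \<sigma> (Suc k) t)\<^sup>2) \<le> 4 * total_energy \<sigma> \<tau> / (\<beta>\<^sup>2 * real (win 0))"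
proof -
  let ?T = "real (win 0)"
  have "(\<Sum>t<\<tau>. \<Sum>k<K. weight (Suc k) * (tilt \<beta> \<sigma> (Suc k) t)\<^sup>2)
      = (\<Sum>k<K. weight (Suc k) * (\<Sum>t<\<tau>. (tilt \<beta> \<sigma> (Suc k) t)\<^sup>2))"
    by (subst sum.swap) (simp add: sum_distrib_left)
  also have "\<dots> \<le> (\<Sum>k<K. 4 * energy \<sigma> (Suc k) / (\<beta>\<^sup>2 * ?T))"
  proof (intro sum_mono)
    fix k assume "k \<in> {..<K}"
    then have k: "Suc k \<le> K" by simp
    have "weight (Suc k) \<le> (1 / 2) ^ (Suc k + 1) * 2"
      unfolding weight_def using k by (intro mult_left_mono) auto
    then have w: "weight (Suc k) \<le> 1 / 2 ^ Suc k" by (simp add: power_divide)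
    have "weight (Suc k) * (\<Sum>t<\<tau>. (tilt \<beta> \<sigma> (Suc k) t)\<^sup>2)
        \<le> 1 / 2 ^ Suc k * (4 * energy \<sigma> (Suc k) / (\<beta>\<^sup>2 * real (win (Suc k))))"
      using w \<beta>_ge k \<tau>_le by (intro mult_mono tilt_sq_sum sum_nonneg) auto
    also have "\<dots> = 4 * energy \<sigma> (Suc k) / (\<beta>\<^sup>2 * ?T)"
      using real_win[OF k] by simp
    finally show "weight (Suc k) * (\<Sum>t<\<tau>. (tilt \<beta> \<sigma> (Suc k) t)\<^sup>2) \<le> 4 * energy \<sigma> (Suc k) / (\<beta>\<^sup>2 * ?T)" .
  qed
  also have "\<dots> = 4 * (\<Sum>k<K. energy \<sigma> (Suc k)) / (\<beta>\<^sup>2 * ?T)"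
    by (simp add: sum_distrib_left sum_divide_distrib)
  finally have moment: "(\<Sum>t<\<tau>. \<Sum>k<K. weight (Suc k) * (tilt \<beta> \<sigma> (Suc k) t)\<^sup>2)
      \<le> 4 * (\<Sum>k<K. energy \<sigma> (Suc k)) / (\<beta>\<^sup>2 * ?T)" .
  have "(\<Sum>k<K. energy \<sigma> (Suc k)) \<le> (\<Sum>k\<le>K. energy \<sigma> k)"
    using energy_nonneg[of \<sigma> 0] by (simp add: sum.atMost_shift)
  also have "\<dots> \<le> total_energy \<sigma> \<tau>" unfolding total_energy_def by simp
  finally have "(\<Sum>k<K. energy \<sigma> (Suc k)) \<le> total_energy \<sigma> \<tau>" .
  then have "4 * (\<Sum>k<K. energy \<sigma> (Suc k)) / (\<beta>\<^sup>2 * ?T) \<le> 4 * total_energy \<sigma> \<tau> / (\<beta>\<^sup>2 * ?T)"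
    by (intro divide_right_mono) auto
  with moment show ?thesis by linarith
qed

text \<open>\<open>\<Phi>\<close> and \<open>g\<close> stand for the exponential moment \<open>exp (\<mu> d)\<close> of the density \<open>d\<close> and for \<open>d exp (\<mu> d)\<close>.
  Their growth during a lifetime is handled by summation by parts: a prefix of the sequence of directions
  is again such a sequence, so the gain of every prefix is known exactly.\<close>

lemma drift_bound:
  fixes \<Phi> g :: "nat \<Rightarrow> real" and len \<mu> \<gamma> C :: real
  assumes \<Phi>: "\<And>s t. s \<le> t \<Longrightarrow> t \<le> \<tau> \<Longrightarrow> \<Phi> s \<le> \<Phi> t" "\<Phi> 0 > 0" "\<Phi> \<tau> \<le> 2 * \<Phi> 0"
    and g: "\<And>t. t < \<tau> \<Longrightarrow> g t \<le> g (Suc t)" "\<And>t. t < \<tau> \<Longrightarrow> g (Suc t) - g t \<le> \<gamma> * \<Phi> 0 / real (win 0)"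
      "3 / 10 * \<Phi> 0 \<le> g \<tau>" "g \<tau> \<le> 2 * \<Phi> 0"
    and pos: "\<mu> \<ge> 0" "\<gamma> \<ge> 0" "C \<ge> 0"
    and len: "7 * real (win 0) * \<beta> \<le> len"
    and small: "2 * \<gamma> * real K + 2 * C * \<mu> * real K * (4 / \<beta> + \<beta> * (real (win 0))\<^sup>2 / len\<^sup>2) \<le> 3 / 20"
  shows "(\<Sum>t<\<tau>. \<mu> * (\<Phi> t * (\<sigma> t * walk \<sigma> t)) / len)
      - \<mu> * (\<Sum>t<\<tau>. g t * (\<Sum>k<K. weight (Suc k) * (\<sigma> t * tilt \<beta> \<sigma> (Suc k) t)))
      + C * \<mu>\<^sup>2 * (\<Sum>t<\<tau>. \<Phi> t * ((\<Sum>k<K. weight (Suc k) * (tilt \<beta> \<sigma> (Suc k) t)\<^sup>2) + (walk \<sigma> t)\<^sup>2 / len\<^sup>2))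
    \<le> 3 * \<mu> * \<Phi> 0 * real \<tau> / 2 ^ K"
proof -
  let ?T = "real (win 0)" and ?Z = "total_energy \<sigma> \<tau>"
  define E where "E = (\<Sum>k<K. energy \<sigma> k)"
  define e0 where "e0 = energy \<sigma> 0"
  define w where "w = real \<tau> * real (win K)"
  have T: "?T > 0" using win_pos[of 0] by simp
  have len_pos: "len > 0" using len T \<beta>_ge by (smt (verit) mult_pos_pos)
  have \<Phi>_le: "\<Phi> t \<le> 2 * \<Phi> 0" "\<Phi> t \<ge> 0" if "t \<le> \<tau>" for t
    using \<Phi>(1)[of t \<tau>] \<Phi>(1)[of 0 t] \<Phi>(2,3) that by auto
  have e0: "e0 \<ge> 0" "E \<ge> 0" by (auto simp: e0_def E_def intro: energy_nonneg sum_nonneg)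
  have w: "w \<ge> 0" "w = real \<tau> * ?T / 2 ^ K" by (simp_all add: w_def real_win[of K])
  have fin: "energy \<sigma> K \<le> w" unfolding w_def by (rule energy_finest[OF bounded inactive]) auto
  have Z: "?Z \<le> E + 2 * w" "?Z \<ge> 0"
    unfolding E_def using fin total_energy_nonneg[OF bounded inactive]
    by (simp_all add: total_energy_def w_def lessThan_Suc_atMost[symmetric])
  \<comment> \<open>Twice \<sigma> * walk is at most the increment of walk^2, and \<Phi> is
    increasing. So the harmful drift is bounded by the final square of the walk, which is the
    coarsest energy \<open>e0\<close>.\<close>
  have "(\<Sum>t<N. \<Phi> t * (\<sigma> t * walk \<sigma> t)) \<le> \<Phi> N * (walk \<sigma> N)\<^sup>2 / 2" if "N \<le> \<tau>" for N
    using that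
  proof (induction N)
    case (Suc N)
    have "\<sigma> N * walk \<sigma> N \<le> ((walk \<sigma> (Suc N))\<^sup>2 - (walk \<sigma> N)\<^sup>2) / 2"
      by (simp add: walk_Suc power2_eq_square algebra_simps)
    then have "\<Phi> N * (\<sigma> N * walk \<sigma> N) \<le> \<Phi> N * (((walk \<sigma> (Suc N))\<^sup>2 - (walk \<sigma> N)\<^sup>2) / 2)"
      using \<Phi>_le[of N] Suc.prems by (intro mult_left_mono) auto
    moreover have "\<Phi> N * (walk \<sigma> (Suc N))\<^sup>2 \<le> \<Phi> (Suc N) * (walk \<sigma> (Suc N))\<^sup>2"
      using \<Phi>(1)[of N "Suc N"] Suc.prems by (intro mult_right_mono) auto
    ultimately show ?case using Suc by (simp add: field_simps)
  qed (use \<Phi>_le in simp)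
  from this[of \<tau>] have "(\<Sum>t<\<tau>. \<Phi> t * (\<sigma> t * walk \<sigma> t)) \<le> \<Phi> \<tau> * (walk \<sigma> \<tau>)\<^sup>2 / 2" by simp
  also have "(walk \<sigma> \<tau>)\<^sup>2 = e0"
  proof -
    have "walk \<sigma> (win 0) - walk \<sigma> \<tau> = 0" using walk_diff[OF \<tau>_le] inactive by simp
    then show ?thesis by (simp add: e0_def energy_def block_def)
  qed
  also have "\<Phi> \<tau> * e0 / 2 \<le> \<Phi> 0 * e0"
    using mult_right_mono[OF \<Phi>(3) e0(1)] by simp
  finally have "(\<Sum>t<\<tau>. \<mu> * (\<Phi> t * (\<sigma> t * walk \<sigma> t)) / len) \<le> \<mu> * (\<Phi> 0 * e0) / len"
    unfolding sum_divide_distrib[symmetric] sum_distrib_left[symmetric]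
    using pos len_pos by (intro divide_right_mono mult_left_mono) auto
  also have "\<dots> = \<mu> * \<Phi> 0 * (e0 / len)" by simp
  \<comment> \<open>Here the ratio of \<alpha> to \<beta> enters: on the scale 1 / (\<beta> T) the
    drift is e0 / 7, just below the 3/20 e0 that is gained.\<close>
  also have "\<dots> \<le> \<mu> * \<Phi> 0 * (e0 / (7 * ?T * \<beta>))"
    using len T \<beta>_ge pos e0 \<Phi>(2) len_pos by (intro mult_left_mono divide_left_mono) auto
  finally have 1: "(\<Sum>t<\<tau>. \<mu> * (\<Phi> t * (\<sigma> t * walk \<sigma> t)) / len) \<le> \<mu> * \<Phi> 0 * (e0 / (7 * ?T * \<beta>))" .
  define a where "a = (\<lambda>t. \<Sum>k<K. weight (Suc k) * (\<sigma> t * tilt \<beta> \<sigma> (Suc k) t))"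
  have gain_a: "gain \<beta> \<sigma> v = (\<Sum>t<v. a t)" for v by (simp add: gain_def a_def)
  have trunc: "truncate \<tau> \<sigma> = \<sigma>" by (rule ext) (simp add: truncate_def inactive)
  have "(\<Sum>t<\<tau>. (g (Suc t) - g t) * gain \<beta> \<sigma> (Suc t)) \<le> (\<Sum>t<\<tau>. \<gamma> * \<Phi> 0 / ?T * max 0 (gain \<beta> \<sigma> (Suc t)))"
  proof (intro sum_mono)
    fix t assume "t \<in> {..<\<tau>}"
    then have "0 \<le> g (Suc t) - g t" "g (Suc t) - g t \<le> \<gamma> * \<Phi> 0 / ?T" using g(1,2)[of t] by auto
    then have "(g (Suc t) - g t) * gain \<beta> \<sigma> (Suc t) \<le> (g (Suc t) - g t) * max 0 (gain \<beta> \<sigma> (Suc t))"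
      by (intro mult_left_mono) auto
    also have "\<dots> \<le> \<gamma> * \<Phi> 0 / ?T * max 0 (gain \<beta> \<sigma> (Suc t))"
      using \<open>g (Suc t) - g t \<le> _\<close> by (intro mult_right_mono) auto
    finally show "(g (Suc t) - g t) * gain \<beta> \<sigma> (Suc t) \<le> \<gamma> * \<Phi> 0 / ?T * max 0 (gain \<beta> \<sigma> (Suc t))" .
  qed
  also have "\<dots> = \<gamma> * \<Phi> 0 / ?T * (\<Sum>t<\<tau>. max 0 (gain \<beta> \<sigma> (Suc t)))" by (simp add: sum_distrib_left)
  also have "\<dots> \<le> \<gamma> * \<Phi> 0 / ?T * (2 * ?Z / \<beta>)"
    using pos \<Phi>(2) by (intro mult_left_mono gain_upper_sum) auto
  finally have parts: "(\<Sum>t<\<tau>. (g (Suc t) - g t) * gain \<beta> \<sigma> (Suc t)) \<le> \<Phi> 0 * (2 * \<gamma> / (\<beta> * ?T) * ?Z)"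
    by (simp add: field_simps)
  have "gain \<beta> \<sigma> \<tau> = (e0 + E / real K) / (2 * \<beta> * ?T) - energy \<sigma> K / (\<beta> * ?T)"
    using gain_eq[OF \<tau>_le _ K_pos, of \<beta> \<sigma>] \<beta>_ge by (simp add: trunc e0_def E_def diff_divide_distrib)
  then have "g \<tau> * gain \<beta> \<sigma> \<tau> = g \<tau> * ((e0 + E / real K) / (2 * \<beta> * ?T)) - g \<tau> * (energy \<sigma> K / (\<beta> * ?T))"
    by (simp only: right_diff_distrib)
  \<comment> \<open>The lower bound on \<open>g \<tau>\<close> applies to the positive part of the
    gain and the upper bound to the finest energy, which enters negatively and is at most
    \<open>w\<close>.\<close>
  also have "\<dots> \<ge> 3 / 10 * \<Phi> 0 * ((e0 + E / real K) / (2 * \<beta> * ?T)) - 2 * \<Phi> 0 * (w / (\<beta> * ?T))"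
    using g(3,4) e0 w fin \<beta>_ge T \<Phi>(2) energy_nonneg[of \<sigma> K]
    by (intro diff_mono mult_mono divide_right_mono divide_nonneg_nonneg add_nonneg_nonneg) auto
  finally have lower: "3 / 10 * \<Phi> 0 * ((e0 + E / real K) / (2 * \<beta> * ?T)) - 2 * \<Phi> 0 * (w / (\<beta> * ?T)) \<le> g \<tau> * gain \<beta> \<sigma> \<tau>" .
  have by_parts: "(\<Sum>t<\<tau>. g t * a t) = g \<tau> * gain \<beta> \<sigma> \<tau> - (\<Sum>t<\<tau>. (g (Suc t) - g t) * gain \<beta> \<sigma> (Suc t))"
    using sum_by_parts[of g a \<tau>] by (simp only: gain_a)
  have "\<Phi> 0 * (3 / 20 * (e0 + E / real K) / (\<beta> * ?T) - 2 * w / (\<beta> * ?T) - 2 * \<gamma> / (\<beta> * ?T) * ?Z)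
      = 3 / 10 * \<Phi> 0 * ((e0 + E / real K) / (2 * \<beta> * ?T)) - 2 * \<Phi> 0 * (w / (\<beta> * ?T)) - \<Phi> 0 * (2 * \<gamma> / (\<beta> * ?T) * ?Z)"
    by (simp add: algebra_simps add_divide_distrib)
  then have "(\<Sum>t<\<tau>. g t * a t) \<ge> \<Phi> 0 * (3 / 20 * (e0 + E / real K) / (\<beta> * ?T) - 2 * w / (\<beta> * ?T)
      - 2 * \<gamma> / (\<beta> * ?T) * ?Z)"
    using by_parts lower parts by linarith
  from mult_left_mono[OF this pos(1)] have 2: "\<mu> * (\<Sum>t<\<tau>. g t * a t) \<ge> \<mu> * \<Phi> 0 * (3 / 20 * (e0 + E / real K) / (\<beta> * ?T) - 2 * w / (\<beta> * ?T)
      - 2 * \<gamma> / (\<beta> * ?T) * ?Z)"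
    by (simp only: mult.assoc)
  define b where "b = (\<lambda>t. (\<Sum>k<K. weight (Suc k) * (tilt \<beta> \<sigma> (Suc k) t)\<^sup>2))"
  have "(\<Sum>t<\<tau>. \<Phi> t * (b t + (walk \<sigma> t)\<^sup>2 / len\<^sup>2)) \<le> (\<Sum>t<\<tau>. 2 * \<Phi> 0 * (b t + (walk \<sigma> t)\<^sup>2 / len\<^sup>2))"
    using \<Phi>_le by (intro sum_mono mult_right_mono) (auto simp: b_def intro!: add_nonneg_nonneg sum_nonneg mult_nonneg_nonneg weight_nonneg)
  also have "\<dots> = 2 * \<Phi> 0 * ((\<Sum>t<\<tau>. b t) + (\<Sum>t<\<tau>. (walk \<sigma> t)\<^sup>2) / len\<^sup>2)"
    by (simp only: sum_distrib_left[symmetric] sum.distrib sum_divide_distrib[symmetric])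
  also have "\<dots> \<le> 2 * \<Phi> 0 * (4 * ?Z / (\<beta>\<^sup>2 * ?T) + ?T * ?Z / len\<^sup>2)"
    using \<Phi>(2) walk_sq_sum_le[OF bounded inactive \<tau>_le] tilt_second_moment unfolding b_def
    by (intro mult_left_mono add_mono divide_right_mono) auto
  finally have "C * \<mu>\<^sup>2 * (\<Sum>t<\<tau>. \<Phi> t * (b t + (walk \<sigma> t)\<^sup>2 / len\<^sup>2))
      \<le> C * \<mu>\<^sup>2 * (2 * \<Phi> 0 * (4 * ?Z / (\<beta>\<^sup>2 * ?T) + ?T * ?Z / len\<^sup>2))"
    using pos by (intro mult_left_mono) auto
  also have "\<dots> = \<mu> * \<Phi> 0 * (2 * C * \<mu> * (4 / \<beta> + \<beta> * ?T\<^sup>2 / len\<^sup>2) / (\<beta> * ?T) * ?Z)"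
    using T \<beta>_ge len_pos by (simp add: field_simps power2_eq_square)
  finally have 3: "C * \<mu>\<^sup>2 * (\<Sum>t<\<tau>. \<Phi> t * (b t + (walk \<sigma> t)\<^sup>2 / len\<^sup>2))
      \<le> \<mu> * \<Phi> 0 * (2 * C * \<mu> * (4 / \<beta> + \<beta> * ?T\<^sup>2 / len\<^sup>2) / (\<beta> * ?T) * ?Z)" .
  \<comment> \<open>\<open>R\<close> collects all second-order terms: the remainder of the summation
    by parts, the squared tilts and the squared walk. By \<open>small\<close> it is at most 3 / (20
    K), so the slope term E / K of the gain pays for it.\<close>
  define R where "R = 2 * \<gamma> + 2 * C * \<mu> * (4 / \<beta> + \<beta> * ?T\<^sup>2 / len\<^sup>2)"
  have "R * real K \<le> 3 / 20" using small by (simp add: R_def algebra_simps)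
  then have R: "R \<le> 3 / 20 / real K" using K_pos by (simp add: field_simps)
  have R0: "R \<ge> 0" unfolding R_def using pos \<beta>_ge by (intro add_nonneg_nonneg mult_nonneg_nonneg) auto
  have "R * ?Z \<le> R * (E + 2 * w)" using Z R0 by (intro mult_left_mono) auto
  also have "\<dots> \<le> 3 / 20 / real K * (E + 2 * w)" using R e0 w by (intro mult_right_mono) auto
  also have "\<dots> = 3 / 20 * (E / real K) + 3 / 10 * (w / real K)"
    by (simp add: algebra_simps add_divide_distrib)
  also have "\<dots> \<le> 3 / 20 * (E / real K) + 3 / 10 * w"
    using w(1) K_pos divide_left_mono[of 1 "real K" w] by simp
  finally have RZ: "R * ?Z \<le> 3 / 20 * (E / real K) + 3 / 10 * w" .
  \<comment> \<open>Since 1/7 < 3/20 the coarsest energy is paid, the terms in \<open>E\<close>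
    cancel, and only multiples of \<open>w\<close> remain, which carry the factor
    \<open>2 ^ -K\<close>.\<close>
  have "e0 / 7 - 3 / 20 * (e0 + E / real K) + 2 * w + R * ?Z \<le> 3 * w"
  proof -
    define F where "F = E / real K"
    have "e0 / 7 - 3 / 20 * (e0 + F) + 2 * w + R * ?Z \<le> 3 * w"
      using RZ[folded F_def] e0 w(1) by argo
    then show ?thesis by (simp add: F_def)
  qed
  then have "(e0 / 7 - 3 / 20 * (e0 + E / real K) + 2 * w + R * ?Z) / (\<beta> * ?T) \<le> 3 * w / (\<beta> * ?T)"
    using \<beta>_ge T by (intro divide_right_mono) auto
  also have "\<dots> \<le> 3 * w / (1 * ?T)"
    using \<beta>_ge T w by (intro divide_left_mono mult_right_mono) auto
  also have "\<dots> = 3 * real \<tau> / 2 ^ K" using T w(2) by simp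
  finally have fin2: "(e0 / 7 - 3 / 20 * (e0 + E / real K) + 2 * w + R * ?Z) / (\<beta> * ?T) \<le> 3 * real \<tau> / 2 ^ K" .
  have "e0 / (7 * ?T * \<beta>) - (3 / 20 * (e0 + E / real K) / (\<beta> * ?T) - 2 * w / (\<beta> * ?T) - 2 * \<gamma> / (\<beta> * ?T) * ?Z)
      + 2 * C * \<mu> * (4 / \<beta> + \<beta> * ?T\<^sup>2 / len\<^sup>2) / (\<beta> * ?T) * ?Z
      = (e0 / 7 - 3 / 20 * (e0 + E / real K) + 2 * w + R * ?Z) / (\<beta> * ?T)"
  proof -
    have "e0 / (7 * y) - (x / y - z / y - c / y * ?Z) + h / y * ?Z = (e0 / 7 - x + z + (c + h) * ?Z) / y"
      if "y > 0" for x y z c h :: real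
      using that by (simp add: field_simps)
    from this[of "\<beta> * ?T" "3 / 20 * (e0 + E / real K)" "2 * w" "2 * \<gamma>"
        "2 * C * \<mu> * (4 / \<beta> + \<beta> * ?T\<^sup>2 / len\<^sup>2)"]
    show ?thesis
      unfolding R_def using T \<beta>_ge by (simp only: mult.commute[of ?T \<beta>] mult.assoc mult_pos_pos less_le_trans[OF zero_less_one])
  qed
  then have 4: "\<mu> * \<Phi> 0 * (e0 / (7 * ?T * \<beta>)) - \<mu> * \<Phi> 0 * (3 / 20 * (e0 + E / real K) / (\<beta> * ?T) - 2 * w / (\<beta> * ?T) - 2 * \<gamma> / (\<beta> * ?T) * ?Z)
      + \<mu> * \<Phi> 0 * (2 * C * \<mu> * (4 / \<beta> + \<beta> * ?T\<^sup>2 / len\<^sup>2) / (\<beta> * ?T) * ?Z)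
      \<le> \<mu> * \<Phi> 0 * (3 * real \<tau> / 2 ^ K)"
    unfolding right_diff_distrib[symmetric] distrib_left[symmetric]
    using fin2 pos \<Phi>(2) by (intro mult_left_mono) auto
  have comb: "x - y + z \<le> u" if "x \<le> X" "Y \<le> y" "z \<le> Z" "X - Y + Z \<le> u" for x y z X Y Z u :: real
    using that by linarith
  have "3 * \<mu> * \<Phi> 0 * real \<tau> / 2 ^ K = \<mu> * \<Phi> 0 * (3 * real \<tau> / 2 ^ K)" by simp
  then show ?thesis using comb[OF 1 2 3 4] unfolding a_def b_def by (simp only:)
qed

end

end

section \<open>Upper bounds on expectations\<close>

text \<open>Integrals in the extended nonnegative reals need no integrability, which is derived only
  at the very end. Negative values of \<open>g\<close> count as 0.\<close>

definition expect_le :: "'b pmf \<Rightarrow> ('b \<Rightarrow> real) \<Rightarrow> real \<Rightarrow> bool" where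
  "expect_le M g v \<longleftrightarrow> (\<integral>\<^sup>+ x. ennreal (g x) \<partial>measure_pmf M) \<le> ennreal v"

lemma expect_le_mono:
  assumes "expect_le M g v" "\<And>x. x \<in> set_pmf M \<Longrightarrow> h x \<le> g x" "v \<le> u"
  shows "expect_le M h u"
proof -
  have "(\<integral>\<^sup>+ x. ennreal (h x) \<partial>measure_pmf M) \<le> (\<integral>\<^sup>+ x. ennreal (g x) \<partial>measure_pmf M)"
    using assms(2) by (intro nn_integral_mono_AE) (auto simp: AE_measure_pmf_iff intro: ennreal_leI)
  also have "\<dots> \<le> ennreal u"
    using assms unfolding expect_le_def by (meson ennreal_leI order_trans)
  finally show ?thesis by (simp add: expect_le_def)
qed

lemma expect_le_weaken: "expect_le M g v \<Longrightarrow> v \<le> u \<Longrightarrow> expect_le M g u"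
  by (rule expect_le_mono) auto

lemma expect_le_return: "g x \<le> v \<Longrightarrow> expect_le (return_pmf x) g v"
  by (simp add: expect_le_def ennreal_leI)

lemma expect_le_map: "expect_le M (\<lambda>x. g (f x)) v \<Longrightarrow> expect_le (map_pmf f M) g v"
  by (simp add: expect_le_def)

text \<open>The composition rule of the whole cost analysis: a random step is bounded for every
  fixed outcome of the earlier ones, and \<open>h\<close> is that bound as a function of the
  outcome.\<close>

lemma expect_le_bind:
  assumes "expect_le M h v" "\<And>x. x \<in> set_pmf M \<Longrightarrow> expect_le (N x) g (h x)"
  shows "expect_le (M \<bind> N) g v"
proof -
  have "(\<integral>\<^sup>+ x. ennreal (g x) \<partial>measure_pmf (M \<bind> N)) = (\<integral>\<^sup>+ x. (\<integral>\<^sup>+ y. ennreal (g y) \<partial>measure_pmf (N x)) \<partial>measure_pmf M)"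
    by (rule nn_integral_bind_pmf)
  also have "\<dots> \<le> (\<integral>\<^sup>+ x. ennreal (h x) \<partial>measure_pmf M)"
    using assms(2) by (intro nn_integral_mono_AE) (auto simp: AE_measure_pmf_iff expect_le_def)
  finally show ?thesis using assms(1) unfolding expect_le_def by (rule order_trans)
qed

lemma expect_le_add_const:
  assumes "expect_le M g v" "c \<ge> 0" "v \<ge> 0"
  shows "expect_le M (\<lambda>x. c + g x) (c + v)"
proof -
  have "(\<integral>\<^sup>+ x. ennreal (c + g x) \<partial>measure_pmf M) \<le> (\<integral>\<^sup>+ x. ennreal c + ennreal (g x) \<partial>measure_pmf M)"
  proof (intro nn_integral_mono)
    fix x
    show "ennreal (c + g x) \<le> ennreal c + ennreal (g x)"
      using assms(2) by (cases "g x \<ge> 0") (auto simp: ennreal_plus ennreal_neg intro!: ennreal_leI)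
  qed
  also have "\<dots> = ennreal c + (\<integral>\<^sup>+ x. ennreal (g x) \<partial>measure_pmf M)"
    by (subst nn_integral_add) auto
  also have "\<dots> \<le> ennreal c + ennreal v"
    using assms by (intro add_left_mono) (simp add: expect_le_def)
  finally show ?thesis using assms by (simp add: expect_le_def ennreal_plus)
qed

lemma expect_le_expectation:
  assumes "expect_le M g v" "\<And>x. g x \<ge> 0" "v \<ge> 0"
  shows "integrable (measure_pmf M) g" "measure_pmf.expectation M g \<le> v"
proof -
  have le: "(\<integral>\<^sup>+ x. ennreal (g x) \<partial>measure_pmf M) \<le> ennreal v" using assms(1) by (simp add: expect_le_def)
  show "integrable (measure_pmf M) g"
    using assms(2) le by (intro integrableI_nonneg) (auto simp: less_top[symmetric] top_unique)
  have "measure_pmf.expectation M g = enn2real (\<integral>\<^sup>+ x. ennreal (g x) \<partial>measure_pmf M)"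
    using assms(2) by (intro integral_eq_nn_integral) auto
  also have "\<dots> \<le> v" using le assms(3) by (rule enn2real_leI[rotated])
  finally show "measure_pmf.expectation M g \<le> v" .
qed

section \<open>The drift of the density along a root-to-leaf path\<close>

lemma exp_le_quadratic:
  fixes z :: real
  assumes "z \<le> 1"
  shows "exp z \<le> 1 + z + z\<^sup>2"
proof (cases "z \<ge> 0")
  case True
  then show ?thesis using assms exp_bound[of z] by simp
next
  case False
  have "(1 - z) * exp z \<le> exp (- z) * exp z"
    using exp_ge_add_one_self[of "- z"] by (intro mult_right_mono) auto
  \<comment> \<open>The right side is 1 - z^3, which is at least 1 for negative \<open>z\<close>,
    and the left side is exp 0.\<close>
  also have "\<dots> \<le> (1 - z) * (1 + z + z\<^sup>2)"
    using False by (simp add: algebra_simps power2_eq_square flip: exp_add) (intro mult_nonpos_nonneg mult_nonpos_nonpos, auto)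
  finally show ?thesis using False by (subst (asm) mult_le_cancel_left_pos) auto
qed

text \<open>The tangent of the logarithm at 16 suffices, with ln 2 \<ge> 1/2 as numerical
  input.\<close>

lemma log2_le_half:
  fixes x :: real
  assumes "x \<ge> 16"
  shows "2 * log 2 x \<le> x"
proof -
  have "ln (x / 16) \<le> x / 16 - 1" using assms by (intro ln_le_minus_one) auto
  moreover have "ln 16 = 4 * ln (2::real)" using ln_realpow[of 2 4] by simp
  ultimately have "ln x \<le> x / 16 - 1 + 4 * ln 2" using assms by (simp add: ln_div)
  moreover have ln2: "ln (2::real) \<ge> 1 / 2" using ln_le_minus_one[of "1 / 2 :: real"] by (simp add: ln_div)
  moreover have "2 * (x / 16 - 1 + 4 * ln 2) \<le> x * ln 2"
  proof -
    have "x / 8 * 1 \<le> x / 8 * (2 * ln 2)" using ln2 assms by (intro mult_left_mono) auto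
    then have "x / 8 \<le> x * ln 2 / 4" by simp
    moreover have "8 * ln 2 \<le> x * ln (2::real) / 2" using ln2 assms mult_right_mono[of 16 x "ln 2"] by simp
    moreover have "x * ln 2 \<ge> 0" using assms ln2 by simp
    ultimately show ?thesis by argo
  qed
  ultimately have "2 * ln x \<le> x * ln 2" by argo
  then show ?thesis using ln2 by (simp add: log_def field_simps)
qed

lemma (in dyadic) tilt_abs_le:
  assumes "\<And>t. \<bar>\<sigma> t\<bar> \<le> 1" "\<beta> > 0"
  shows "\<bar>tilt \<beta> \<sigma> k t\<bar> \<le> 2 / \<beta>"
proof -
  have "\<bar>block \<sigma> k j\<bar> \<le> real (win k)" for j
  proof -
    have "\<bar>block \<sigma> k j\<bar> \<le> (\<Sum>u\<in>{j * win k..<j * win k + win k}. \<bar>\<sigma> u\<bar>)"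
      unfolding block_sum by (rule sum_abs)
    also have "\<dots> \<le> real (card {j * win k..<j * win k + win k}) * 1"
      using assms(1) by (intro sum_bounded_above) auto
    finally show ?thesis by simp
  qed
  then have "2 * \<bar>block \<sigma> k (t div win k - 1)\<bar> / (\<beta> * real (win k)) \<le> 2 * real (win k) / (\<beta> * real (win k))"
    using assms(2) by (intro divide_right_mono) auto
  also have "\<dots> = 2 / \<beta>" using win_pos[of k] by simp
  finally show ?thesis using assms(2) by (simp add: tilt_def abs_mult)
qed

section \<open>Parameters for large n\<close>

locale see_saw_large = see_saw +
  assumes C\<alpha>_ge: "C\<alpha> \<ge> 100000" and C\<beta>_ge: "C\<beta> \<ge> 100000" and C\<alpha>\<beta>: "C\<alpha> \<ge> 100000 * C\<beta>"
    and loglog_ge: "log 2 (log 2 n) \<ge> 10"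
    and loglog_small: "1000 * log 2 (log 2 n) \<le> log 2 n"
    and size_large: "1000000 * \<alpha> * (log 2 n) ^ 3 \<le> 2 powr sqrt (log 2 n)"
begin

abbreviation (input) "lg \<equiv> log 2 n"
abbreviation (input) "llg \<equiv> log 2 (log 2 n)"

definition \<mu> :: real where "\<mu> = 8 * ln (log 2 n)"

text \<open>Only subarrays longer than 3 * \<open>min_len\<close> are split, and each child keeps
  more than a third of the width, so every subproblem that occurs is at least this long.\<close>

definition min_len :: real where "min_len = 2 powr sqrt (log 2 n) / 3"

lemma lg_ge: "lg \<ge> 10000"
  using loglog_ge loglog_small by simp

lemma \<mu>_bounds: "\<mu> \<ge> 1" "\<mu> \<le> 8 * llg"
proof -
  have ln2: "ln (2::real) \<ge> 1 / 2" "ln (2::real) \<le> 1"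
    using ln_le_minus_one[of "1 / 2 :: real"] ln_le_minus_one[of "2 :: real"] by (simp_all add: ln_div)
  have \<mu>: "\<mu> = 8 * ln 2 * llg" using ln2 by (simp add: \<mu>_def log_def)
  have "8 * (1 / 2) * 10 \<le> 8 * ln 2 * llg" using ln2 loglog_ge by (intro mult_mono) auto
  then show "\<mu> \<ge> 1" using \<mu> by simp
  have "8 * ln 2 * llg \<le> 8 * 1 * llg" using ln2 loglog_ge by (intro mult_mono) auto
  then show "\<mu> \<le> 8 * llg" using \<mu> by simp
qed

lemma k_max_bounds: "2 * llg \<le> real k_max" "real k_max \<le> 3 * llg" "k_max > 0"
  using loglog_ge unfolding k_max_def by linarith+

lemma two_power_k_max: "lg\<^sup>2 \<le> 2 ^ k_max" "2 ^ k_max \<le> 2 * lg\<^sup>2"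
proof -
  have sq: "2 powr (2 * llg) = lg\<^sup>2"
    using lg_ge powr_powr[of 2 llg 2] by (simp add: mult.commute)
  have "2 powr (2 * llg) \<le> 2 powr real k_max" using k_max_bounds by (intro powr_mono) auto
  then show "lg\<^sup>2 \<le> 2 ^ k_max" using sq by (simp add: powr_realpow)
  have "real k_max \<le> 2 * llg + 1" using loglog_ge unfolding k_max_def by linarith
  then have "2 powr real k_max \<le> 2 powr (2 * llg + 1)" by (intro powr_mono) auto
  then show "2 ^ k_max \<le> 2 * lg\<^sup>2" using sq by (simp add: powr_realpow powr_add)
qed

lemma \<alpha>_eq: "\<alpha> = C\<alpha> * llg\<^sup>2" and \<beta>_eq: "\<beta> = C\<beta> * llg\<^sup>2"
  by (simp_all add: \<alpha>_def \<beta>_def)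

lemma llg_sq: "llg\<^sup>2 \<ge> 10 * llg"
  using mult_right_mono[OF loglog_ge, of llg] loglog_ge by (simp add: power2_eq_square)

lemma \<alpha>_ge: "\<alpha> \<ge> 100000 * llg\<^sup>2" and \<beta>_ge: "\<beta> \<ge> 100000 * llg\<^sup>2" and \<alpha>\<beta>: "\<alpha> \<ge> 100000 * \<beta>"
  unfolding \<alpha>_eq \<beta>_eq mult.assoc[symmetric] using C\<alpha>_ge C\<beta>_ge C\<alpha>\<beta>
  by (intro mult_right_mono; simp)+

lemma \<alpha>_large: "\<alpha> \<ge> 10000000" and \<beta>_large: "\<beta> \<ge> 10000000"
  using \<alpha>_ge \<beta>_ge llg_sq loglog_ge by linarith+

lemma \<mu>_sq_le: "\<mu>\<^sup>2 \<le> \<alpha>"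
proof -
  have "\<mu>\<^sup>2 \<le> (8 * llg)\<^sup>2" using \<mu>_bounds by (intro power_mono) auto
  also have "\<dots> \<le> 100000 * llg\<^sup>2" by (simp add: power_mult_distrib)
  finally show ?thesis using \<alpha>_ge by simp
qed

text \<open>The third bound makes even the shortest window nonempty; the first one keeps the
  rounding errors of a level below 1 / log n.\<close>

lemma min_len_ge:
  "min_len \<ge> 300000 * \<alpha> * lg ^ 3" "min_len \<ge> 1000000" "2 * \<alpha> * 2 ^ k_max \<le> min_len"
proof -
  show 1: "min_len \<ge> 300000 * \<alpha> * lg ^ 3"
  proof -
    have "0 \<le> \<alpha> * lg ^ 3" using \<alpha>_large lg_ge by simp
    then show ?thesis using size_large unfolding min_len_def mult.assoc by linarith
  qed
  have lg3: "lg ^ 3 \<ge> lg\<^sup>2" using lg_ge by (intro power_increasing) auto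
  have "1 \<le> lg\<^sup>2" using lg_ge by simp
  then have lg1: "lg ^ 3 \<ge> 1" using lg3 by linarith
  have "300000 * 10000000 * 1 \<le> 300000 * \<alpha> * lg ^ 3"
    using \<alpha>_large lg1 by (intro mult_mono) auto
  then show "min_len \<ge> 1000000" using 1 by simp
  have "2 * \<alpha> * 2 ^ k_max \<le> 2 * \<alpha> * (2 * lg ^ 3)"
    using two_power_k_max lg3 \<alpha>_large by (intro mult_left_mono) linarith+
  also have "\<dots> \<le> 300000 * \<alpha> * lg ^ 3" using \<alpha>_large lg_ge by simp
  finally show "2 * \<alpha> * 2 ^ k_max \<le> min_len" using 1 by simp
qed

lemma lifetime_bounds:
  assumes "real len \<ge> min_len"
  shows "min_window len > 0" "real (lifetime len) \<le> real len / \<alpha>" "real len / (2 * \<alpha>) \<le> real (lifetime len)"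
    "lifetime len > 0"
proof -
  define x where "x = real len / (\<alpha> * 2 ^ k_max)"
  have pos: "\<alpha> * 2 ^ k_max > 0" using \<alpha>_large by simp
  \<comment> \<open>From 2 on, rounding down loses at most half.\<close>
  have x: "x \<ge> 2" unfolding x_def using assms min_len_ge(3) pos by (simp add: field_simps)
  have w: "real (min_window len) \<le> x" "x < real (min_window len) + 1"
    unfolding min_window_def x_def[symmetric] using x by linarith+
  show mw: "min_window len > 0" using w x by linarith
  then show "lifetime len > 0" by (simp add: lifetime_def)
  have lt: "real (lifetime len) = 2 ^ k_max * real (min_window len)" by (simp add: lifetime_def)
  have x1: "2 ^ k_max * x = real len / \<alpha>" by (simp add: x_def)
  show "real (lifetime len) \<le> real len / \<alpha>"
    unfolding lt x1[symmetric] using w by (intro mult_left_mono) auto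
  have "x / 2 \<le> real (min_window len)" using w x by linarith
  then have "2 ^ k_max * (x / 2) \<le> real (lifetime len)" unfolding lt by (intro mult_left_mono) auto
  then show "real len / (2 * \<alpha>) \<le> real (lifetime len)" using x1 by (simp add: field_simps)
qed

text \<open>Bounds the number of levels below, as a child has at most 2/3 of the width of its
  parent. The maximum with 1 keeps the logarithm nonnegative also for width 0.\<close>

definition depth :: "nat \<Rightarrow> real" where "depth len = log (3 / 2) (max 1 (real len))"

text \<open>Savings per insertion: a reset moves at most \<open>len\<close> elements after at least
  len / (2 \<alpha>) insertions, a rebuild after at least len / (2 \<alpha> 2^k) of them.\<close>

definition node_charge :: "nat \<Rightarrow> real" where "node_charge k = 2 * \<alpha> + 2 * \<alpha> * 2 ^ k"

text \<open>Bound for the expected cost of one insertion into a subtree of width \<open>len\<close>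
  holding \<open>c\<close> elements. The first two summands pay for a short leaf, the third for the
  non-leaves on the path. The last pays for a dense leaf: it is at least 2000 (log n)^2 at density
  3/4. Its factor exp (depth / log n) allows growth by 1 + 1 / log n per level; the summand with exp
  (\<mu> / 3) belongs to sparse nodes.\<close>

definition charge :: "nat \<Rightarrow> real \<Rightarrow> real" where
  "charge len c = 2 * \<alpha> + 400 * lg + 2 * \<alpha> * (real k_max + 2) * depth len
     + 2000 * lg\<^sup>2 * exp (depth len / lg) * exp (- 3 / 4 * \<mu>)
       * (exp (\<mu> * c / real len) + depth len * exp (\<mu> / 3))"

lemma depth_nonneg: "depth len \<ge> 0"
  unfolding depth_def by (subst zero_le_log_cancel_iff) auto

lemma charge_nonneg: "charge len c \<ge> 0"
  unfolding charge_def using \<alpha>_large lg_ge depth_nonneg[of len]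
  by (intro add_nonneg_nonneg mult_nonneg_nonneg) auto

lemma depth_child:
  assumes "len' \<ge> 1" "3 * real len' \<le> 2 * real len"
  shows "depth len' \<le> depth len - 1"
proof -
  have "log (3 / 2) (real len') \<le> log (3 / 2) (real len / (3 / 2))"
    using assms by (subst log_le_cancel_iff) auto
  also have "\<dots> = log (3 / 2) (real len) - 1"
    using assms by (subst log_divide) auto
  finally show ?thesis using assms by (simp add: depth_def max_absorb2)
qed

lemma p_eq_weight:
  assumes "k < k_max"
  shows "p (Suc k) = (1 / 2) ^ (Suc k + 1) * (1 + real (Suc k) / real k_max)"
  using assms by (simp add: p_def)

lemma sum_p: "(\<Sum>k\<le>k_max. p k) = 1"
proof -
  have "(\<Sum>k\<le>k_max. p k) = p 0 + (\<Sum>k = 1..k_max. p k)"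
    by (simp add: sum.atMost_shift sum.atLeast1_atMost_eq)
  also have "(\<Sum>k = 1..k_max. p k) = 1 - p 0"
    by (simp add: p_def Let_def)
  finally show ?thesis by simp
qed

text \<open>Each skew contributes p k * 2^k \<le> 1: its probability outweighs the frequency of its
  rebuilds, and there are only \<open>k_max + 1\<close> values.\<close>

lemma expected_node_charge: "(\<Sum>k\<le>k_max. p k * node_charge k) \<le> 2 * \<alpha> * (real k_max + 2)"
proof -
  have "p k * 2 ^ k \<le> 1" if "k \<le> k_max" for k
  proof (cases k)
    case 0
    have "p 0 \<le> (\<Sum>k\<le>k_max. p k)" by (intro member_le_sum) (auto intro: p_nonneg)
    then show ?thesis using sum_p 0 by simp
  next
    case (Suc k')
    have "p k * 2 ^ k = (1 + real k / real k_max) / 2"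
      using that Suc by (subst Suc, subst p_eq_weight) (auto simp: power_divide field_simps)
    also have "\<dots> \<le> 1" using that k_max_bounds by simp
    finally show ?thesis .
  qed
  then have "(\<Sum>k\<le>k_max. p k * 2 ^ k) \<le> (\<Sum>k\<le>k_max. 1)" by (intro sum_mono) auto
  then have 1: "(\<Sum>k\<le>k_max. p k * 2 ^ k) \<le> real k_max + 1" by simp
  have "(\<Sum>k\<le>k_max. p k * node_charge k) = 2 * \<alpha> * (\<Sum>k\<le>k_max. p k) + 2 * \<alpha> * (\<Sum>k\<le>k_max. p k * 2 ^ k)"
    unfolding sum_distrib_left sum.distrib[symmetric] by (intro sum.cong) (auto simp: node_charge_def algebra_simps)
  also have "\<dots> \<le> 2 * \<alpha> * 1 + 2 * \<alpha> * (real k_max + 1)"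
    using 1 \<alpha>_large unfolding sum_p by (intro add_mono mult_left_mono) auto
  finally show ?thesis by (simp add: algebra_simps)
qed

text \<open>Expansion of the density \<open>(d + \<sigma> v) / (1 + \<sigma> u)\<close> of a child to second order.\<close>

lemma exp_density_child:
  fixes d u v u0 v0 e :: real
  assumes \<sigma>: "\<sigma> = 1 \<or> \<sigma> = - 1" and d: "0 \<le> d" "d \<le> 1"
    and small: "4 * \<mu> * (\<bar>u\<bar> + \<bar>v\<bar>) \<le> 1"
    and u: "\<bar>u - u0\<bar> \<le> 2 * e" and v: "\<bar>v - v0\<bar> \<le> 4 * e" and e: "0 \<le> e" "e \<le> 1"
  shows "exp (\<mu> * ((d + \<sigma> * v) / (1 + \<sigma> * u)))
    \<le> exp (\<mu> * d) * (1 + \<mu> * (\<sigma> * v0) - \<mu> * (d * (\<sigma> * u0)) + 22 * \<mu>\<^sup>2 * (u0\<^sup>2 + v0\<^sup>2) + 446 * \<mu>\<^sup>2 * e)"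
proof -
  have \<mu>: "\<mu> \<ge> 1" by (rule \<mu>_bounds)
  have "4 * 1 * (\<bar>u\<bar> + \<bar>v\<bar>) \<le> 4 * \<mu> * (\<bar>u\<bar> + \<bar>v\<bar>)" using \<mu> by (intro mult_right_mono) auto
  then have uv: "\<bar>u\<bar> + \<bar>v\<bar> \<le> 1 / 4" using small by simp
  \<comment> \<open>\<open>y\<close> is the first-order change of the density and
    \<open>x = y / (1 + z)\<close> the exact one; they differ by the quadratic term x z.\<close>
  define y where "y = \<sigma> * (v - u * d)"
  define z where "z = \<sigma> * u"
  define x where "x = y / (1 + z)"
  have az: "\<bar>z\<bar> = \<bar>u\<bar>" using \<sigma> by (auto simp: z_def)
  have z: "\<bar>z\<bar> \<le> 1 / 2" using uv az by linarith
  have "\<bar>u * d\<bar> \<le> \<bar>u\<bar>" using d by (simp add: abs_mult mult_left_le)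
  then have ay: "\<bar>y\<bar> \<le> \<bar>u\<bar> + \<bar>v\<bar>" using \<sigma> by (auto simp: y_def)
  have eq: "(d + \<sigma> * v) / (1 + \<sigma> * u) = d + x"
    using z by (auto simp: x_def y_def z_def field_simps)
  have ax: "\<bar>x\<bar> \<le> 2 * \<bar>y\<bar>"
  proof -
    have "\<bar>y\<bar> / \<bar>1 + z\<bar> \<le> \<bar>y\<bar> / (1 / 2)" using z by (intro divide_left_mono) auto
    then show ?thesis by (simp add: x_def)
  qed
  have "x = y - x * z" using z by (auto simp: x_def field_simps)
  moreover have "- (x * z) \<le> 2 * \<bar>y\<bar> * \<bar>u\<bar>"
    using mult_mono[OF ax, of "\<bar>z\<bar>" "\<bar>u\<bar>"] az by (metis abs_ge_minus_self abs_ge_zero abs_mult mult_nonneg_nonneg order_refl order_trans zero_le_numeral)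
  ultimately have x: "x \<le> y + 2 * \<bar>y\<bar> * \<bar>u\<bar>" by linarith
  have "2 * \<bar>y\<bar> * \<bar>u\<bar> \<le> 2 * (\<bar>u\<bar> + \<bar>v\<bar>) * \<bar>u\<bar>" using ay by (intro mult_right_mono mult_left_mono) auto
  also have "\<dots> \<le> 3 * (u\<^sup>2 + v\<^sup>2)"
  proof -
    have "3 * (p\<^sup>2 + r\<^sup>2) - 2 * (p + r) * p = (p - r)\<^sup>2 + 2 * r\<^sup>2" for p r :: real
      by (simp add: power2_eq_square algebra_simps)
    then have "2 * (p + r) * p \<le> 3 * (p\<^sup>2 + r\<^sup>2)" for p r :: real
      by (metis add_nonneg_nonneg diff_ge_0_iff_ge zero_le_power2 zero_le_mult_iff zero_le_numeral)
    from this[of "\<bar>u\<bar>" "\<bar>v\<bar>"] show ?thesis by simp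
  qed
  finally have x1: "x \<le> y + 3 * (u\<^sup>2 + v\<^sup>2)" using x by simp
  have "x\<^sup>2 \<le> (2 * (\<bar>u\<bar> + \<bar>v\<bar>))\<^sup>2" using ax ay by (intro power2_le_iff_abs_le[THEN iffD2]) auto
  also have "\<dots> \<le> 8 * (u\<^sup>2 + v\<^sup>2)"
  proof -
    have "(2 * (p + r))\<^sup>2 \<le> 8 * (p\<^sup>2 + r\<^sup>2)" for p r :: real
      using zero_le_power2[of "p - r"] by (simp add: power2_eq_square algebra_simps)
    from this[of "\<bar>u\<bar>" "\<bar>v\<bar>"] show ?thesis by simp
  qed
  finally have x2: "x\<^sup>2 \<le> 8 * (u\<^sup>2 + v\<^sup>2)" .
  have "\<mu> * x \<le> \<mu> * (2 * (\<bar>u\<bar> + \<bar>v\<bar>))" using ax ay \<mu> by (intro mult_left_mono) auto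
  then have "\<mu> * x \<le> 1" using small \<mu> uv by (simp add: algebra_simps)
  then have "exp (\<mu> * x) \<le> 1 + \<mu> * x + (\<mu> * x)\<^sup>2" by (rule exp_le_quadratic)
  also have "\<dots> \<le> 1 + (\<mu> * y + \<mu>\<^sup>2 * (3 * (u\<^sup>2 + v\<^sup>2))) + \<mu>\<^sup>2 * (8 * (u\<^sup>2 + v\<^sup>2))"
  proof -
    have "\<mu> * x \<le> \<mu> * (y + 3 * (u\<^sup>2 + v\<^sup>2))" using x1 \<mu> by (intro mult_left_mono) auto
    moreover have "\<mu> * (3 * (u\<^sup>2 + v\<^sup>2)) \<le> \<mu>\<^sup>2 * (3 * (u\<^sup>2 + v\<^sup>2))"
      using \<mu> by (intro mult_right_mono) (auto simp: power2_eq_square)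
    moreover have "\<mu>\<^sup>2 * x\<^sup>2 \<le> \<mu>\<^sup>2 * (8 * (u\<^sup>2 + v\<^sup>2))" using x2 by (intro mult_left_mono) auto
    ultimately show ?thesis unfolding power_mult_distrib distrib_left by linarith
  qed
  also have "\<dots> = 1 + \<mu> * y + \<mu>\<^sup>2 * (11 * (u\<^sup>2 + v\<^sup>2))" by (simp add: algebra_simps)
  finally have 1: "exp (\<mu> * x) \<le> 1 + \<mu> * y + \<mu>\<^sup>2 * (11 * (u\<^sup>2 + v\<^sup>2))" .
  \<comment> \<open>Replaces the true deviations \<open>u\<close>, \<open>v\<close> by the ideal
    ones \<open>u0\<close>, \<open>v0\<close>. The rounding errors 2 e and 4 e contribute 11 (2 *
    2^2 + 2 * 4^2) = 440, and the linear term adds 6.\<close>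
  have sq: "a\<^sup>2 \<le> 2 * b\<^sup>2 + 2 * c\<^sup>2 * e" if "\<bar>a - b\<bar> \<le> c * e" "c \<ge> 0" for a b c :: real
  proof -
    have "(a - b)\<^sup>2 \<le> (c * e)\<^sup>2" using that e by (intro power2_le_iff_abs_le[THEN iffD2]) auto
    also have "\<dots> = c\<^sup>2 * (e * e)" by (simp add: power2_eq_square)
    also have "\<dots> \<le> c\<^sup>2 * e" using e by (intro mult_left_mono mult_left_le) auto
    finally show ?thesis using zero_le_power2[of "a - 2 * b"]
      by (simp add: power2_eq_square algebra_simps)
  qed
  have sq': "11 * (u\<^sup>2 + v\<^sup>2) \<le> 22 * (u0\<^sup>2 + v0\<^sup>2) + 440 * e"
    using sq[OF u] sq[OF v] by simp
  have "y - (\<sigma> * v0 - d * (\<sigma> * u0)) = \<sigma> * (v - v0) - \<sigma> * d * (u - u0)" by (simp add: y_def algebra_simps)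
  also have "\<dots> \<le> \<bar>v - v0\<bar> + d * \<bar>u - u0\<bar>"
  proof -
    have "\<bar>\<sigma> * d * (u - u0)\<bar> = d * \<bar>u - u0\<bar>" using \<sigma> d by (auto simp: abs_mult)
    moreover have "\<sigma> * (v - v0) \<le> \<bar>v - v0\<bar>" using \<sigma> by auto
    ultimately show ?thesis by linarith
  qed
  also have "\<dots> \<le> 4 * e + 1 * (2 * e)" using u v d e by (intro add_mono mult_mono) auto
  finally have y: "y \<le> \<sigma> * v0 - d * (\<sigma> * u0) + 6 * e" by simp
  have "\<mu> * y \<le> \<mu> * (\<sigma> * v0 - d * (\<sigma> * u0) + 6 * e)" using y \<mu> by (intro mult_left_mono) auto
  moreover have "\<mu> * (6 * e) \<le> \<mu>\<^sup>2 * (6 * e)" using \<mu> e by (intro mult_right_mono) (auto simp: power2_eq_square)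
  moreover have "\<mu>\<^sup>2 * (11 * (u\<^sup>2 + v\<^sup>2)) \<le> \<mu>\<^sup>2 * (22 * (u0\<^sup>2 + v0\<^sup>2) + 440 * e)"
    using sq' by (intro mult_left_mono) auto
  ultimately have "exp (\<mu> * x) \<le> 1 + \<mu> * (\<sigma> * v0) - \<mu> * (d * (\<sigma> * u0)) + 22 * \<mu>\<^sup>2 * (u0\<^sup>2 + v0\<^sup>2) + 446 * \<mu>\<^sup>2 * e"
    using 1 by (simp add: algebra_simps)
  then have "exp (\<mu> * d) * exp (\<mu> * x) \<le> exp (\<mu> * d)
     * (1 + \<mu> * (\<sigma> * v0) - \<mu> * (d * (\<sigma> * u0)) + 22 * \<mu>\<^sup>2 * (u0\<^sup>2 + v0\<^sup>2) + 446 * \<mu>\<^sup>2 * e)"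
    by (intro mult_left_mono) auto
  then show ?thesis unfolding eq by (simp add: distrib_left exp_add)
qed

text \<open>One level of depth frees a factor exp (- 1 / log n) and one summand exp (\<mu> / 3);
  \<open>node_bound\<close> spends the former in dense and the latter in sparse nodes.\<close>

lemma charge_child:
  assumes "len' \<ge> 1" "3 * real len' \<le> 2 * real len"
  shows "charge len' c \<le> 2 * \<alpha> + 400 * lg + 2 * \<alpha> * (real k_max + 2) * (depth len - 1)
     + 2000 * lg\<^sup>2 * exp (- 3 / 4 * \<mu>) * exp (depth len / lg)
       * (exp (- 1 / lg) * (exp (\<mu> * c / real len') + (depth len - 1) * exp (\<mu> / 3)))"
proof -
  note d = depth_child[OF assms] depth_nonneg[of len']
  have "depth len' / lg \<le> (depth len - 1) / lg" using d lg_ge by (intro divide_right_mono) auto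
  then have "exp (depth len' / lg) \<le> exp (depth len / lg + - 1 / lg)" by (simp add: diff_divide_distrib)
  then have g: "exp (depth len' / lg) \<le> exp (depth len / lg) * exp (- 1 / lg)" unfolding exp_add .
  have "2000 * lg\<^sup>2 * exp (depth len' / lg) * exp (- 3 / 4 * \<mu>)
       * (exp (\<mu> * c / real len') + depth len' * exp (\<mu> / 3))
     \<le> 2000 * lg\<^sup>2 * (exp (depth len / lg) * exp (- 1 / lg)) * exp (- 3 / 4 * \<mu>)
       * (exp (\<mu> * c / real len') + (depth len - 1) * exp (\<mu> / 3))"
    using g d by (intro mult_mono mult_left_mono mult_right_mono add_mono mult_nonneg_nonneg add_nonneg_nonneg) auto
  moreover have "2 * \<alpha> * (real k_max + 2) * depth len' \<le> 2 * \<alpha> * (real k_max + 2) * (depth len - 1)"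
    using d \<alpha>_large by (intro mult_left_mono) auto
  ultimately show ?thesis unfolding charge_def by (simp add: mult_ac)
qed

definition dirs :: "bool list \<Rightarrow> nat \<Rightarrow> real" where
  "dirs bs t = (if t < length bs then if bs ! t then 1 else - 1 else 0)"

lemma dirs_bounded: "\<bar>dirs bs t\<bar> \<le> 1"
  by (simp add: dirs_def)

text \<open>The slack 1 / log n of a level is shared out evenly: one half for rounding widths and
  counts, the other half, in \<open>finest_small\<close>, for the energy of the finest
  windows.\<close>

lemma rounding_small:
  assumes "real len \<ge> min_len"
  shows "446 * \<mu>\<^sup>2 * (1 / real len) \<le> 1 / (2 * lg)"
proof -
  have "lg ^ 1 \<le> lg ^ 3" using lg_ge by (intro power_increasing) auto
  then have "892 * \<mu>\<^sup>2 * lg \<le> 300000 * \<alpha> * lg ^ 3"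
    using \<mu>_sq_le \<alpha>_large lg_ge by (intro mult_mono) auto
  then have "892 * \<mu>\<^sup>2 * lg \<le> real len" using min_len_ge(1) assms by linarith
  moreover have "real len > 0" using assms min_len_ge by linarith
  ultimately show ?thesis using lg_ge by (simp add: field_simps)
qed

lemma finest_small: "3 * \<mu> / 2 ^ k_max \<le> 1 / (2 * lg)"
proof -
  have "6 * \<mu> * lg \<le> lg * lg" using \<mu>_bounds loglog_small lg_ge by (intro mult_right_mono) auto
  also have "\<dots> \<le> 2 ^ k_max" using two_power_k_max by (simp add: power2_eq_square)
  finally show ?thesis using lg_ge by (simp add: field_simps)
qed

text \<open>Here the order (log log n)^2 of \<alpha> and \<beta> is decisive, because \<mu> *
  \<open>k_max\<close> has this order: \<mu> stems from the second-order terms and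
  \<open>k_max\<close> from the slope of the weights.\<close>

lemma gain_dominates:
  assumes "real T \<le> real len / \<alpha>" "real len > 0"
  shows "2 * ((2 + 4 * \<mu>) / \<alpha>) * real k_max + 2 * 22 * \<mu> * real k_max * (4 / \<beta> + \<beta> * (real T)\<^sup>2 / (real len)\<^sup>2) \<le> 3 / 20"
proof -
  have \<mu>K: "\<mu> * real k_max \<le> 24 * llg\<^sup>2"
    using mult_mono[OF \<mu>_bounds(2) k_max_bounds(2)] loglog_ge by (simp add: power2_eq_square)
  have K: "real k_max \<le> llg\<^sup>2" using k_max_bounds llg_sq loglog_ge by linarith
  have l2: "llg\<^sup>2 > 0" using loglog_ge by simp
  have "real T / real len \<le> 1 / \<alpha>" using assms \<alpha>_large by (simp add: field_simps)
  then have "(real T / real len)\<^sup>2 \<le> (1 / \<alpha>)\<^sup>2" by (intro power_mono) auto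
  then have "\<beta> * ((real T)\<^sup>2 / (real len)\<^sup>2) \<le> \<beta> * (1 / \<alpha>)\<^sup>2"
    using \<beta>_large by (intro mult_left_mono) (auto simp: power_divide)
  also have "\<dots> = (\<beta> / \<alpha>) * (1 / \<alpha>)" by (simp add: power2_eq_square)
  also have "\<dots> \<le> 1 * (1 / \<beta>)"
    using \<alpha>\<beta> \<beta>_large \<alpha>_large by (intro mult_mono divide_left_mono) auto
  finally have b: "4 / \<beta> + \<beta> * (real T)\<^sup>2 / (real len)\<^sup>2 \<le> 5 / \<beta>" by simp
  have ib: "1 / \<beta> \<le> 1 / (100000 * llg\<^sup>2)" "1 / \<alpha> \<le> 1 / (100000 * llg\<^sup>2)"
    using \<beta>_ge \<alpha>_ge l2 \<beta>_large \<alpha>_large by (intro divide_left_mono; simp)+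
  have "2 * 22 * \<mu> * real k_max * (4 / \<beta> + \<beta> * (real T)\<^sup>2 / (real len)\<^sup>2) \<le> 2 * 22 * \<mu> * real k_max * (5 / \<beta>)"
    using b \<mu>_bounds by (intro mult_left_mono) auto
  also have "\<dots> = 220 * (\<mu> * real k_max) * (1 / \<beta>)" by simp
  also have "\<dots> \<le> 220 * (24 * llg\<^sup>2) * (1 / (100000 * llg\<^sup>2))"
    using \<mu>K ib \<beta>_large \<mu>_bounds
    by (intro mult_mono[where b = "220 * (24 * llg\<^sup>2)"]) (simp_all add: mult_nonneg_nonneg)
  also have "\<dots> = 5280 / 100000" using l2 by simp
  finally have 1: "2 * 22 * \<mu> * real k_max * (4 / \<beta> + \<beta> * (real T)\<^sup>2 / (real len)\<^sup>2) \<le> 5280 / 100000" .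
  have "2 * ((2 + 4 * \<mu>) / \<alpha>) * real k_max = (4 * real k_max + 8 * (\<mu> * real k_max)) * (1 / \<alpha>)"
    by (simp add: algebra_simps add_divide_distrib)
  also have "\<dots> \<le> (200 * llg\<^sup>2) * (1 / (100000 * llg\<^sup>2))"
    using \<mu>K K ib l2 \<alpha>_large by (intro mult_mono) auto
  also have "\<dots> = 200 / 100000" using l2 by simp
  finally show ?thesis using 1 by simp
qed

text \<open>One lifetime of a node, or a prefix of it, with directions \<open>bs\<close>. For the
  child that receives insertion \<open>t\<close>, \<open>cw k t\<close> is the width and
  \<open>cc t\<close> the number of elements; \<open>\<eta>\<close> is the surplus of the right
  child at creation. Only the width depends on the skew.\<close>

context
  fixes len s :: nat and bs :: "bool list" and \<eta> :: real
    and cw :: "nat \<Rightarrow> nat \<Rightarrow> nat" and cc :: "nat \<Rightarrow> nat"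
  assumes len: "2 powr sqrt lg < real len" and s: "4 * s \<le> 3 * len" and bs: "length bs \<le> lifetime len"
    and cw: "\<And>k t. k \<le> k_max \<Longrightarrow> t < length bs \<Longrightarrow>
      \<bar>real (cw k t) - (real len / 2 + dirs bs t * real len * dyadic.tilt k_max (min_window len) \<beta> (dirs bs) k t / 2)\<bar> \<le> 1"
    and cc: "\<And>t. t < length bs \<Longrightarrow> real (cc t) = (real (s + t) + dirs bs t * (\<eta> + walk (dirs bs) t)) / 2"
    and \<eta>: "\<bar>\<eta>\<bar> \<le> 4"
begin

abbreviation (input) "\<tau> \<equiv> length bs"
abbreviation (input) "\<sigma> \<equiv> dirs bs"

lemma len_min: "real len \<ge> 3 * min_len" "real len \<ge> min_len" "real len \<ge> 3000000"
  using len min_len_ge unfolding min_len_def by linarith+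

lemma len_0: "real len > 0"
  using len_min by simp

lemma dyadic: "dyadic (min_window len)"
  using lifetime_bounds(1)[OF len_min(2)] by unfold_locales

interpretation dyadic k_max "min_window len"
  by (rule dyadic)

lemma win_0: "win 0 = lifetime len"
  by (simp add: win_def lifetime_def)

lemma T_le: "real (win 0) \<le> real len / \<alpha>"
  unfolding win_0 by (rule lifetime_bounds(2)[OF len_min(2)])

lemma \<tau>_le_T: "\<tau> \<le> win 0"
  using bs by (simp add: win_0)

lemma \<tau>_small: "t \<le> \<tau> \<Longrightarrow> real t \<le> real len / \<alpha>"
  using \<tau>_le_T T_le by (meson of_nat_mono order_trans)

lemma len_alpha: "real len / \<alpha> \<le> real len / 10000000"
  using \<alpha>_large by (intro divide_left_mono) auto

lemma tilt_small: "\<bar>tilt \<beta> \<sigma> k t\<bar> \<le> 2 / \<beta>"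
  using dirs_bounded \<beta>_large by (intro tilt_abs_le) auto

lemma sigma: "t < \<tau> \<Longrightarrow> \<sigma> t = 1 \<or> \<sigma> t = - 1"
  by (simp add: dirs_def)

lemma walk_small: "t \<le> \<tau> \<Longrightarrow> \<bar>walk \<sigma> t\<bar> \<le> real len / \<alpha>"
  using walk_abs_le[of "dirs bs" t, OF dirs_bounded] \<tau>_small[of t] by linarith

lemma child_width:
  assumes "k \<le> k_max" "t < \<tau>"
  shows "1 \<le> cw k t" "3 * real (cw k t) \<le> 2 * real len" "48 / 100 * real len \<le> real (cw k t)"
proof -
  have "2 / \<beta> \<le> 2 / 10000000" using \<beta>_large by (intro divide_left_mono) auto
  then have "\<bar>tilt \<beta> \<sigma> k t\<bar> \<le> 2 / 10000000" using tilt_small[of k t] by linarith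
  then have "\<bar>real len * tilt \<beta> \<sigma> k t\<bar> \<le> real len * (2 / 10000000)"
    unfolding abs_mult by (intro mult_mono) auto
  then have "\<bar>real (cw k t) - real len / 2\<bar> \<le> 1 + real len / 10000000"
    using cw[OF assms] sigma[OF assms(2)] by auto
  then show "3 * real (cw k t) \<le> 2 * real len" "48 / 100 * real len \<le> real (cw k t)" "1 \<le> cw k t"
    using len_min by linarith+
qed

lemma child_count_le:
  assumes "t < \<tau>"
  shows "real (cc t) \<le> real s / 2 + 2 + real len / 10000000"
proof -
  have "\<sigma> t * (\<eta> + walk \<sigma> t) \<le> \<bar>\<eta>\<bar> + \<bar>walk \<sigma> t\<bar>" using sigma[OF assms] by auto
  then have "real (cc t) \<le> (real s + real len / \<alpha> + (4 + real len / \<alpha>)) / 2"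
    using cc[OF assms] \<eta> walk_small[of t] \<tau>_small[of t] assms by simp
  moreover define x where "x = real len / \<alpha>"
  ultimately show ?thesis using len_alpha by (simp add: field_simps)
qed

definition \<Phi> :: "nat \<Rightarrow> real" where "\<Phi> t = exp (\<mu> * (real (s + t) / real len))"

lemma dens_le: "t \<le> \<tau> \<Longrightarrow> real (s + t) / real len \<le> 1"
proof -
  assume "t \<le> \<tau>"
  then have "real t \<le> real len / 10000000" using \<tau>_small[of t] len_alpha by linarith
  moreover have "4 * real s \<le> 3 * real len" using s by linarith
  ultimately have "real (s + t) \<le> real len" using len_0 by simp
  then show ?thesis using len_0 by (simp add: divide_le_eq)
qed

text \<open>The first three keep the exponents within the range of the quadratic bound for
  \<open>exp\<close>; the last one limits the growth of \<Phi> during a lifetime to a factor of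
  2.\<close>

lemma mu_alpha: "4 * \<mu> * (5 / \<alpha>) \<le> 1 / 4" "4 * \<mu> * (2 / \<beta>) \<le> 1 / 4" "4 * \<mu> * (6 / real len) \<le> 1 / 4" "\<mu> / \<alpha> \<le> 1 / 2"
proof -
  have "llg \<le> llg\<^sup>2" using llg_sq loglog_ge by linarith
  then have a: "80 * \<mu> \<le> \<alpha>" "32 * \<mu> \<le> \<beta>" using \<mu>_bounds \<alpha>_ge \<beta>_ge loglog_ge by linarith+
  then show "4 * \<mu> * (5 / \<alpha>) \<le> 1 / 4" "4 * \<mu> * (2 / \<beta>) \<le> 1 / 4" "\<mu> / \<alpha> \<le> 1 / 2"
    using \<alpha>_large \<beta>_large by (auto simp: field_simps)
  have "lg ^ 3 \<ge> 1" using lg_ge by simp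
  then have "\<alpha> * 1 \<le> 300000 * \<alpha> * lg ^ 3" using \<alpha>_large by (intro mult_mono) auto
  then have "\<alpha> \<le> min_len" using min_len_ge(1) by simp
  then have "3 * \<alpha> \<le> real len" using len_min by linarith
  then show "4 * \<mu> * (6 / real len) \<le> 1 / 4" using a len_0 \<mu>_bounds by (simp add: field_simps)
qed

text \<open>The receiving child has density (d + \<sigma> v) / (1 + \<sigma> u) with
  \<open>u\<close> close to the tilt and \<open>v\<close> close to walk / len. The rounding and
  \<open>\<eta>\<close> disappear in 1 / (2 log n).\<close>

lemma child_exp:
  assumes "k \<le> k_max" "t < \<tau>"
  shows "exp (\<mu> * real (cc t) / real (cw k t))
    \<le> \<Phi> t * (1 + \<mu> * (\<sigma> t * (walk \<sigma> t / real len)) - \<mu> * (real (s + t) / real len * (\<sigma> t * tilt \<beta> \<sigma> k t))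
       + 22 * \<mu>\<^sup>2 * ((tilt \<beta> \<sigma> k t)\<^sup>2 + (walk \<sigma> t / real len)\<^sup>2) + 1 / (2 * lg))"
proof -
  let ?l = "real len" and ?d = "real (s + t) / real len" and ?u0 = "tilt \<beta> \<sigma> k t" and ?v0 = "walk \<sigma> t / real len"
  define v where "v = (\<eta> + walk \<sigma> t) / ?l"
  define u where "u = \<sigma> t * (2 * real (cw k t) / ?l - 1)"
  have \<sigma>: "\<sigma> t = 1 \<or> \<sigma> t = - 1" by (rule sigma) fact
  have \<sigma>\<sigma>: "\<sigma> t * \<sigma> t = 1" using \<sigma> by auto
  have "u - ?u0 = \<sigma> t * (2 / ?l) * (real (cw k t) - (?l / 2 + \<sigma> t * ?l * ?u0 / 2))"
    using len_0 \<sigma> by (auto simp: u_def field_simps)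
  then have "\<bar>u - ?u0\<bar> = 2 / ?l * \<bar>real (cw k t) - (?l / 2 + \<sigma> t * ?l * ?u0 / 2)\<bar>"
    using \<sigma> by (auto simp: abs_mult)
  also have "\<dots> \<le> 2 / ?l * 1" using cw[OF assms] by (intro mult_left_mono) auto
  finally have u: "\<bar>u - ?u0\<bar> \<le> 2 * (1 / ?l)" by simp
  have "\<bar>v - ?v0\<bar> = \<bar>\<eta>\<bar> / ?l" using len_0 by (simp add: v_def add_divide_distrib)
  then have v: "\<bar>v - ?v0\<bar> \<le> 4 * (1 / ?l)" using \<eta> len_0 by (simp add: divide_right_mono)
  have "\<bar>?v0\<bar> \<le> 1 / \<alpha>" using walk_small[of t] assms len_0 by (simp add: field_simps)
  also have "1 / \<alpha> \<le> 5 / \<alpha>" using \<alpha>_large by (intro divide_right_mono) auto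
  finally have "\<bar>u\<bar> + \<bar>v\<bar> \<le> 2 / \<beta> + 5 / \<alpha> + 6 / ?l" using u v tilt_small[of k t] by linarith
  then have "4 * \<mu> * (\<bar>u\<bar> + \<bar>v\<bar>) \<le> 4 * \<mu> * (2 / \<beta> + 5 / \<alpha> + 6 / ?l)"
    using \<mu>_bounds by (intro mult_left_mono) auto
  also have "\<dots> \<le> 1" using mu_alpha by (simp add: distrib_left)
  finally have small: "4 * \<mu> * (\<bar>u\<bar> + \<bar>v\<bar>) \<le> 1" .
  have e: "0 \<le> 1 / ?l" "1 / ?l \<le> 1" using len_min by auto
  have "real (cc t) / real (cw k t) = (?d + \<sigma> t * v) / (1 + \<sigma> t * u)"
  proof -
    have "1 + \<sigma> t * u = 2 * real (cw k t) / ?l"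
      unfolding u_def using \<sigma>\<sigma> by (simp add: mult.assoc[symmetric])
    moreover have "?d + \<sigma> t * v = 2 * real (cc t) / ?l"
      unfolding v_def cc[OF assms(2)] by (simp add: add_divide_distrib distrib_left)
    ultimately show ?thesis using len_0 child_width(1)[OF assms] by (simp add: field_simps)
  qed
  then have "exp (\<mu> * real (cc t) / real (cw k t)) = exp (\<mu> * ((?d + \<sigma> t * v) / (1 + \<sigma> t * u)))"
    by (simp only: times_divide_eq_right[symmetric])
  also have "\<dots> \<le> exp (\<mu> * ?d) * (1 + \<mu> * (\<sigma> t * ?v0) - \<mu> * (?d * (\<sigma> t * ?u0))
      + 22 * \<mu>\<^sup>2 * (?u0\<^sup>2 + ?v0\<^sup>2) + 446 * \<mu>\<^sup>2 * (1 / ?l))"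
    using dens_le[of t] assms len_0 by (intro exp_density_child[OF \<sigma> _ _ small u v e]) auto
  also have "\<dots> \<le> exp (\<mu> * ?d) * (1 + \<mu> * (\<sigma> t * ?v0) - \<mu> * (?d * (\<sigma> t * ?u0))
      + 22 * \<mu>\<^sup>2 * (?u0\<^sup>2 + ?v0\<^sup>2) + 1 / (2 * lg))"
    using rounding_small[OF len_min(2)] by (intro mult_left_mono) auto
  finally show ?thesis by (simp only: \<Phi>_def)
qed

text \<open>Averaging over the skew leaves \<open>base\<close> unchanged, which contains the harmful
  drift, and turns \<open>extra\<close> into the tilt terms of \<open>drift_bound\<close>. Density
  at least 3/10 makes the gain large enough.\<close>

lemma density_sum_high:
  assumes "3 * real len \<le> 10 * real s"
  shows "(\<Sum>k\<le>k_max. p k * (\<Sum>t<\<tau>. exp (\<mu> * real (cc t) / real (cw k t)))) \<le> (1 + 1 / lg) * (\<Sum>t<\<tau>. \<Phi> t)"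
proof -
  let ?l = "real len"
  define d where "d = (\<lambda>t. real (s + t) / ?l)"
  define g where "g = (\<lambda>t. \<Phi> t * d t)"
  define base where "base = (\<lambda>t. \<Phi> t * (1 + 1 / (2 * lg)) + \<mu> * (\<Phi> t * (\<sigma> t * walk \<sigma> t)) / ?l + 22 * \<mu>\<^sup>2 * (\<Phi> t * ((walk \<sigma> t)\<^sup>2 / ?l\<^sup>2)))"
  define extra where "extra = (\<lambda>k t. - \<mu> * (g t * (\<sigma> t * tilt \<beta> \<sigma> k t)) + 22 * \<mu>\<^sup>2 * (\<Phi> t * (tilt \<beta> \<sigma> k t)\<^sup>2))"
  have \<Phi>_pos: "\<Phi> t > 0" for t by (simp add: \<Phi>_def)
  have pw: "p (Suc k) = weight (Suc k)" if "k < k_max" for k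
    using p_eq_weight[OF that] by (simp add: weight_def)
  have "(\<Sum>k\<le>k_max. p k * (\<Sum>t<\<tau>. exp (\<mu> * real (cc t) / real (cw k t)))) \<le> (\<Sum>k\<le>k_max. p k * (\<Sum>t<\<tau>. base t + extra k t))"
  proof (intro sum_mono mult_left_mono p_nonneg)
    fix k t assume "k \<in> {..k_max}" "t \<in> {..<\<tau>}"
    then have "k \<le> k_max" "t < \<tau>" by auto
    note bound = child_exp[OF this]
    have "real (s + t) / ?l = d t" by (simp add: d_def)
    from bound[unfolded this] show "exp (\<mu> * real (cc t) / real (cw k t)) \<le> base t + extra k t"
      unfolding base_def extra_def g_def by (simp add: algebra_simps power_divide)
  qed
  also have "\<dots> = (\<Sum>k\<le>k_max. p k) * (\<Sum>t<\<tau>. base t) + (\<Sum>k\<le>k_max. p k * (\<Sum>t<\<tau>. extra k t))"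
    by (simp add: sum.distrib distrib_left sum_distrib_right)
  also have "(\<Sum>k\<le>k_max. p k * (\<Sum>t<\<tau>. extra k t)) = (\<Sum>k<k_max. weight (Suc k) * (\<Sum>t<\<tau>. extra (Suc k) t))"
  proof -
    \<comment> \<open>With skew 0 a lifetime is a single window, which has no predecessor and hence
      no tilt.\<close>
    have "extra 0 t = 0" if "t < \<tau>" for t
      using \<tau>_le_T that by (simp add: extra_def tilt_def)
    then show ?thesis by (simp add: sum.atMost_shift pw)
  qed
  also have "\<dots> = (\<Sum>t<\<tau>. \<Sum>k<k_max. weight (Suc k) * extra (Suc k) t)"
    by (subst sum.swap) (simp add: sum_distrib_left)
  also have "\<dots> = (\<Sum>t<\<tau>. - \<mu> * (g t * (\<Sum>k<k_max. weight (Suc k) * (\<sigma> t * tilt \<beta> \<sigma> (Suc k) t)))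
      + 22 * \<mu>\<^sup>2 * (\<Phi> t * (\<Sum>k<k_max. weight (Suc k) * (tilt \<beta> \<sigma> (Suc k) t)\<^sup>2)))"
    unfolding sum_distrib_left sum.distrib[symmetric] by (intro sum.cong refl) (simp add: extra_def algebra_simps)
  finally have "(\<Sum>k\<le>k_max. p k * (\<Sum>t<\<tau>. exp (\<mu> * real (cc t) / real (cw k t))))
      \<le> (\<Sum>t<\<tau>. base t) + (\<Sum>t<\<tau>. - \<mu> * (g t * (\<Sum>k<k_max. weight (Suc k) * (\<sigma> t * tilt \<beta> \<sigma> (Suc k) t)))
      + 22 * \<mu>\<^sup>2 * (\<Phi> t * (\<Sum>k<k_max. weight (Suc k) * (tilt \<beta> \<sigma> (Suc k) t)\<^sup>2)))" by (simp only: sum_p mult_1_left)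
  moreover have "(\<Sum>t<N. \<Phi> t * c + l t + C * (\<Phi> t * w t)) + (\<Sum>t<N. - \<mu> * h t + C * (\<Phi> t * b t))
      = c * (\<Sum>t<N. \<Phi> t) + ((\<Sum>t<N. l t) - \<mu> * (\<Sum>t<N. h t) + C * (\<Sum>t<N. \<Phi> t * (b t + w t)))"
    for N c C l w h b
    by (induction N) (auto simp: algebra_simps)
  note this[of "1 + 1 / (2 * lg)" "\<lambda>t. \<mu> * (\<Phi> t * (\<sigma> t * walk \<sigma> t)) / ?l" "22 * \<mu>\<^sup>2" "\<lambda>t. (walk \<sigma> t)\<^sup>2 / ?l\<^sup>2" \<tau>
      "\<lambda>t. g t * (\<Sum>k<k_max. weight (Suc k) * (\<sigma> t * tilt \<beta> \<sigma> (Suc k) t))"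
      "\<lambda>t. \<Sum>k<k_max. weight (Suc k) * (tilt \<beta> \<sigma> (Suc k) t)\<^sup>2"]
  ultimately have "(\<Sum>k\<le>k_max. p k * (\<Sum>t<\<tau>. exp (\<mu> * real (cc t) / real (cw k t))))
      \<le> (1 + 1 / (2 * lg)) * (\<Sum>t<\<tau>. \<Phi> t) + ((\<Sum>t<\<tau>. \<mu> * (\<Phi> t * (\<sigma> t * walk \<sigma> t)) / ?l)
      - \<mu> * (\<Sum>t<\<tau>. g t * (\<Sum>k<k_max. weight (Suc k) * (\<sigma> t * tilt \<beta> \<sigma> (Suc k) t)))
      + 22 * \<mu>\<^sup>2 * (\<Sum>t<\<tau>. \<Phi> t * ((\<Sum>k<k_max. weight (Suc k) * (tilt \<beta> \<sigma> (Suc k) t)\<^sup>2) + (walk \<sigma> t)\<^sup>2 / ?l\<^sup>2)))"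
    by (simp only: base_def)
  also have "((\<Sum>t<\<tau>. \<mu> * (\<Phi> t * (\<sigma> t * walk \<sigma> t)) / ?l)
      - \<mu> * (\<Sum>t<\<tau>. g t * (\<Sum>k<k_max. weight (Suc k) * (\<sigma> t * tilt \<beta> \<sigma> (Suc k) t)))
      + 22 * \<mu>\<^sup>2 * (\<Sum>t<\<tau>. \<Phi> t * ((\<Sum>k<k_max. weight (Suc k) * (tilt \<beta> \<sigma> (Suc k) t)\<^sup>2) + (walk \<sigma> t)\<^sup>2 / ?l\<^sup>2)))
      \<le> 3 * \<mu> * \<Phi> 0 * real \<tau> / 2 ^ k_max"
  proof (rule drift_bound[OF dirs_bounded _ k_max_bounds(3) _ \<tau>_le_T, where \<gamma> = "(2 + 4 * \<mu>) / \<alpha>"])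
    show "\<sigma> t = 0" if "t \<ge> \<tau>" for t using that by (simp add: dirs_def)
    show "1 \<le> \<beta>" using \<beta>_large by simp
    show mono: "\<Phi> t \<le> \<Phi> t'" if "t \<le> t'" for t t'
      using that \<mu>_bounds len_0 by (auto simp: \<Phi>_def intro!: mult_left_mono divide_right_mono)
    show "\<Phi> 0 > 0" by (rule \<Phi>_pos)
    have half: "exp (1 / 2 :: real) \<le> 2" using exp_le_quadratic[of "1 / 2"] by (simp add: power2_eq_square)
    have "\<mu> * (real \<tau> / ?l) \<le> \<mu> * (1 / \<alpha>)"
      using \<tau>_small[of \<tau>] len_0 \<mu>_bounds by (intro mult_left_mono) (auto simp: field_simps)
    also have "\<dots> \<le> 1 / 2" using mu_alpha by simp
    finally have "exp (\<mu> * (real \<tau> / ?l)) \<le> exp (1 / 2)" by (simp only: exp_le_cancel_iff)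
    then have "exp (\<mu> * (real \<tau> / ?l)) \<le> 2" using half by (rule order_trans)
    then have "exp (\<mu> * (real s / ?l)) * exp (\<mu> * (real \<tau> / ?l)) \<le> exp (\<mu> * (real s / ?l)) * 2"
      by (intro mult_left_mono) auto
    then show \<Phi>\<tau>: "\<Phi> \<tau> \<le> 2 * \<Phi> 0"
      by (simp add: \<Phi>_def add_divide_distrib distrib_left exp_add)
    have d_mono: "d t \<le> d (Suc t)" "d t \<ge> 0" for t
      using len_0 by (auto simp: d_def divide_right_mono)
    show "g t \<le> g (Suc t)" for t
      unfolding g_def using mono[of t "Suc t"] d_mono \<Phi>_pos by (intro mult_mono) (auto intro: less_imp_le)
    \<comment> \<open>\<open>g\<close> is d exp (\<mu> d) with d growing by 1 / len. As \<Phi> stays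
      below 2 \<Phi> 0 and exp (\<mu> / len) below 1 + 2 \<mu> / len, the increment is at most (2 +
      4 \<mu>) \<Phi> 0 / len.\<close>
    show "g (Suc t) - g t \<le> (2 + 4 * \<mu>) / \<alpha> * \<Phi> 0 / real (win 0)" if "t < \<tau>" for t
    proof -
      have "\<mu> / ?l \<le> 1" using mu_alpha(3) by simp
      then have "exp (\<mu> / ?l) \<le> 1 + \<mu> / ?l + (\<mu> / ?l)\<^sup>2" by (rule exp_le_quadratic)
      also have "(\<mu> / ?l)\<^sup>2 \<le> \<mu> / ?l"
        using mult_right_mono[OF \<open>\<mu> / ?l \<le> 1\<close>, of "\<mu> / ?l"] \<mu>_bounds unfolding power2_eq_square by simp
      finally have ex: "exp (\<mu> / ?l) \<le> 1 + 2 * (\<mu> / ?l)" by simp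
      have "\<Phi> (Suc t) = \<Phi> t * exp (\<mu> / ?l)"
        by (simp add: \<Phi>_def add_divide_distrib distrib_left flip: exp_add)
      also have "\<dots> \<le> \<Phi> t * (1 + 2 * (\<mu> / ?l))" using ex \<Phi>_pos[of t] by (intro mult_left_mono) auto
      finally have inc: "\<Phi> (Suc t) - \<Phi> t \<le> \<Phi> t * (2 * (\<mu> / ?l))" by (simp add: algebra_simps)
      have "g (Suc t) - g t = \<Phi> (Suc t) * (1 / ?l) + (\<Phi> (Suc t) - \<Phi> t) * d t"
        by (simp add: g_def d_def add_divide_distrib algebra_simps)
      also have "\<dots> \<le> 2 * \<Phi> 0 * (1 / ?l) + 2 * \<Phi> 0 * (2 * (\<mu> / ?l)) * 1"
      proof (intro add_mono mult_mono)
        show "\<Phi> (Suc t) \<le> 2 * \<Phi> 0" using mono[of "Suc t" \<tau>] \<Phi>\<tau> that by simp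
        have "\<Phi> t \<le> 2 * \<Phi> 0" using mono[of t \<tau>] \<Phi>\<tau> that by simp
        then have "\<Phi> t * (2 * (\<mu> / ?l)) \<le> 2 * \<Phi> 0 * (2 * (\<mu> / ?l))" using \<mu>_bounds by (intro mult_right_mono) auto
        then show "\<Phi> (Suc t) - \<Phi> t \<le> 2 * \<Phi> 0 * (2 * (\<mu> / ?l))" using inc by linarith
        show "d t \<le> 1" using dens_le[of t] that by (simp add: d_def)
      qed (use \<Phi>_pos[of 0] d_mono \<mu>_bounds len_0 in auto)
      also have "\<dots> = (2 + 4 * \<mu>) * \<Phi> 0 * (1 / ?l)" by (simp add: algebra_simps add_divide_distrib)
      also have "\<dots> \<le> (2 + 4 * \<mu>) * \<Phi> 0 * (1 / (\<alpha> * real (win 0)))"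
        using T_le win_pos[of 0] \<alpha>_large \<mu>_bounds \<Phi>_pos[of 0] len_0
        by (intro mult_left_mono divide_left_mono) (auto simp: field_simps)
      finally show ?thesis by simp
    qed
    have "3 / 10 \<le> d \<tau>" using assms len_0 by (simp add: d_def field_simps)
    then have "3 / 10 * \<Phi> 0 \<le> d \<tau> * \<Phi> \<tau>" using mono[of 0 \<tau>] \<Phi>_pos by (intro mult_mono) (auto intro: less_imp_le)
    then show "3 / 10 * \<Phi> 0 \<le> g \<tau>" by (simp add: g_def mult.commute)
    have "\<Phi> \<tau> * d \<tau> \<le> 2 * \<Phi> 0 * 1"
      using \<Phi>\<tau> dens_le[of \<tau>] d_mono \<Phi>_pos[of 0] by (intro mult_mono) (auto simp: d_def)
    then show "g \<tau> \<le> 2 * \<Phi> 0" by (simp add: g_def)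
    show "\<mu> \<ge> 0" "(2 + 4 * \<mu>) / \<alpha> \<ge> 0" "(0::real) \<le> 22" using \<mu>_bounds \<alpha>_large by auto
    have "real (win 0) * (7 * \<beta>) \<le> real (win 0) * \<alpha>" using \<alpha>\<beta> \<beta>_large by (intro mult_left_mono) auto
    then have "7 * real (win 0) * \<beta> \<le> real (win 0) * \<alpha>" by (simp only: mult_ac)
    also have "\<dots> \<le> ?l" using T_le \<alpha>_large by (simp add: field_simps)
    finally show "7 * real (win 0) * \<beta> \<le> ?l" .
    show "2 * ((2 + 4 * \<mu>) / \<alpha>) * real k_max + 2 * 22 * \<mu> * real k_max * (4 / \<beta> + \<beta> * (real (win 0))\<^sup>2 / ?l\<^sup>2) \<le> 3 / 20"
      by (rule gain_dominates[OF T_le len_0])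
  qed
  also have "3 * \<mu> * \<Phi> 0 * real \<tau> / 2 ^ k_max = (3 * \<mu> / 2 ^ k_max) * (\<Phi> 0 * real \<tau>)" by simp
  also have "\<dots> \<le> 1 / (2 * lg) * (\<Sum>t<\<tau>. \<Phi> t)"
  proof (intro mult_mono finest_small)
    have "real (card {..<\<tau>}) * \<Phi> 0 \<le> (\<Sum>t<\<tau>. \<Phi> t)"
      using \<mu>_bounds len_0 by (intro sum_bounded_below) (auto simp: \<Phi>_def intro!: mult_left_mono divide_right_mono)
    then show "\<Phi> 0 * real \<tau> \<le> (\<Sum>t<\<tau>. \<Phi> t)" by (simp add: mult.commute)
  qed (use lg_ge \<Phi>_pos[of 0] in auto)
  finally show ?thesis by (simp add: algebra_simps)
qed

text \<open>The induction step from a node to its children: its charges cover its own savings and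
  the charges at the children, on average over the skew. It is stated for a sum over time because
  the gain is a telescoping sum and gives nothing for a single insertion.\<close>

lemma node_bound:
  "(\<Sum>k\<le>k_max. p k * (\<Sum>t<\<tau>. node_charge k + charge (cw k t) (real (cc t)))) \<le> (\<Sum>t<\<tau>. charge len (real (s + t)))"
proof -
  define y where "y = depth len"
  define M where "M = 2000 * lg\<^sup>2 * exp (- 3 / 4 * \<mu>) * exp (y / lg)"
  define e3 where "e3 = exp (\<mu> / 3)"
  define B where "B = 2 * \<alpha> + 400 * lg"
  define Q where "Q = 2 * \<alpha> * (real k_max + 2)"
  define X where "X = (\<lambda>k t. exp (\<mu> * real (cc t) / real (cw k t)))"
  have M: "M \<ge> 0" by (simp add: M_def)
  have sum_const: "(\<Sum>k\<le>k_max. p k * c) = c" for c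
    using sum_p by (simp flip: sum_distrib_right)
  have ex: "exp (- 1 / lg) \<le> 1" "exp (- 1 / lg) > 0" using lg_ge by auto
  \<comment> \<open>The factor freed by one level of depth outweighs the growth of the exponential
    moment.\<close>
  have "(1 + 1 / lg) * exp (- 1 / lg) \<le> exp (1 / lg) * exp (- 1 / lg)"
    using exp_ge_add_one_self[of "1 / lg"] by (intro mult_right_mono) auto
  then have ex1: "(1 + 1 / lg) * exp (- 1 / lg) \<le> 1" by (simp flip: exp_add)
  have y: "y - 1 \<ge> 0" if "\<tau> > 0"
    using depth_child[OF child_width(1,2)[of 0 0]] depth_nonneg[of "cw 0 0"] that by (simp add: y_def)
  have key: "exp (- 1 / lg) * ((\<Sum>k\<le>k_max. p k * (\<Sum>t<\<tau>. X k t)) + real \<tau> * ((y - 1) * e3))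
      \<le> (\<Sum>t<\<tau>. \<Phi> t) + real \<tau> * (y * e3)"
  proof (cases "3 * real len \<le> 10 * real s")
    case True
    have "exp (- 1 / lg) * (\<Sum>k\<le>k_max. p k * (\<Sum>t<\<tau>. X k t)) \<le> exp (- 1 / lg) * ((1 + 1 / lg) * (\<Sum>t<\<tau>. \<Phi> t))"
      unfolding X_def using density_sum_high[OF True] by (intro mult_left_mono) auto
    also have "\<dots> = ((1 + 1 / lg) * exp (- 1 / lg)) * (\<Sum>t<\<tau>. \<Phi> t)" by simp
    also have "\<dots> \<le> 1 * (\<Sum>t<\<tau>. \<Phi> t)"
      using ex1 by (intro mult_right_mono sum_nonneg) (auto simp: \<Phi>_def)
    finally have 1: "exp (- 1 / lg) * (\<Sum>k\<le>k_max. p k * (\<Sum>t<\<tau>. X k t)) \<le> (\<Sum>t<\<tau>. \<Phi> t)" by simp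
    have "0 \<le> real \<tau> * ((y - 1) * e3)" using y by (cases "\<tau> = 0") (auto simp: e3_def)
    then have "exp (- 1 / lg) * (real \<tau> * ((y - 1) * e3)) \<le> 1 * (real \<tau> * ((y - 1) * e3))"
      using ex by (intro mult_right_mono) auto
    also have "\<dots> \<le> real \<tau> * (y * e3)"
      by (auto simp: e3_def intro!: mult_left_mono mult_right_mono)
    finally have "exp (- 1 / lg) * (real \<tau> * ((y - 1) * e3)) \<le> real \<tau> * (y * e3)" .
    then show ?thesis using 1 by (simp add: distrib_left)
  next
    case False
    \<comment> \<open>Sparse case, where the tilt is not exploited: at most 0.16 len elements in a
      width of at least 0.48 len.\<close>
    have "X k t \<le> e3" if "k \<le> k_max" "t < \<tau>" for k t
    proof -
      have "real (cc t) \<le> 16 / 100 * real len"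
        using child_count_le[OF that(2)] False len_min by linarith
      also have "\<dots> \<le> real (cw k t) / 3" using child_width(3)[OF that] by simp
      finally have "real (cc t) / real (cw k t) \<le> 1 / 3"
        using child_width(1)[OF that] by (simp add: field_simps)
      then have "\<mu> * (real (cc t) / real (cw k t)) \<le> \<mu> * (1 / 3)" using \<mu>_bounds by (intro mult_left_mono) auto
      then show ?thesis by (simp add: X_def e3_def)
    qed
    then have "(\<Sum>k\<le>k_max. p k * (\<Sum>t<\<tau>. X k t)) \<le> (\<Sum>k\<le>k_max. p k * (\<Sum>t<\<tau>. e3))"
      by (intro sum_mono mult_left_mono p_nonneg) auto
    also have "\<dots> = real \<tau> * e3" using sum_const by simp
    finally have "exp (- 1 / lg) * ((\<Sum>k\<le>k_max. p k * (\<Sum>t<\<tau>. X k t)) + real \<tau> * ((y - 1) * e3))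
        \<le> exp (- 1 / lg) * (real \<tau> * e3 + real \<tau> * ((y - 1) * e3))"
      by (intro mult_left_mono) auto
    also have "\<dots> = exp (- 1 / lg) * (real \<tau> * (y * e3))" by (simp add: algebra_simps)
    also have "\<dots> \<le> 1 * (real \<tau> * (y * e3))"
      using ex y by (cases "\<tau> = 0") (auto simp: e3_def intro!: mult_right_mono)
    also have "\<dots> \<le> (\<Sum>t<\<tau>. \<Phi> t) + real \<tau> * (y * e3)"
      by (simp add: sum_nonneg \<Phi>_def)
    finally show ?thesis .
  qed
  have "(\<Sum>k\<le>k_max. p k * (\<Sum>t<\<tau>. node_charge k + charge (cw k t) (real (cc t))))
      \<le> (\<Sum>k\<le>k_max. p k * (\<Sum>t<\<tau>. node_charge k + (B + Q * (y - 1) + M * (exp (- 1 / lg) * (X k t + (y - 1) * e3)))))"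
    unfolding B_def Q_def M_def X_def e3_def y_def
    by (intro sum_mono mult_left_mono p_nonneg add_left_mono charge_child child_width) auto
  also have "\<dots> = (\<Sum>k\<le>k_max. p k * (real \<tau> * node_charge k + real \<tau> * (B + Q * (y - 1))
      + M * exp (- 1 / lg) * ((\<Sum>t<\<tau>. X k t) + real \<tau> * ((y - 1) * e3))))"
    by (intro sum.cong refl arg_cong2[where f = "(*)"])
      (simp add: sum.distrib distrib_left sum_distrib_left mult.assoc)
  also have "\<dots> = real \<tau> * (\<Sum>k\<le>k_max. p k * node_charge k) + real \<tau> * (B + Q * (y - 1))
      + M * (exp (- 1 / lg) * ((\<Sum>k\<le>k_max. p k * (\<Sum>t<\<tau>. X k t)) + real \<tau> * ((y - 1) * e3)))"
  proof -
    have "(\<Sum>k\<le>k_max. p k * (real \<tau> * node_charge k + b + c * (S k + d)))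
        = real \<tau> * (\<Sum>k\<le>k_max. p k * node_charge k) + b + c * ((\<Sum>k\<le>k_max. p k * S k) + d)" for b c d S
    proof -
      have "(\<Sum>k\<le>k_max. p k * (real \<tau> * node_charge k + b + c * (S k + d)))
          = (\<Sum>k\<le>k_max. real \<tau> * (p k * node_charge k) + p k * b + c * (p k * S k) + p k * (c * d))"
        by (intro sum.cong) (auto simp: algebra_simps)
      then show ?thesis by (simp add: sum.distrib sum_const distrib_left flip: sum_distrib_left)
    qed
    from this[of "real \<tau> * (B + Q * (y - 1))" "M * exp (- 1 / lg)" "\<lambda>k. \<Sum>t<\<tau>. X k t" "real \<tau> * ((y - 1) * e3)"]
    show ?thesis by (simp only: mult.assoc)
  qed
  also have "\<dots> \<le> real \<tau> * Q + real \<tau> * (B + Q * (y - 1)) + M * ((\<Sum>t<\<tau>. \<Phi> t) + real \<tau> * (y * e3))"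
    using expected_node_charge key M unfolding Q_def[symmetric]
    by (intro add_mono order_refl mult_left_mono[OF _ M] mult_left_mono[OF _ of_nat_0_le_iff]) auto
  also have "\<dots> = (\<Sum>t<\<tau>. B + Q * y + M * (\<Phi> t + y * e3))"
    by (simp add: sum.distrib sum_distrib_left distrib_left algebra_simps)
  also have "\<dots> = (\<Sum>t<\<tau>. charge len (real (s + t)))"
    by (intro sum.cong refl) (simp add: charge_def B_def Q_def M_def e3_def y_def \<Phi>_def)
  finally show ?thesis .
qed

end

end

section \<open>Future charges of a non-leaf\<close>

context see_saw
begin

lemma expect_le_skew:
  assumes "\<And>k. k \<le> k_max \<Longrightarrow> h k \<ge> 0"
  shows "expect_le skew_pmf h (\<Sum>k\<le>k_max. p k * h k)"
proof -
  have "(\<integral>\<^sup>+ k. ennreal (h k) \<partial>measure_pmf skew_pmf) = (\<integral>\<^sup>+ k. ennreal (p k) * ennreal (h k) \<partial>count_space UNIV)"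
    by (simp add: nn_integral_measure_pmf pmf_skew_pmf)
  also have "\<dots> = (\<Sum>k\<in>{..k_max}. ennreal (p k) * ennreal (h k))"
    by (rule nn_integral_count_space') (auto simp: p_def Let_def)
  also have "\<dots> = (\<Sum>k\<in>{..k_max}. ennreal (p k * h k))"
    using assms by (intro sum.cong) (auto simp: ennreal_mult p_nonneg)
  also have "\<dots> = ennreal (\<Sum>k\<le>k_max. p k * h k)"
    using assms by (intro sum_ennreal) (auto simp: p_nonneg)
  finally show ?thesis by (simp add: expect_le_def)
qed

lemma skew_le: "k \<in> set_pmf skew_pmf \<Longrightarrow> k \<le> k_max"
  by (auto simp: set_pmf_iff pmf_skew_pmf p_def Let_def split: if_splits)

end

context see_saw_large
begin

lemma window_pos:
  assumes "real len \<ge> min_len"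
  shows "window len k > 0"
  using lifetime_bounds(1)[OF assms] by (simp add: window_def)

lemma window_lifetime: "k \<le> k_max \<Longrightarrow> 2 ^ k * window len k = lifetime len"
  by (simp add: window_def lifetime_def flip: power_add)

lemma window_dvd: "k \<le> k_max \<Longrightarrow> window len k dvd lifetime len"
  by (metis dvd_triv_right window_lifetime)

definition charges :: "nat \<Rightarrow> nat \<Rightarrow> nat \<Rightarrow> real" where
  "charges len s q = (\<Sum>t<q. charge len (real (s + t)))"

lemma charges_0 [simp]: "charges len s 0 = 0"
  by (simp add: charges_def)

lemma charges_Suc: "charges len s (Suc q) = charge len (real s) + charges len (Suc s) q"
  unfolding charges_def sum.lessThan_Suc_shift by simp

lemma charges_add: "charges len s (q + q') = charges len s q + charges len (s + q) q'"
  by (induction q') (auto simp: charges_def add.assoc)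

lemma charges_nonneg: "charges len s q \<ge> 0"
  unfolding charges_def by (intro sum_nonneg charge_nonneg)

definition left_width :: "nat \<Rightarrow> nat \<Rightarrow> nat \<Rightarrow> int \<Rightarrow> nat" where
  "left_width len k c D = nat \<lfloor>real len / 2 - shift len k (c div window len k) D\<rfloor>"

text \<open>\<open>bs\<close> are the directions of the future insertions, \<open>True\<close> meaning right. The width of the left child
  is \<open>None\<close> during a window whose charges are accounted for by the existing children.\<close>

primrec future :: "nat \<Rightarrow> nat \<Rightarrow> bool list \<Rightarrow> nat \<Rightarrow> int \<Rightarrow> nat option \<Rightarrow> nat \<Rightarrow> nat \<Rightarrow> real" where
  "future len k [] c D w nl nr = 0"
| "future len k (b # bs) c D w nl nr = node_charge k
     + (case w of None \<Rightarrow> 0 | Some wl \<Rightarrow> if b then charge (len - wl) (real nr) else charge wl (real nl))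
     + (let nl' = (if b then nl else Suc nl); nr' = (if b then Suc nr else nr); D' = (if b then D + 1 else D - 1) in
        if Suc c = lifetime len then charges len (nl' + nr') (length bs)
        else if window len k dvd Suc c then future len k bs (Suc c) 0 (Some (left_width len k (Suc c) D')) nl' nr'
        else future len k bs (Suc c) D' w nl' nr')"

text \<open>Counterpart of \<open>finish_insertion\<close> with its cases reset, rebuild and
  nothing, so that \<open>future_Cons\<close> separates an insertion from what it triggers.\<close>

definition resume :: "nat \<Rightarrow> nat \<Rightarrow> bool list \<Rightarrow> nat \<Rightarrow> int \<Rightarrow> nat option \<Rightarrow> nat \<Rightarrow> nat \<Rightarrow> real" where
  "resume len k bs c D w nl nr =
     (if c = lifetime len then charges len (nl + nr) (length bs)
      else if window len k dvd c then future len k bs c 0 (Some (left_width len k c D)) nl nr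
      else future len k bs c D w nl nr)"

lemma future_Cons:
  "future len k (b # bs) c D w nl nr = node_charge k
     + (case w of None \<Rightarrow> 0 | Some wl \<Rightarrow> if b then charge (len - wl) (real nr) else charge wl (real nl))
     + resume len k bs (Suc c) (if b then D + 1 else D - 1) w (if b then nl else Suc nl) (if b then Suc nr else nr)"
  by (simp add: resume_def Let_def)

declare future.simps(2) [simp del]

lemma future_nonneg: "future len k bs c D w nl nr \<ge> 0"
proof (induction bs arbitrary: c D w nl nr)
  case (Cons b bs)
  have "resume len k bs c D w nl nr \<ge> 0" for c D w nl nr
    unfolding resume_def using Cons.IH charges_nonneg by simp
  then show ?case using charge_nonneg \<alpha>_large
    by (auto simp: future_Cons node_charge_def intro!: add_nonneg_nonneg split: option.splits)
qed simp

lemma resume_nonneg: "resume len k bs c D w nl nr \<ge> 0"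
  unfolding resume_def using future_nonneg charges_nonneg by simp

lemma mod_Suc_not_dvd:
  assumes "w > (0::nat)" "\<not> w dvd Suc c"
  shows "Suc c mod w = Suc (c mod w)" "Suc c div w = c div w"
  using assms by (auto simp: mod_Suc div_Suc dvd_eq_mod_eq_0 split: if_splits)

lemma mod_Suc_dvd:
  assumes "w > (0::nat)" "w dvd Suc c"
  shows "c mod w = w - 1" "Suc c div w = Suc (c div w)" "Suc c div w * w = Suc c"
proof -
  show "c mod w = w - 1" "Suc c div w = Suc (c div w)"
    using assms by (auto simp: mod_Suc div_Suc dvd_eq_mod_eq_0 split: if_splits)
  show "Suc c div w * w = Suc c" using assms(2) by (rule dvd_div_mult_self)
qed

text \<open>Existing children carry their own budgets until the window ends. Passing from
  \<open>Some\<close> to \<open>None\<close> removes exactly their charges for the remaining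
  \<open>w - c mod w\<close> insertions of the window.\<close>

lemma future_Some:
  assumes "real len \<ge> min_len" "k \<le> k_max" "c < lifetime len"
  defines "w \<equiv> window len k"
  shows "future len k bs c D (Some wl) nl nr = future len k bs c D None nl nr
    + charges wl nl (length (filter Not (take (w - c mod w) bs)))
    + charges (len - wl) nr (length (filter (\<lambda>b. b) (take (w - c mod w) bs)))"
  using assms(3)
proof (induction bs arbitrary: c D nl nr)
  case (Cons b bs)
  have w: "w > 0" unfolding w_def by (rule window_pos) fact
  have wT: "w dvd lifetime len" unfolding w_def by (rule window_dvd) fact
  show ?case
  proof (cases "w dvd Suc c")
    case True
    then have "w - c mod w = 1" using mod_Suc_dvd(1)[OF w True] w by simp
    then show ?thesis using True
      by (simp add: future_Cons resume_def w_def charges_Suc)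
  next
    case False
    then have ne: "Suc c \<noteq> lifetime len" using wT by auto
    then have lt: "Suc c < lifetime len" using Cons.prems by simp
    have "Suc c mod w < w" using w by simp
    then have q: "w - c mod w = Suc (w - Suc c mod w)"
      using mod_Suc_not_dvd(1)[OF w False] by simp
    show ?thesis
      using Cons.IH[OF lt] ne False unfolding q
      by (simp add: future_Cons resume_def w_def charges_Suc)
  qed
qed simp

section \<open>Future charges as an explicit sum over time\<close>

definition lefts :: "bool list \<Rightarrow> nat \<Rightarrow> nat" where "lefts bs t = length (filter Not (take t bs))"
definition rights :: "bool list \<Rightarrow> nat \<Rightarrow> nat" where "rights bs t = length (filter (\<lambda>b. b) (take t bs))"

lemma lefts_Suc: "t < length bs \<Longrightarrow> lefts bs (Suc t) = (if bs ! t then lefts bs t else Suc (lefts bs t))"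
  by (simp add: lefts_def take_Suc_conv_app_nth)

lemma rights_Suc: "t < length bs \<Longrightarrow> rights bs (Suc t) = (if bs ! t then Suc (rights bs t) else rights bs t)"
  by (simp add: rights_def take_Suc_conv_app_nth)

lemma lefts_rights: "t \<le> length bs \<Longrightarrow> lefts bs t + rights bs t = t"
  by (induction t) (auto simp: lefts_Suc rights_Suc, auto simp: lefts_def rights_def)

lemma walk_dirs: "t \<le> length bs \<Longrightarrow> walk (dirs bs) t = real (rights bs t) - real (lefts bs t)"
  by (induction t) (auto simp: lefts_Suc rights_Suc walk_Suc dirs_def, auto simp: lefts_def rights_def)

definition imb :: "bool list \<Rightarrow> nat \<Rightarrow> nat \<Rightarrow> int" where
  "imb bs i j = (int (rights bs j) - int (lefts bs j)) - (int (rights bs i) - int (lefts bs i))"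

text \<open>Closed form of the left width that the recursion of \<open>future\<close> hands on. For
  \<open>j = 0\<close> the subtraction truncates, harmlessly, as the shift is 0 there.\<close>

definition width_at :: "nat \<Rightarrow> nat \<Rightarrow> bool list \<Rightarrow> nat \<Rightarrow> nat" where
  "width_at len k bs t = (let w = window len k; j = t div w in
     nat \<lfloor>real len / 2 - shift len k j (imb bs ((j - 1) * w) (j * w))\<rfloor>)"

text \<open>Unrolls the recursion into the form required by \<open>node_bound\<close>. Insertions
  beyond the lifetime are charged at the same node, which has been reset by then.\<close>

lemma future_eq_sum:
  assumes len: "real len \<ge> min_len" and k: "k \<le> k_max"
    and c: "c < lifetime len" "c \<le> length bs"
  defines "w \<equiv> window len k"
  shows "future len k (drop c bs) c (imb bs (c div w * w) c) (Some (width_at len k bs c)) (nl + lefts bs c) (nr + rights bs c)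
     = (\<Sum>t\<in>{c..<min (length bs) (lifetime len)}. node_charge k +
          (if bs ! t then charge (len - width_at len k bs t) (real (nr + rights bs t))
           else charge (width_at len k bs t) (real (nl + lefts bs t))))
       + charges len (nl + nr + lifetime len) (length bs - lifetime len)"
  using c
proof (induction "length bs - c" arbitrary: c)
  case 0
  then show ?case by simp
next
  case (Suc d)
  let ?F = "\<lambda>t. node_charge k + (if bs ! t then charge (len - width_at len k bs t) (real (nr + rights bs t))
           else charge (width_at len k bs t) (real (nl + lefts bs t)))"
  have w: "w > 0" unfolding w_def by (rule window_pos) fact
  have wT: "w dvd lifetime len" unfolding w_def by (rule window_dvd) fact
  have cl: "c < length bs" using Suc by simp
  then have drop: "drop c bs = bs ! c # drop (Suc c) bs" by (simp add: Cons_nth_drop_Suc)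
  have lr: "lefts bs (Suc c) = (if bs ! c then lefts bs c else Suc (lefts bs c))"
     "rights bs (Suc c) = (if bs ! c then Suc (rights bs c) else rights bs c)"
    using cl by (simp_all add: lefts_Suc rights_Suc)
  have imb: "imb bs i (Suc c) = (if bs ! c then imb bs i c + 1 else imb bs i c - 1)" for i
    by (simp add: imb_def lr)
  have sum: "(\<Sum>t\<in>{c..<min (length bs) (lifetime len)}. ?F t) = ?F c + (\<Sum>t\<in>{Suc c..<min (length bs) (lifetime len)}. ?F t)"
    using cl Suc.prems by (intro sum.atLeast_Suc_lessThan) auto
  have tot: "nl + lefts bs (Suc c) + (nr + rights bs (Suc c)) = nl + nr + Suc c"
    using lefts_rights[of "Suc c" bs] cl by simp
  have step: "future len k (drop c bs) c (imb bs (c div w * w) c) (Some (width_at len k bs c)) (nl + lefts bs c) (nr + rights bs c)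
     = ?F c + resume len k (drop (Suc c) bs) (Suc c) (imb bs (c div w * w) (Suc c)) (Some (width_at len k bs c))
        (nl + lefts bs (Suc c)) (nr + rights bs (Suc c))"
    unfolding drop future_Cons imb lr by auto
  show ?case
  proof (cases "Suc c = lifetime len")
    case True
    then have "resume len k (drop (Suc c) bs) (Suc c) D' w' (nl + lefts bs (Suc c)) (nr + rights bs (Suc c))
        = charges len (nl + nr + lifetime len) (length bs - lifetime len)" for D' w'
      unfolding resume_def tot by simp
    then show ?thesis unfolding step sum using True by simp
  next
    case False
    then have lt: "Suc c < lifetime len" using Suc.prems by simp
    have IH: "future len k (drop (Suc c) bs) (Suc c) (imb bs (Suc c div w * w) (Suc c)) (Some (width_at len k bs (Suc c)))
        (nl + lefts bs (Suc c)) (nr + rights bs (Suc c))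
      = (\<Sum>t\<in>{Suc c..<min (length bs) (lifetime len)}. ?F t) + charges len (nl + nr + lifetime len) (length bs - lifetime len)"
      using Suc.hyps lt cl by (intro Suc.hyps(1)) auto
    show ?thesis
    proof (cases "w dvd Suc c")
      case True
      note m = mod_Suc_dvd[OF w True]
      have "imb bs (Suc c div w * w) (Suc c) = 0" unfolding m(3) by (simp add: imb_def)
      moreover have "left_width len k (Suc c) (imb bs (c div w * w) (Suc c)) = width_at len k bs (Suc c)"
        unfolding left_width_def width_at_def Let_def w_def[symmetric] m(3) unfolding m(2) by simp
      ultimately show ?thesis
        unfolding step sum using IH False True by (simp add: resume_def w_def)
    next
      case wn: False
      note m = mod_Suc_not_dvd[OF w wn]
      have "width_at len k bs (Suc c) = width_at len k bs c"
        unfolding width_at_def Let_def w_def[symmetric] m(2) ..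
      then show ?thesis
        unfolding step sum using IH False wn m(2) by (simp add: resume_def w_def)
    qed
  qed
qed

lemma shift_abs_le:
  assumes "\<bar>D\<bar> \<le> int (window len k)" "real len \<ge> min_len"
  shows "\<bar>shift len k j D\<bar> \<le> real len / \<beta>"
proof -
  have w: "real (window len k) > 0" using window_pos[OF assms(2)] by simp
  have D: "\<bar>real_of_int D\<bar> \<le> real (window len k)" using assms(1) by linarith
  have "\<bar>real len * real_of_int D / (\<beta> * real (window len k))\<bar> = real len * \<bar>real_of_int D\<bar> / (\<beta> * real (window len k))"
    using \<beta>_large w by (simp add: abs_mult)
  also have "\<dots> \<le> real len * real (window len k) / (\<beta> * real (window len k))"
    using D \<beta>_large w by (intro divide_right_mono mult_left_mono) auto
  also have "\<dots> = real len / \<beta>" using w by simp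
  finally show ?thesis using \<beta>_large by (auto simp: shift_def)
qed

lemma left_floor:
  fixes j :: nat
  assumes "\<bar>D\<bar> \<le> int (window len k)" "real len \<ge> min_len"
  defines "wl \<equiv> nat \<lfloor>real len / 2 - shift len k j D\<rfloor>"
  shows "real wl \<le> real len / 2 - shift len k j D" "real len / 2 - shift len k j D < real wl + 1"
    "wl \<le> len" "\<bar>real wl - real len / 2\<bar> \<le> real len / \<beta> + 1" "real (len - wl) = real len - real wl"
proof -
  have s: "\<bar>shift len k j D\<bar> \<le> real len / \<beta>" by (rule shift_abs_le) fact+
  have b: "real len / \<beta> \<le> real len / 10000000" using \<beta>_large by (intro divide_left_mono) auto
  have l: "real len \<ge> 1000000" using assms min_len_ge by linarith
  have "real len / 2 - shift len k j D \<ge> 0" using s b l by linarith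
  then show 1: "real wl \<le> real len / 2 - shift len k j D" "real len / 2 - shift len k j D < real wl + 1"
    unfolding wl_def by linarith+
  have "real wl \<le> real len" using 1 s b l by linarith
  then show 2: "wl \<le> len" by simp
  then show "real (len - wl) = real len - real wl" by simp
  show "\<bar>real wl - real len / 2\<bar> \<le> real len / \<beta> + 1" using 1 s by linarith
qed

text \<open>Only the first lifetime has to be estimated, by \<open>node_bound\<close>; everything
  after the reset is charged identically on both sides, whatever the skew was.\<close>

lemma fresh_future_bound:
  assumes len: "2 powr sqrt lg < real len" and s: "4 * (nl + nr) \<le> 3 * len"
    and diff: "\<bar>real nr - real nl\<bar> \<le> 4"
  shows "(\<Sum>k\<le>k_max. p k * future len k bs 0 0 (Some (len div 2)) nl nr) \<le> charges len (nl + nr) (length bs)"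
proof -
  let ?T = "lifetime len"
  have lm: "real len \<ge> min_len" using len min_len_ge unfolding min_len_def by linarith
  have T: "?T > 0" by (rule lifetime_bounds) fact
  define bs' where "bs' = take ?T bs"
  have len': "length bs' = min (length bs) ?T" by (simp add: bs'_def)
  define cc where "cc = (\<lambda>t. if bs' ! t then nr + rights bs t else nl + lefts bs t)"
  define cw where "cw = (\<lambda>k t. if bs' ! t then len - width_at len k bs t else width_at len k bs t)"
  have take': "take t bs' = take t bs" if "t \<le> ?T" for t using that by (simp add: bs'_def min_def)
  have lr: "lefts bs' t = lefts bs t" "rights bs' t = rights bs t" if "t \<le> ?T" for t
    using take'[OF that] by (simp_all add: lefts_def rights_def)
  have eq: "future len k bs 0 0 (Some (len div 2)) nl nr
      = (\<Sum>t<length bs'. node_charge k + charge (cw k t) (real (cc t)))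
        + charges len (nl + nr + ?T) (length bs - ?T)" if k: "k \<le> k_max" for k
  proof -
    have w0: "width_at len k bs 0 = len div 2"
      by (simp add: width_at_def shift_def Let_def floor_divide_of_nat_eq[of len 2, simplified])
    have "imb bs (0 div window len k * window len k) 0 = 0" "lefts bs 0 = 0" "rights bs 0 = 0"
      by (simp_all add: imb_def lefts_def rights_def)
    then have "future len k bs 0 0 (Some (len div 2)) nl nr
      = (\<Sum>t\<in>{0..<min (length bs) ?T}. node_charge k +
          (if bs ! t then charge (len - width_at len k bs t) (real (nr + rights bs t))
           else charge (width_at len k bs t) (real (nl + lefts bs t))))
       + charges len (nl + nr + ?T) (length bs - ?T)"
      using future_eq_sum[OF lm k T, of bs nl nr] w0 by simp
    also have "(\<Sum>t\<in>{0..<min (length bs) ?T}. node_charge k +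
          (if bs ! t then charge (len - width_at len k bs t) (real (nr + rights bs t))
           else charge (width_at len k bs t) (real (nl + lefts bs t))))
        = (\<Sum>t<length bs'. node_charge k + charge (cw k t) (real (cc t)))"
      unfolding len' atLeast0LessThan by (intro sum.cong refl) (simp add: cw_def cc_def bs'_def)
    finally show ?thesis .
  qed
  have bound: "(\<Sum>k\<le>k_max. p k * (\<Sum>t<length bs'. node_charge k + charge (cw k t) (real (cc t))))
      \<le> (\<Sum>t<length bs'. charge len (real (nl + nr + t)))"
  proof (rule node_bound[OF len s, where \<eta> = "real nr - real nl"])
    show "length bs' \<le> ?T" by (simp add: len')
    show "\<bar>real nr - real nl\<bar> \<le> 4" by fact
    fix t assume t: "t < length bs'"
    have tb: "t < length bs" "t \<le> ?T" "t \<le> length bs'" using t by (auto simp: len')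
    have "lefts bs t + rights bs t = t" using lefts_rights[of t bs] tb by simp
    then have "real t = real (lefts bs t) + real (rights bs t)" by linarith
    moreover have "walk (dirs bs') t = real (rights bs t) - real (lefts bs t)"
      using walk_dirs[OF tb(3)] lr[OF tb(2)] by simp
    ultimately show "real (cc t) = (real (nl + nr + t) + dirs bs' t * (real nr - real nl + walk (dirs bs') t)) / 2"
      using t by (simp add: cc_def dirs_def)
    fix k assume k: "k \<le> k_max"
    interpret dyadic k_max "min_window len"
      using lifetime_bounds(1)[OF lm] by unfold_locales
    let ?w = "window len k" and ?j = "t div window len k"
    have win: "win k = ?w" by (simp add: win_def window_def)
    have w: "?w > 0" by (rule window_pos) fact
    define D where "D = imb bs ((?j - 1) * ?w) (?j * ?w)"
    have jt: "?j * ?w \<le> t" by simp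
    then have jt': "(?j - 1) * ?w \<le> t" by (meson diff_le_self le_trans mult_le_mono1)
    have D: "real_of_int D = walk (dirs bs') (?j * ?w) - walk (dirs bs') ((?j - 1) * ?w)"
      unfolding D_def imb_def walk_dirs[OF le_trans[OF jt tb(3)]] walk_dirs[OF le_trans[OF jt' tb(3)]]
        lr[OF le_trans[OF jt tb(2)]] lr[OF le_trans[OF jt' tb(2)]] by simp
    have "\<bar>walk (dirs bs') (?j * ?w) - walk (dirs bs') ((?j - 1) * ?w)\<bar> \<le> real (?j * ?w - (?j - 1) * ?w)"
    proof -
      have "\<bar>walk (dirs bs') (?j * ?w) - walk (dirs bs') ((?j - 1) * ?w)\<bar> \<le> (\<Sum>u\<in>{(?j - 1) * ?w..<?j * ?w}. \<bar>dirs bs' u\<bar>)"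
        by (subst walk_diff) (auto intro: sum_abs)
      also have "\<dots> \<le> real (card {(?j - 1) * ?w..<?j * ?w}) * 1"
        by (intro sum_bounded_above) (simp add: dirs_bounded)
      finally show ?thesis by simp
    qed
    also have "?j * ?w - (?j - 1) * ?w \<le> ?w" by (cases ?j) auto
    finally have "\<bar>real_of_int D\<bar> \<le> real ?w" using D by simp
    then have Dw: "\<bar>D\<bar> \<le> int ?w" by linarith
    have wa: "width_at len k bs t = nat \<lfloor>real len / 2 - shift len k ?j D\<rfloor>"
      by (simp add: width_at_def D_def Let_def)
    note fl = left_floor[OF Dw lm, of ?j, folded wa]
    \<comment> \<open>For odd \<open>?j\<close> the imbalance recorded by the algorithm is the block
      of the preceding window; for even \<open>?j\<close> both sides are 0.\<close>
    have sh: "shift len k ?j D = real len * tilt \<beta> (dirs bs') k t / 2"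
    proof (cases "odd ?j")
      case True
      then have "?j - 1 + 1 = ?j" by (cases ?j) auto
      then have "block (dirs bs') k (?j - 1) = real_of_int D" unfolding block_def win D by simp
      then show ?thesis using True by (simp add: shift_def tilt_def win)
    qed (simp add: shift_def tilt_def win)
    show "\<bar>real (cw k t) - (real len / 2 + dirs bs' t * real len * tilt \<beta> (dirs bs') k t / 2)\<bar> \<le> 1"
    proof (cases "bs' ! t")
      case True
      then have "real (cw k t) = real len - real (width_at len k bs t)" using fl(5) by (simp add: cw_def)
      moreover have "dirs bs' t * real len * tilt \<beta> (dirs bs') k t / 2 = shift len k ?j D"
        using True t sh by (simp add: dirs_def)
      ultimately show ?thesis using fl(1,2) by linarith
    next
      case False
      then have "real (cw k t) = real (width_at len k bs t)" by (simp add: cw_def)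
      moreover have "dirs bs' t * real len * tilt \<beta> (dirs bs') k t / 2 = - shift len k ?j D"
        using False t sh by (simp add: dirs_def)
      ultimately show ?thesis using fl(1,2) by linarith
    qed
  qed
  have "(\<Sum>k\<le>k_max. p k * future len k bs 0 0 (Some (len div 2)) nl nr)
      = (\<Sum>k\<le>k_max. p k * (\<Sum>t<length bs'. node_charge k + charge (cw k t) (real (cc t))))
        + (\<Sum>k\<le>k_max. p k) * charges len (nl + nr + ?T) (length bs - ?T)"
    unfolding sum_distrib_right sum.distrib[symmetric] by (intro sum.cong refl) (simp add: eq distrib_left)
  also have "\<dots> \<le> charges len (nl + nr) (length bs') + charges len (nl + nr + ?T) (length bs - ?T)"
    using bound by (simp add: sum_p charges_def)
  also have "\<dots> = charges len (nl + nr) (length bs)"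
  proof (cases "length bs \<le> ?T")
    case False
    then show ?thesis using charges_add[of len "nl + nr" ?T "length bs - ?T"] by (simp add: len')
  qed (simp add: len')
  finally show ?thesis .
qed

end

section \<open>Budgets\<close>

context see_saw_large
begin

declare grow.simps [simp del]

text \<open>The first summands are the savings for the next rebuild or reset, the others bound the expected
  charges of the future insertions \<open>ys\<close>.\<close>

primrec budget :: "subproblem \<Rightarrow> 'a::linorder slots \<Rightarrow> 'a list \<Rightarrow> real" where
  "budget (Leaf lo len c) a ys =
     ikr_potential a lo len + 2 * \<alpha> * real c + charges len (length (contents a lo len)) (length ys)"
| "budget (Node lo len k c D l r) a ys =
     2 * \<alpha> * real c + 2 * \<alpha> * 2 ^ k * real (c mod window len k)
     + budget l a (filter (goes_left a l) (take (window len k - c mod window len k) ys))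
     + budget r a (filter (\<lambda>y. \<not> goes_left a l y) (take (window len k - c mod window len k) ys))
     + future len k (map (\<lambda>y. \<not> goes_left a l y) ys) c D None
         (length (contents a (off l) (width l))) (length (contents a (off r) (width r)))"

text \<open>\<open>s\<close> is the number of elements at creation. The 4 allows for dividing an
  evenly filled subarray, and each insertion changes the difference by 1.\<close>

definition balanced :: "nat \<Rightarrow> nat \<Rightarrow> nat \<Rightarrow> nat \<Rightarrow> bool" where
  "balanced len c nl nr \<longleftrightarrow>
     (\<exists>s. nl + nr = s + c \<and> 4 * s \<le> 3 * len) \<and> \<bar>real nr - real nl\<bar> \<le> 4 + real c"

definition node_size :: "nat \<Rightarrow> bool" where
  "node_size len \<longleftrightarrow> 2 powr sqrt lg < real len \<and> len \<le> m"

definition halves :: "nat \<Rightarrow> nat \<Rightarrow> subproblem \<Rightarrow> subproblem \<Rightarrow> bool" where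
  "halves lo len l r \<longleftrightarrow> off l = lo \<and> off r = lo + width l \<and> width l + width r = len
     \<and> \<bar>real (width l) - real len / 2\<bar> \<le> real len / \<beta> + 1"

text \<open>A leaf has to be dense or short, since only then does its charge cover the
  Itai-Konheim-Rodeh cost.\<close>

primrec sound :: "subproblem \<Rightarrow> 'a slots \<Rightarrow> bool" where
  "sound (Leaf lo len c) a \<longleftrightarrow> min_len \<le> real len \<and> len \<le> m
     \<and> (3 * len < 4 * length (contents a lo len) \<or> real len \<le> 2 powr sqrt lg)"
| "sound (Node lo len k c D l r) a \<longleftrightarrow> node_size len \<and> k \<le> k_max \<and> c < lifetime len
     \<and> halves lo len l r \<and> \<bar>D\<bar> \<le> int (c mod window len k)
     \<and> balanced len c (length (contents a (off l) (width l))) (length (contents a (off r) (width r)))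
     \<and> sound l a \<and> sound r a"

lemma node_size_min: "node_size len \<Longrightarrow> 3 * min_len \<le> real len \<and> min_len \<le> real len \<and> 3000000 \<le> real len"
  using min_len_ge(2) unfolding node_size_def min_len_def by simp

lemma goes_left_cong:
  assumes "contents b (off l) (width l) = contents a (off l) (width l)"
  shows "goes_left b l = goes_left a l"
  by (rule ext) (simp add: goes_left_def assms)

text \<open>Soundness and budget read only the subproblem's own subarray, so work in one child
  leaves the budget of its sibling as it is.\<close>

lemma region_cong:
  assumes "sound t a" "\<And>i. off t \<le> i \<Longrightarrow> i < off t + width t \<Longrightarrow> b i = a i"
  shows "sound t b \<and> (\<forall>ys. budget t b ys = budget t a ys)"
  using assms
proof (induction t)
  case (Leaf lo len c)
  have al: "b i = a i" if "lo \<le> i" "i < lo + len" for i using Leaf.prems(2)[of i] that by simp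
  have "contents b lo len = contents a lo len" using al by (rule contents_cong)
  then show ?case
    using Leaf.prems(1) ikr_potential_cong[OF al, of lo len] by simp_all
next
  case (Node lo len k c D l r)
  have h: "off l = lo" "off r = lo + width l" "width l + width r = len"
    using Node.prems(1) by (simp_all add: halves_def)
  have al: "b i = a i" if "off l \<le> i" "i < off l + width l" for i using Node.prems(2)[of i] that h by simp
  have ar: "b i = a i" if "off r \<le> i" "i < off r + width r" for i using Node.prems(2)[of i] that h by simp
  have cl: "contents b (off l) (width l) = contents a (off l) (width l)" using al by (intro contents_cong) auto
  have cr: "contents b (off r) (width r) = contents a (off r) (width r)" using ar by (intro contents_cong) auto
  have s: "sound l a" "sound r a" using Node.prems(1) by simp_all
  show ?case
    using Node.prems(1) Node.IH(1)[OF s(1) al] Node.IH(2)[OF s(2) ar] cl cr goes_left_cong[OF cl] by simp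
qed

lemma budget_nonneg: "budget t a ys \<ge> 0"
proof (induction t arbitrary: ys)
  case (Leaf lo len c)
  show ?case using ikr_potential_nonneg[of a lo len] charges_nonneg \<alpha>_large by simp
next
  case (Node lo len k c D l r)
  then show ?case using future_nonneg \<alpha>_large by simp
qed

abbreviation (input) outlay :: "'a::linorder list \<Rightarrow> subproblem \<times> 'a memory \<Rightarrow> real" where
  "outlay ys \<equiv> (\<lambda>(t, (a, c)). real c + budget t a ys)"

abbreviation (input) updated where
  "updated lo len xs a t a' \<equiv> sound t a' \<and> off t = lo \<and> width t = len \<and> contents a' lo len = xs
     \<and> (\<forall>i. i < lo \<or> lo + len \<le> i \<longrightarrow> a' i = a i)"

lemma ikr_region_of_min_len: "min_len \<le> real len \<Longrightarrow> ikr_region len"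
proof
  assume "min_len \<le> real len"
  then have len: "real len \<ge> 16" using min_len_ge(2) by simp
  then show "2 * log 2 (real len) \<le> real len" by (rule log2_le_half)
  have "log 2 2 \<le> log 2 (real len)" using len by (subst log_le_cancel_iff) auto
  then show "1 \<le> log 2 (real len)" by simp
qed

lemma length_directions:
  "length (filter Not (take q (map (\<lambda>y. \<not> P y) ys))) = length (filter P (take q ys))"
  "length (filter (\<lambda>b. b) (take q (map (\<lambda>y. \<not> P y) ys))) = length (filter (\<lambda>y. \<not> P y) (take q ys))"
  by (simp_all add: take_map filter_map o_def)

text \<open>By induction on the width: creation moves nothing, and both halves are evenly filled
  with the same \<open>\<rho>\<close>. The bound 17/20 leaves room above the leaf threshold 3/4 for
  rounding and for insertions.\<close>

lemma grow_spec:
  fixes a :: "'a::linorder slots"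
  assumes "evenly \<rho> a lo len" "min_len \<le> real len" "len \<le> m"
    and "real (length (contents a lo len)) \<le> 17 / 20 * real len"
  shows "(\<forall>t\<in>set_pmf (grow a lo len). sound t a \<and> off t = lo \<and> width t = len \<and> received t = 0)
    \<and> (\<forall>ys. expect_le (grow a lo len) (\<lambda>t. budget t a ys) (charges len (length (contents a lo len)) (length ys)))"
  using assms
proof (induction len arbitrary: lo rule: less_induct)
  case (less len)
  let ?s = "length (contents a lo len)"
  note even = less.prems(1) and min = less.prems(2)
  have len0: "real len \<ge> 1000000" using min min_len_ge(2) by simp
  have \<rho>: "0 \<le> \<rho>" "\<rho> \<le> 1" using even by (simp_all add: evenly_def)
  show ?case
  proof (cases "is_leaf_case ?s len")
    case True
    then have grow: "grow a lo len = return_pmf (Leaf lo len 0)" by (subst grow.simps) simp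
    interpret ikr_region len by (rule ikr_region_of_min_len) fact
    have "ikr_potential a lo len = 0"
      using even less.prems(4) len0 by (intro potential_evenly_zero) auto
    moreover have "sound (Leaf lo len 0) a"
      using True min less.prems(3) len0 by (auto simp: is_leaf_case_def field_simps)
    ultimately show ?thesis unfolding grow by (auto intro: expect_le_return)
  next
    case False
    define hl where "hl = len div 2"
    define hr where "hr = len - len div 2"
    define nl where "nl = length (contents a lo hl)"
    define nr where "nr = length (contents a (lo + hl) hr)"
    have grow: "grow a lo len = skew_pmf \<bind> (\<lambda>k. grow a lo hl \<bind> (\<lambda>l. grow a (lo + hl) hr \<bind>
        (\<lambda>r. return_pmf (Node lo len k 0 0 l r))))"
      using False by (subst grow.simps) (simp add: hl_def hr_def)
    have size: "node_size len" and s: "4 * ?s \<le> 3 * len"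
      using False less.prems(3) len0 by (auto simp: is_leaf_case_def node_size_def field_simps)
    note lens = node_size_min[OF size]
    have h: "hl + hr = len" "hl < len" "hr < len" "real hl \<ge> real len / 2 - 1 / 2" "real hl \<le> real len / 2"
      "real hr = real len - real hl"
      using len0 by (auto simp: hl_def hr_def)
    have cnt: "contents a lo len = contents a lo hl @ contents a (lo + hl) hr"
      using contents_append[of a lo hl hr] h by simp
    then have sn: "?s = nl + nr" by (simp add: nl_def nr_def)
    have el: "evenly \<rho> a lo hl" using evenly_sub[OF even, of 0 hl] h by simp
    have er: "evenly \<rho> a (lo + hl) hr" using evenly_sub[OF even, of hl hr] h by simp
    have bl: "\<bar>real nl - \<rho> * real hl\<bar> \<le> 1" using evenlyD[OF el, of 0 hl] by (simp add: nl_def)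
    have br: "\<bar>real nr - \<rho> * real hr\<bar> \<le> 1" using evenlyD[OF er, of 0 hr] by (simp add: nr_def)
    have hrl: "\<rho> * real hr = \<rho> * real hl + \<rho> * (real hr - real hl)" by (simp add: algebra_simps)
    have "\<rho> * (real hr - real hl) \<le> 1 * 1" using \<rho> h by (intro mult_mono) auto
    moreover have "0 \<le> \<rho> * (real hr - real hl)" using \<rho> h by (intro mult_nonneg_nonneg) auto
    ultimately have diff: "\<bar>real nr - real nl\<bar> \<le> 4" using bl br hrl by linarith
    have sr: "real nl + real nr \<le> 3 / 4 * real len" using s sn by linarith
    have dl: "real nl \<le> 17 / 20 * real hl" and dr: "real nr \<le> 17 / 20 * real hr"
      using diff sr h len0 by linarith+
    have minl: "min_len \<le> real hl" "min_len \<le> real hr" using lens h min_len_ge(2) by linarith+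
    have mle: "hl \<le> m" "hr \<le> m" using h less.prems(3) by linarith+
    note L = less.IH[OF h(2) el minl(1) mle(1) dl[unfolded nl_def]]
    note R = less.IH[OF h(3) er minl(2) mle(2) dr[unfolded nr_def]]
    have bal: "balanced len 0 nl nr" using s sn diff by (auto simp: balanced_def)
    have len\<beta>: "real len / \<beta> \<ge> 0" using \<beta>_large by simp
    have halves: "halves lo len l r" if "off l = lo" "width l = hl" "off r = lo + hl" "width r = hr" for l r
      using that h len\<beta> by (auto simp: halves_def)
    have T: "lifetime len > 0" using lifetime_bounds[of len] lens by simp
    have A: "sound t a \<and> off t = lo \<and> width t = len \<and> received t = 0" if "t \<in> set_pmf (grow a lo len)" for t
    proof -
      from that obtain k l r where klr: "k \<in> set_pmf skew_pmf" "l \<in> set_pmf (grow a lo hl)"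
        "r \<in> set_pmf (grow a (lo + hl) hr)" "t = Node lo len k 0 0 l r"
        unfolding grow by auto
      then have "sound l a" "off l = lo" "width l = hl" "sound r a" "off r = lo + hl" "width r = hr"
        using L R by blast+
      then show ?thesis using klr skew_le[OF klr(1)] size T halves bal by (simp add: nl_def nr_def)
    qed
    have B: "expect_le (grow a lo len) (\<lambda>t. budget t a ys) (charges len ?s (length ys))" for ys
    proof -
      \<comment> \<open>Routing depends only on the array and the place of the left child, both
        known before the skew and the subtrees are drawn. Hence one list \<open>bs\<close> of
        directions serves for all outcomes.\<close>
      define g where "g = goes_left a (Leaf lo hl 0)"
      have gl: "goes_left a l = g" if "off l = lo" "width l = hl" for l
        using that by (intro ext) (simp add: g_def goes_left_def)
      define bs where "bs = map (\<lambda>y. \<not> g y) ys"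
      \<comment> \<open>As long as the children are not drawn, their first window is charged by size
        alone (\<open>Some hl\<close>); afterwards \<open>future_Some\<close> hands this part over
        to their budgets.\<close>
      define F where "F = (\<lambda>k. future len k bs 0 0 (Some hl) nl nr)"
      have "expect_le skew_pmf F (charges len ?s (length ys))"
      proof (rule expect_le_mono[OF expect_le_skew])
        show "(\<Sum>k\<le>k_max. p k * F k) \<le> charges len ?s (length ys)"
          using fresh_future_bound[of len nl nr bs] size s sn diff by (simp add: F_def hl_def node_size_def bs_def)
      qed (auto simp: F_def future_nonneg)
      then show ?thesis unfolding grow
      proof (rule expect_le_bind)
        fix k assume "k \<in> set_pmf skew_pmf"
        then have k: "k \<le> k_max" by (rule skew_le)
        let ?w = "window len k"
        define yl where "yl = filter g (take ?w ys)"
        define yr where "yr = filter (\<lambda>y. \<not> g y) (take ?w ys)"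
        define N where "N = future len k bs 0 0 None nl nr"
        have F: "F k = N + charges hl nl (length yl) + charges hr nr (length yr)"
          unfolding F_def N_def using lens T
          by (subst future_Some[OF _ k]) (auto simp: bs_def length_directions yl_def yr_def hl_def hr_def)
        have N: "N \<ge> 0" by (simp add: N_def future_nonneg)
        have "expect_le (grow a lo hl) (\<lambda>l. (N + charges hr nr (length yr)) + budget l a yl)
            ((N + charges hr nr (length yr)) + charges hl nl (length yl))"
          using L N charges_nonneg by (intro expect_le_add_const) (auto simp: nl_def)
        then have "expect_le (grow a lo hl) (\<lambda>l. (N + charges hr nr (length yr)) + budget l a yl) (F k)"
          by (simp add: F algebra_simps)
        then show "expect_le (grow a lo hl \<bind> (\<lambda>l. grow a (lo + hl) hr \<bind> (\<lambda>r. return_pmf (Node lo len k 0 0 l r))))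
           (\<lambda>t. budget t a ys) (F k)"
        proof (rule expect_le_bind)
          fix l assume "l \<in> set_pmf (grow a lo hl)"
          then have l: "off l = lo" "width l = hl" using L by blast+
          have "expect_le (grow a (lo + hl) hr) (\<lambda>r. (N + budget l a yl) + budget r a yr)
              ((N + budget l a yl) + charges hr nr (length yr))"
            using R N budget_nonneg charges_nonneg
            by (intro expect_le_add_const) (auto simp: nr_def intro!: add_nonneg_nonneg)
          then have "expect_le (grow a (lo + hl) hr) (\<lambda>r. (N + budget l a yl) + budget r a yr)
              (N + charges hr nr (length yr) + budget l a yl)"
            by (simp add: algebra_simps)
          then show "expect_le (grow a (lo + hl) hr \<bind> (\<lambda>r. return_pmf (Node lo len k 0 0 l r)))
             (\<lambda>t. budget t a ys) (N + charges hr nr (length yr) + budget l a yl)"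
          proof (rule expect_le_bind)
            fix r assume "r \<in> set_pmf (grow a (lo + hl) hr)"
            then have r: "off r = lo + hl" "width r = hr" using R by blast+
            show "expect_le (return_pmf (Node lo len k 0 0 l r)) (\<lambda>t. budget t a ys) (N + budget l a yl + budget r a yr)"
              by (rule expect_le_return)
                (simp add: gl l r N_def bs_def nl_def nr_def yl_def yr_def)
          qed
        qed
      qed
    qed
    show ?thesis using A B by blast
  qed
qed

section \<open>Creating and rebuilding subtrees\<close>

lemma create_subtree_support:
  fixes a :: "'a::linorder slots"
  assumes res: "(t, (a', c')) \<in> set_pmf (create_subtree lo len xs (a, c))"
    and xs: "real (length xs) \<le> 17 / 20 * real len" and len: "min_len \<le> real len" "len \<le> m"
  shows "a' = spread lo len xs a" "c' \<le> c + length xs" "sound t a'" "off t = lo" "width t = len"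
    "contents a' lo len = xs" "\<And>i. i < lo \<or> lo + len \<le> i \<Longrightarrow> a' i = a i"
proof -
  let ?a = "spread lo len xs a"
  have le: "length xs \<le> len" using xs by linarith
  have len0: "len > 0" using len min_len_ge(2) by (cases len) auto
  have r: "a' = ?a" "c' = c + moves a ?a" "t \<in> set_pmf (grow ?a lo len)"
    using res by (auto simp: create_subtree_def place_def Let_def)
  show "a' = ?a" by (rule r)
  show "c' \<le> c + length xs" using r(2) moves_spread_le[OF le] by simp
  show c: "contents a' lo len = xs" unfolding r(1) by (rule contents_spread) fact
  show "\<And>i. i < lo \<or> lo + len \<le> i \<Longrightarrow> a' i = a i" unfolding r(1) by (rule spread_outside)
  have "\<forall>t\<in>set_pmf (grow ?a lo len). sound t ?a \<and> off t = lo \<and> width t = len \<and> received t = 0"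
    using grow_spec[OF evenly_spread[OF le len0] len, unfolded contents_spread[OF le], OF xs] by blast
  then show "sound t a'" "off t = lo" "width t = len" using r by auto
qed

lemma create_subtree_expect:
  fixes a :: "'a::linorder slots"
  assumes xs: "real (length xs) \<le> 17 / 20 * real len" and len: "min_len \<le> real len" "len \<le> m"
  shows "expect_le (create_subtree lo len xs (a, c)) (outlay ys)
    (real c + real (length xs) + charges len (length xs) (length ys))"
proof -
  let ?a = "spread lo len xs a"
  have le: "length xs \<le> len" using xs by linarith
  have len0: "len > 0" using len min_len_ge(2) by (cases len) auto
  have "expect_le (grow ?a lo len) (\<lambda>t. budget t ?a ys) (charges len (length xs) (length ys))"
    using grow_spec[OF evenly_spread[OF le len0] len, unfolded contents_spread[OF le], OF xs] by blast
  then have "expect_le (grow ?a lo len) (\<lambda>t. real (c + moves a ?a) + budget t ?a ys)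
      (real (c + moves a ?a) + charges len (length xs) (length ys))"
    using charges_nonneg by (intro expect_le_add_const) auto
  then have "expect_le (grow ?a lo len) (\<lambda>t. real (c + moves a ?a) + budget t ?a ys)
      (real c + real (length xs) + charges len (length xs) (length ys))"
    using moves_spread_le[OF le, of a lo] by (elim expect_le_mono) auto
  then show ?thesis
    by (simp add: create_subtree_def place_def Let_def) (intro expect_le_map, simp)
qed

text \<open>Density at most 3/4 at creation, at most len / 10^7 insertions since then and children
  within len / 10^7 + 1 of half the width: this stays well below 17/20.\<close>

lemma child_capacity:
  assumes size: "node_size len" and halves: "halves lo len l r" and bal: "balanced len c nl nr"
    and c: "c \<le> lifetime len"
  shows "real nl + 1 \<le> 17 / 20 * real (width l)" "real nr + 1 \<le> 17 / 20 * real (width r)"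
    "min_len \<le> real (width l)" "min_len \<le> real (width r)" "width l \<le> m" "width r \<le> m"
proof -
  note lens = node_size_min[OF size]
  have b: "real len / \<beta> \<le> real len / 10000000" using \<beta>_large by (intro divide_left_mono) auto
  have a: "real len / \<alpha> \<le> real len / 10000000" using \<alpha>_large by (intro divide_left_mono) auto
  have c': "real c \<le> real len / 10000000" using lifetime_bounds(2)[of len] lens c a by linarith
  obtain s where s: "nl + nr = s + c" "4 * s \<le> 3 * len" and d: "\<bar>real nr - real nl\<bar> \<le> 4 + real c"
    using bal by (auto simp: balanced_def)
  have s': "real nl + real nr = real s + real c" "4 * real s \<le> 3 * real len" using s by linarith+
  have w: "\<bar>real (width l) - real len / 2\<bar> \<le> real len / 10000000 + 1" "real (width l) + real (width r) = real len"
    using halves b unfolding halves_def by linarith+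
  show "real nl + 1 \<le> 17 / 20 * real (width l)" "real nr + 1 \<le> 17 / 20 * real (width r)"
    using s' d w c' lens by linarith+
  show "min_len \<le> real (width l)" "min_len \<le> real (width r)" using w lens by linarith+
  show "width l \<le> m" "width r \<le> m" using halves size by (auto simp: halves_def node_size_def)
qed

lemma contents_halves:
  assumes "halves lo len l r"
  shows "contents a lo len = contents a (off l) (width l) @ contents a (off r) (width r)"
  using contents_append[of a lo "width l" "width r"] assms by (simp add: halves_def)

lemma lifetime_pays: "node_size len \<or> min_len \<le> real len \<Longrightarrow> real len \<le> 2 * \<alpha> * real (lifetime len)"
  using lifetime_bounds(3)[of len] node_size_min[of len] \<alpha>_large by (auto simp: field_simps)

lemma window_pays:
  assumes "node_size len" "k \<le> k_max"
  shows "real len \<le> 2 * \<alpha> * 2 ^ k * real (window len k)"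
proof -
  have "real (lifetime len) = 2 ^ k * real (window len k)"
    using window_lifetime[OF assms(2), of len] by (metis of_nat_mult of_nat_numeral of_nat_power)
  then show ?thesis using lifetime_pays[of len] assms(1) by simp
qed

lemma rebuild_support:
  fixes a :: "'a::linorder slots"
  assumes res: "(t, (a', c')) \<in> set_pmf (rebuild (Node lo len k c D l r) (a, cost))"
    and size: "node_size len" and k: "k \<le> k_max" and c: "c < lifetime len" and dvd: "window len k dvd c"
    and D: "\<bar>D\<bar> \<le> int (window len k)" and halves: "halves lo len l r"
    and bal: "balanced len c (length (contents a (off l) (width l))) (length (contents a (off r) (width r)))"
  shows "sound t a'" "off t = lo" "width t = len" "contents a' lo len = contents a lo len"
    "\<And>i. i < lo \<or> lo + len \<le> i \<Longrightarrow> a' i = a i"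
proof -
  let ?wl = "left_width len k c D"
  let ?xs = "contents a (off l) (width l)" and ?ys = "contents a (off r) (width r)"
  note lens = node_size_min[OF size]
  have wl: "?wl \<le> len" "\<bar>real ?wl - real len / 2\<bar> \<le> real len / \<beta> + 1"
    unfolding left_width_def using left_floor[OF D, of "c div window len k"] lens by auto
  have hv: "halves lo len l' r'" if "off l' = lo" "width l' = ?wl" "off r' = lo + ?wl" "width r' = len - ?wl" for l' r'
    using that wl by (simp add: halves_def)
  from res obtain l' a1 c1 r' c2 where
    1: "(l', (a1, c1)) \<in> set_pmf (create_subtree lo ?wl ?xs (a, cost))" and
    2: "(r', (a', c2)) \<in> set_pmf (create_subtree (lo + ?wl) (len - ?wl) ?ys (a1, c1))" and
    t: "t = Node lo len k c 0 l' r'"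
    by (auto simp: rebuild_def Let_def left_width_def split_beta)
  \<comment> \<open>The leaves are placeholders that fix offset and width of the new
    children.\<close>
  note cap = child_capacity[OF size hv bal less_imp_le[OF c], of "Leaf lo ?wl 0" "Leaf (lo + ?wl) (len - ?wl) 0", simplified]
  have "real (length ?xs) \<le> 17 / 20 * real ?wl" "real (length ?ys) \<le> 17 / 20 * real (len - ?wl)" using cap by linarith+
  note L = create_subtree_support[OF 1 this(1) cap(3,5)] and R = create_subtree_support[OF 2 this(2) cap(4,6)]
  have same: "a' i = a1 i" if "lo \<le> i" "i < lo + ?wl" for i using R(7)[of i] that by simp
  have cl: "contents a' lo ?wl = ?xs" using L(6) contents_cong[OF same, of lo ?wl] by simp
  have sl: "sound l' a'" using region_cong[OF L(3), of a'] same L(4,5) by simp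
  show "sound t a'" unfolding t
    using size k c hv bal dvd sl R(3) L(4,5) R(4,5,6) cl by (simp add: dvd_imp_mod_0)
  show "off t = lo" "width t = len" by (simp_all add: t)
  show "contents a' lo len = contents a lo len"
    using contents_halves[OF hv[OF L(4,5) R(4,5)], of a'] contents_halves[OF halves, of a] cl L(4,5) R(4,5,6) by simp
  show "\<And>i. i < lo \<or> lo + len \<le> i \<Longrightarrow> a' i = a i"
    using L(7) R(7) wl(1) by (metis (no_types, opaque_lifting) le_add1 le_add_diff_inverse le_trans nat_add_left_cancel_le add.assoc trans_less_add1)
qed

text \<open>The moves \<open>nl + nr\<close> are listed separately because
  \<open>finish_node\<close> pays them from the savings of the window. The savings for the reset are
  kept, as the counter \<open>c\<close> goes on.\<close>

lemma rebuild_expect: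
  fixes a :: "'a::linorder slots"
  assumes size: "node_size len" and k: "k \<le> k_max" and c: "c < lifetime len" and dvd: "window len k dvd c"
    and D: "\<bar>D\<bar> \<le> int (window len k)" and halves: "halves lo len l r"
    and bal: "balanced len c (length (contents a (off l) (width l))) (length (contents a (off r) (width r)))"
  defines "nl \<equiv> length (contents a (off l) (width l))" and "nr \<equiv> length (contents a (off r) (width r))"
  shows "expect_le (rebuild (Node lo len k c D l r) (a, cost)) (outlay ys)
    (real cost + real (nl + nr) + 2 * \<alpha> * real c
      + future len k (map (\<lambda>y. \<not> goes_left a l y) ys) c 0 (Some (left_width len k c D)) nl nr)"
proof -
  define wl where "wl = left_width len k c D"
  define xs where "xs = contents a (off l) (width l)"
  define zs where "zs = contents a (off r) (width r)"
  define g where "g = goes_left a l"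
  define yl where "yl = filter g (take (window len k) ys)"
  define yr where "yr = filter (\<lambda>y. \<not> g y) (take (window len k) ys)"
  define N where "N = 2 * \<alpha> * real c + future len k (map (\<lambda>y. \<not> g y) ys) c 0 None nl nr"
  note lens = node_size_min[OF size]
  have len: "length xs = nl" "length zs = nr" by (simp_all add: xs_def zs_def nl_def nr_def)
  have N: "N \<ge> 0" unfolding N_def using future_nonneg \<alpha>_large by simp
  have wl: "wl \<le> len" "\<bar>real wl - real len / 2\<bar> \<le> real len / \<beta> + 1"
    unfolding wl_def left_width_def using left_floor[OF D, of "c div window len k"] lens by auto
  have hv: "halves lo len l' r'" if "off l' = lo" "width l' = wl" "off r' = lo + wl" "width r' = len - wl" for l' r'
    using that wl by (simp add: halves_def)
  note cap = child_capacity[OF size hv bal less_imp_le[OF c], of "Leaf lo wl 0" "Leaf (lo + wl) (len - wl) 0", simplified,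
      folded nl_def nr_def]
  have d: "real (length xs) \<le> 17 / 20 * real wl" "real (length zs) \<le> 17 / 20 * real (len - wl)"
    unfolding len using cap by linarith+
  have reb: "rebuild (Node lo len k c D l r) (a, cost) = create_subtree lo wl xs (a, cost) \<bind>
      (\<lambda>(l', \<sigma>). create_subtree (lo + wl) (len - wl) zs \<sigma> \<bind> (\<lambda>(r', \<sigma>'). return_pmf (Node lo len k c 0 l' r', \<sigma>')))"
    by (simp add: rebuild_def Let_def wl_def left_width_def xs_def zs_def)
  have fut: "future len k (map (\<lambda>y. \<not> g y) ys) c 0 (Some wl) nl nr
      = future len k (map (\<lambda>y. \<not> g y) ys) c 0 None nl nr + charges wl nl (length yl) + charges (len - wl) nr (length yr)"
    using future_Some[OF _ k c, where D = 0 and wl = wl and nl = nl and nr = nr and bs = "map (\<lambda>y. \<not> g y) ys"] lens dvd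
    by (simp add: length_directions yl_def yr_def dvd_imp_mod_0)
  let ?K = "N + real nr + charges (len - wl) nr (length yr)"
  have K: "?K \<ge> 0" using N charges_nonneg by (intro add_nonneg_nonneg) auto
  have "expect_le (create_subtree lo wl xs (a, cost)) (\<lambda>z. ?K + (case z of (l', (a1, c1)) \<Rightarrow> real c1 + budget l' a1 yl))
      (?K + (real cost + real (length xs) + charges wl (length xs) (length yl)))"
    using create_subtree_expect[OF d(1) cap(3,5)] K charges_nonneg
    by (intro expect_le_add_const) (auto intro!: add_nonneg_nonneg)
  then have "expect_le (create_subtree lo wl xs (a, cost)) (\<lambda>z. ?K + (case z of (l', (a1, c1)) \<Rightarrow> real c1 + budget l' a1 yl))
      (real cost + real (nl + nr) + 2 * \<alpha> * real c + future len k (map (\<lambda>y. \<not> g y) ys) c 0 (Some wl) nl nr)"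
    by (simp add: fut N_def len algebra_simps)
  then show ?thesis unfolding reb g_def[symmetric] wl_def[symmetric]
  proof (rule expect_le_bind)
    fix z assume "z \<in> set_pmf (create_subtree lo wl xs (a, cost))"
    moreover obtain l' a1 c1 where z: "z = (l', (a1, c1))" by (metis surj_pair)
    ultimately have 1: "(l', (a1, c1)) \<in> set_pmf (create_subtree lo wl xs (a, cost))" by simp
    note L = create_subtree_support[OF 1 d(1) cap(3,5)]
    let ?M = "N + budget l' a1 yl"
    have "expect_le (create_subtree (lo + wl) (len - wl) zs (a1, c1)) (\<lambda>z. ?M + (case z of (r', (a2, c2)) \<Rightarrow> real c2 + budget r' a2 yr))
        (?M + (real c1 + real (length zs) + charges (len - wl) (length zs) (length yr)))"
      using create_subtree_expect[OF d(2) cap(4,6)] N budget_nonneg charges_nonneg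
      by (intro expect_le_add_const) (auto intro!: add_nonneg_nonneg)
    then have "expect_le (create_subtree (lo + wl) (len - wl) zs (a1, c1)) (\<lambda>z. ?M + (case z of (r', (a2, c2)) \<Rightarrow> real c2 + budget r' a2 yr))
        (?K + (case z of (l', (a1, c1)) \<Rightarrow> real c1 + budget l' a1 yl))"
      by (simp add: z len algebra_simps)
    then show "expect_le ((\<lambda>(l', \<sigma>). create_subtree (lo + wl) (len - wl) zs \<sigma> \<bind> (\<lambda>(r', \<sigma>'). return_pmf (Node lo len k c 0 l' r', \<sigma>'))) z)
        (outlay ys) (?K + (case z of (l', (a1, c1)) \<Rightarrow> real c1 + budget l' a1 yl))"
      unfolding z prod.case
    proof (rule expect_le_bind)
      fix z' assume "z' \<in> set_pmf (create_subtree (lo + wl) (len - wl) zs (a1, c1))"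
      moreover obtain r' a2 c2 where z': "z' = (r', (a2, c2))" by (metis surj_pair)
      ultimately have 2: "(r', (a2, c2)) \<in> set_pmf (create_subtree (lo + wl) (len - wl) zs (a1, c1))" by simp
      note R = create_subtree_support[OF 2 d(2) cap(4,6)]
      have same: "a2 i = a1 i" if "lo \<le> i" "i < lo + wl" for i using R(7)[of i] that by simp
      have cl: "contents a2 lo wl = xs" using L(6) contents_cong[OF same, of lo wl] by simp
      have bl: "budget l' a2 vs = budget l' a1 vs" for vs using region_cong[OF L(3), of a2] same L(4,5) by simp
      \<comment> \<open>The left child keeps its elements, so all later directions survive the
        rebuild although the widths change.\<close>
      have gl: "goes_left a2 l' = g"
        by (rule ext) (simp add: goes_left_def g_def L(4,5) cl xs_def)
      have "budget (Node lo len k c 0 l' r') a2 ys = N + budget l' a1 yl + budget r' a2 yr"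
        using dvd by (simp add: gl bl L(4,5) R(4,5,6) cl len N_def yl_def yr_def dvd_imp_mod_0)
      then show "expect_le (case z' of (r', \<sigma>') \<Rightarrow> return_pmf (Node lo len k c 0 l' r', \<sigma>')) (outlay ys)
          (?M + (case z' of (r', (a2, c2)) \<Rightarrow> real c2 + budget r' a2 yr))"
        unfolding z' prod.case by (intro expect_le_return) simp
    qed
  qed
qed

text \<open>The cases differ in the savings that are spent: those of the lifetime on a reset, those
  of the window on a rebuild, none otherwise.\<close>

lemma finish_node:
  fixes a :: "'a::linorder slots" and ys :: "'a list" and cost :: nat
  assumes size: "node_size len" and k: "k \<le> k_max" and c: "c < lifetime len"
    and D: "\<bar>D\<bar> \<le> int (Suc (c mod window len k))" and halves: "halves lo len l r"
    and bal: "balanced len (Suc c) (length (contents a (off l) (width l))) (length (contents a (off r) (width r)))"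
    and sound: "sound l a" "sound r a"
    and dens: "real (length (contents a lo len)) \<le> 17 / 20 * real len"
  defines "nl \<equiv> length (contents a (off l) (width l))" and "nr \<equiv> length (contents a (off r) (width r))"
    and "q \<equiv> window len k - Suc (c mod window len k)"
  defines "M \<equiv> finish_insertion (Node lo len k (Suc c) D l r) (a, cost)"
  shows "\<forall>(t, (a', c')) \<in> set_pmf M. updated lo len (contents a lo len) a t a'"
    and "expect_le M (outlay ys)
      (real cost + 2 * \<alpha> * real (Suc c) + 2 * \<alpha> * 2 ^ k * real (Suc (c mod window len k))
       + budget l a (filter (goes_left a l) (take q ys)) + budget r a (filter (\<lambda>y. \<not> goes_left a l y) (take q ys))
       + resume len k (map (\<lambda>y. \<not> goes_left a l y) ys) (Suc c) D None nl nr)"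
proof -
  let ?w = "window len k"
  let ?bs = "map (\<lambda>y. \<not> goes_left a l y) ys"
  let ?V = "real cost + 2 * \<alpha> * real (Suc c) + 2 * \<alpha> * 2 ^ k * real (Suc (c mod ?w))
    + budget l a (filter (goes_left a l) (take q ys)) + budget r a (filter (\<lambda>y. \<not> goes_left a l y) (take q ys))
    + resume len k ?bs (Suc c) D None nl nr"
  note lens = node_size_min[OF size]
  have w: "?w > 0" using window_pos lens by blast
  have mod: "c mod ?w < ?w" using w by simp
  have cnt: "length (contents a lo len) = nl + nr"
    using contents_halves[OF halves, of a] by (simp add: nl_def nr_def)
  have mle: "min_len \<le> real len" "len \<le> m" using lens size by (auto simp: node_size_def)
  have nn: "0 \<le> budget l a (filter (goes_left a l) (take q ys))"
    "0 \<le> budget r a (filter (\<lambda>y. \<not> goes_left a l y) (take q ys))" by (rule budget_nonneg)+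
  consider (reset) "Suc c = lifetime len" | (rebuild) "Suc c < lifetime len" "?w dvd Suc c"
    | (idle) "Suc c < lifetime len" "\<not> ?w dvd Suc c" using c by linarith
  then have "(\<forall>(t, (a', c')) \<in> set_pmf M. updated lo len (contents a lo len) a t a') \<and>
    expect_le M (outlay ys) ?V"
  proof cases
    case reset
    then have M: "M = create_subtree lo len (contents a lo len) (a, cost)"
      by (simp add: M_def finish_insertion_def reset_def)
    have "real (nl + nr) \<le> 2 * \<alpha> * real (Suc c)"
      using dens lifetime_pays[of len] size reset unfolding cnt by (simp del: of_nat_Suc)
    moreover have "0 \<le> 2 * \<alpha> * 2 ^ k * real (Suc (c mod ?w))" using \<alpha>_large by (intro mult_nonneg_nonneg) auto
    ultimately have "real cost + real (length (contents a lo len)) + charges len (length (contents a lo len)) (length ys) \<le> ?V"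
      using nn reset unfolding cnt by (simp add: resume_def)
    with create_subtree_expect[OF dens mle, of lo a cost ys] have "expect_le M (outlay ys) ?V"
      unfolding M by (rule expect_le_weaken)
    moreover have "updated lo len (contents a lo len) a t a'" if "(t, (a', c')) \<in> set_pmf M" for t a' c'
      using create_subtree_support[OF that[unfolded M] dens mle] by blast
    ultimately show ?thesis by blast
  next
    case rebuild
    then have M: "M = rebuild (Node lo len k (Suc c) D l r) (a, cost)"
      by (simp add: M_def finish_insertion_def)
    have D': "\<bar>D\<bar> \<le> int ?w" using D mod by linarith
    have "real len \<le> 2 * \<alpha> * 2 ^ k * real (Suc (c mod ?w))"
      using window_pays[OF size k] mod_Suc_dvd(1)[OF w rebuild(2)] w by simp
    then have "real (nl + nr) \<le> 2 * \<alpha> * 2 ^ k * real (Suc (c mod ?w))" using dens unfolding cnt by linarith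
    then have "real cost + real (nl + nr) + 2 * \<alpha> * real (Suc c)
      + future len k ?bs (Suc c) 0 (Some (left_width len k (Suc c) D)) nl nr \<le> ?V"
      using nn rebuild by (simp add: resume_def)
    with rebuild_expect[OF size k rebuild D' halves bal, of cost ys, folded nl_def nr_def]
    have "expect_le M (outlay ys) ?V"
      unfolding M by (rule expect_le_weaken)
    moreover have "updated lo len (contents a lo len) a t a'" if "(t, (a', c')) \<in> set_pmf M" for t a' c'
      using rebuild_support[OF that[unfolded M] size k rebuild D' halves bal] by blast
    ultimately show ?thesis by blast
  next
    case idle
    then have M: "M = return_pmf (Node lo len k (Suc c) D l r, (a, cost))"
      by (simp add: M_def finish_insertion_def)
    note md = mod_Suc_not_dvd[OF w idle(2)]
    have s: "sound (Node lo len k (Suc c) D l r) a"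
      using size k idle halves D bal sound md by simp
    have "budget (Node lo len k (Suc c) D l r) a ys = 2 * \<alpha> * real (Suc c) + 2 * \<alpha> * 2 ^ k * real (Suc (c mod ?w))
       + budget l a (filter (goes_left a l) (take q ys)) + budget r a (filter (\<lambda>y. \<not> goes_left a l y) (take q ys))
       + resume len k ?bs (Suc c) D None nl nr"
      using idle by (simp add: md(1) q_def resume_def nl_def nr_def)
    then show ?thesis unfolding M using s by (auto intro: expect_le_return)
  qed
  then show "\<forall>(t, (a', c')) \<in> set_pmf M. updated lo len (contents a lo len) a t a'"
    "expect_le M (outlay ys) ?V" by blast+
qed

text \<open>Short leaves have (log len)^2 \<le> log n. In dense ones exp (\<mu> s / len) cancels the
  prefactor exp (- 3/4 \<mu>), which leaves 2000 (log n)^2.\<close>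

lemma leaf_charge:
  assumes "min_len \<le> real len" "len \<le> m" "3 * len < 4 * s \<or> real len \<le> 2 powr sqrt lg"
  shows "ikr_cost len + 2 * \<alpha> \<le> charge len (real s)"
proof -
  let ?l = "log 2 (real len)"
  have len: "real len > 0" using assms(1) min_len_ge(2) by linarith
  have l0: "?l \<ge> 0" using assms(1) min_len_ge(2) by simp
  define y where "y = depth len"
  have y: "y \<ge> 0" unfolding y_def by (rule depth_nonneg)
  have e: "exp (y / lg) \<ge> 1" using y lg_ge by simp
  have Q: "2 * \<alpha> * (real k_max + 2) * y \<ge> 0" using y \<alpha>_large by simp
  define X where "X = 2000 * lg\<^sup>2 * exp (y / lg) * exp (- 3 / 4 * \<mu>) * (exp (\<mu> * real s / real len) + y * exp (\<mu> / 3))"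
  have X: "X \<ge> 0" using y by (simp add: X_def)
  have charge: "charge len (real s) = 2 * \<alpha> + 400 * lg + 2 * \<alpha> * (real k_max + 2) * y + X"
    by (simp add: charge_def X_def y_def)
  show ?thesis
  proof (cases "real len \<le> 2 powr sqrt lg")
    case True
    then have "?l \<le> sqrt lg" using len by (simp add: log_le_iff)
    then have "?l\<^sup>2 \<le> (sqrt lg)\<^sup>2" using l0 by (rule power_mono)
    then have "?l\<^sup>2 \<le> lg" using lg_ge by simp
    then show ?thesis using Q X unfolding charge ikr_cost_def by linarith
  next
    case False
    then have s: "3 * real len \<le> 4 * real s" using assms(3) by linarith
    have "real len \<le> 2 * n" using assms(2) by (simp add: n_def)
    then have "?l \<le> log 2 (2 * n)" using len by (subst log_le_cancel_iff) auto
    also have "\<dots> = 1 + lg"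
    proof -
      have "n > 0" using len assms(2) by (simp add: n_def)
      then show ?thesis by (simp add: log_mult)
    qed
    also have "\<dots> \<le> 2 * lg" using lg_ge by simp
    finally have "?l\<^sup>2 \<le> (2 * lg)\<^sup>2" using l0 by (rule power_mono)
    then have "?l\<^sup>2 \<le> 4 * lg\<^sup>2" by (simp add: power_mult_distrib)
    then have l: "400 * ?l\<^sup>2 \<le> 2000 * lg\<^sup>2" using zero_le_power2[of lg] by linarith
    have "3 / 4 \<le> real s / real len" using s len by (simp add: field_simps)
    then have "\<mu> * (3 / 4) \<le> \<mu> * (real s / real len)" using \<mu>_bounds by (intro mult_left_mono) auto
    then have "exp (\<mu> * (3 / 4)) \<le> exp (\<mu> * real s / real len)" by simp
    moreover have "y * exp (\<mu> / 3) \<ge> 0" using y by simp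
    ultimately have "exp (\<mu> * (3 / 4)) \<le> exp (\<mu> * real s / real len) + y * exp (\<mu> / 3)" by linarith
    then have "exp (- 3 / 4 * \<mu>) * exp (\<mu> * (3 / 4)) \<le> exp (- 3 / 4 * \<mu>) * (exp (\<mu> * real s / real len) + y * exp (\<mu> / 3))"
      by (intro mult_left_mono) auto
    then have "1 \<le> exp (- 3 / 4 * \<mu>) * (exp (\<mu> * real s / real len) + y * exp (\<mu> / 3))"
      by (simp flip: exp_add)
    then have "2000 * lg\<^sup>2 * 1 * 1 \<le> 2000 * lg\<^sup>2 * exp (y / lg) * (exp (- 3 / 4 * \<mu>) * (exp (\<mu> * real s / real len) + y * exp (\<mu> / 3)))"
      using e by (intro mult_mono) auto
    then have "2000 * lg\<^sup>2 \<le> X" by (simp add: X_def mult.assoc)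
    then show ?thesis using l Q lg_ge unfolding charge ikr_cost_def by linarith
  qed
qed

text \<open>The claim holds for every continuation \<open>ys\<close>, so the induction hypothesis
  can be applied to the sublist that reaches a child before its parent's window ends.\<close>

lemma process_spec:
  fixes a :: "'a::linorder slots" and x :: 'a
  assumes "sound t a" and "sorted_wrt (<) (contents a (off t) (width t))" and "x \<notin> set (contents a (off t) (width t))"
    and "real (length (contents a (off t) (width t))) + 1 \<le> 17 / 20 * real (width t)"
  shows "(\<forall>(t', (a', c')) \<in> set_pmf (process x t (a, cost)). sound t' a' \<and> off t' = off t \<and> width t' = width t
      \<and> contents a' (off t) (width t) = insort x (contents a (off t) (width t))
      \<and> (\<forall>i. i < off t \<or> off t + width t \<le> i \<longrightarrow> a' i = a i))
    \<and> (\<forall>ys. expect_le (process x t (a, cost)) (outlay ys) (real cost + budget t a (x # ys)))"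
  using assms
proof (induction t arbitrary: a cost)
  case (Leaf lo len c)
  have len: "min_len \<le> real len" "len \<le> m" and type: "3 * len < 4 * length (contents a lo len) \<or> real len \<le> 2 powr sqrt lg"
    using Leaf.prems(1) by simp_all
  interpret ikr_region len by (rule ikr_region_of_min_len) fact
  obtain a1 c1 where ins: "ikr_insert lo len x (a, cost) = (a1, c1)" by fastforce
  have prems: "sorted_wrt (<) (contents a lo len)" "x \<notin> set (contents a lo len)"
    "real (length (contents a lo len)) + 1 \<le> 17 / 20 * real len" using Leaf.prems by simp_all
  note cont = insert_contents[OF prems ins] and cost = insert_cost[OF prems ins] and out = outside_region[OF prems ins]
  have cnt: "length (contents a1 lo len) = Suc (length (contents a lo len))" by (simp add: cont)
  have dens: "real (length (contents a1 lo len)) \<le> 17 / 20 * real len" unfolding cnt using prems(3) by simp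
  have charge: "charges len (length (contents a lo len)) (length (x # ys))
      \<ge> ikr_cost len + 2 * \<alpha> + charges len (length (contents a1 lo len)) (length ys)" for ys :: "'a list"
    using leaf_charge[OF len type] by (simp add: charges_Suc cnt)
  define M where "M = process x (Leaf lo len c) (a, cost)"
  have M: "M = finish_insertion (Leaf lo len (Suc c)) (a1, c1)" by (simp add: M_def ins)
  have "(\<forall>(t', (a', c')) \<in> set_pmf M. updated lo len (contents a1 lo len) a1 t' a')
    \<and> (\<forall>ys. expect_le M (outlay ys) (real cost + budget (Leaf lo len c) a (x # ys)))"
  proof (cases "Suc c = lifetime len")
    case True
    then have M': "M = create_subtree lo len (contents a1 lo len) (a1, c1)"
      by (simp add: M finish_insertion_def reset_def)
    have "real (length (contents a1 lo len)) \<le> 2 * \<alpha> * real (Suc c)"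
      using dens lifetime_pays[of len] len True by (simp del: of_nat_Suc)
    then have "real c1 + real (length (contents a1 lo len)) + charges len (length (contents a1 lo len)) (length ys)
        \<le> real cost + budget (Leaf lo len c) a (x # ys)" for ys
      using cost charge[of ys] ikr_potential_nonneg[of a1 lo len] by (simp add: algebra_simps)
    then have "expect_le M (outlay ys) (real cost + budget (Leaf lo len c) a (x # ys))" for ys
      using create_subtree_expect[OF dens len, of lo a1 c1 ys] unfolding M' by (elim expect_le_mono) auto
    moreover have "updated lo len (contents a1 lo len) a1 t' a'"
      if "(t', (a', c')) \<in> set_pmf M" for t' a' c'
      using create_subtree_support[OF that[unfolded M'] dens len] by blast
    ultimately show ?thesis by blast
  next
    case False
    then have M': "M = return_pmf (Leaf lo len (Suc c), (a1, c1))"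
      by (simp add: M finish_insertion_def)
    have "sound (Leaf lo len (Suc c)) a1" using len type by (auto simp: cnt)
    moreover have "real c1 + budget (Leaf lo len (Suc c)) a1 ys \<le> real cost + budget (Leaf lo len c) a (x # ys)" for ys
      using cost charge[of ys] by (simp add: algebra_simps)
    ultimately show ?thesis unfolding M' by (auto intro: expect_le_return)
  qed
  then show ?case unfolding M_def[symmetric] using cont out by (fastforce simp del: process.simps)
next
  case (Node lo len k c D l r)
  define q where "q = window len k - Suc (c mod window len k)"
  let ?L = "contents a (off l) (width l)" and ?R = "contents a (off r) (width r)"
  let ?w = "window len k"
  have size: "node_size len" and k: "k \<le> k_max" and c: "c < lifetime len" and halves: "halves lo len l r"
    and D: "\<bar>D\<bar> \<le> int (c mod ?w)" and bal: "balanced len c (length ?L) (length ?R)"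
    and sl: "sound l a" and sr: "sound r a"
    using Node.prems(1) by simp_all
  have h: "off l = lo" "off r = lo + width l" "width l + width r = len" using halves by (simp_all add: halves_def)
  have w: "?w > 0" using window_pos node_size_min[OF size] by blast
  then have "c mod ?w < ?w" by simp
  then have q: "?w - c mod ?w = Suc q" by (simp add: q_def)
  have cont: "contents a lo len = ?L @ ?R" by (rule contents_halves) fact
  have prems: "sorted_wrt (<) (?L @ ?R)" "x \<notin> set (?L @ ?R)" "real (length (?L @ ?R)) + 1 \<le> 17 / 20 * real len"
    using Node.prems(2-4) cont by simp_all
  have sorted: "sorted_wrt (<) ?L" "sorted_wrt (<) ?R" using prems(1) by (simp_all add: sorted_wrt_append)
  have new: "x \<notin> set ?L" "x \<notin> set ?R" using prems(2) by simp_all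
  note cap = child_capacity[OF size halves bal less_imp_le[OF c]]
  obtain s where s: "length ?L + length ?R = s + c" "4 * s \<le> 3 * len"
    and diff: "\<bar>real (length ?R) - real (length ?L)\<bar> \<le> 4 + real c" using bal by (auto simp: balanced_def)
  define P where "P = 2 * \<alpha> * real (Suc c) + 2 * \<alpha> * 2 ^ k * real (Suc (c mod ?w))"
  have P: "P \<ge> 0" "2 * \<alpha> * real c + 2 * \<alpha> * 2 ^ k * real (c mod ?w) + node_charge k = P"
    using \<alpha>_large by (simp_all add: P_def node_charge_def algebra_simps)
  show ?case
  proof (cases "goes_left a l x")
    case True
    have step: "process x (Node lo len k c D l r) (a, cost) =
        process x l (a, cost) \<bind> (\<lambda>(l', \<sigma>). finish_insertion (Node lo len k (Suc c) (D - 1) l' r) \<sigma>)"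
      using True by simp
    note IH = Node.IH(1)[OF sl sorted(1) new(1) cap(1), of cost]
    have Lne: "?L \<noteq> []" "x < Max (set ?L)" using True by (auto simp: goes_left_def Let_def)
    have ins: "insort x (?L @ ?R) = insort x ?L @ ?R" using prems(1) Lne by (rule sorted_insort_append_left)
    have F: "(\<forall>(t', (a', c')) \<in> set_pmf (finish_insertion (Node lo len k (Suc c) (D - 1) l' r) (a1, c1)).
        updated lo len (insort x (contents a lo len)) a t' a')
      \<and> (\<forall>ys. expect_le (finish_insertion (Node lo len k (Suc c) (D - 1) l' r) (a1, c1)) (outlay ys)
        (real c1 + budget l' a1 (filter (goes_left a l) (take q ys)) + (P + budget r a (filter (\<lambda>y. \<not> goes_left a l y) (take q ys))
         + resume len k (map (\<lambda>y. \<not> goes_left a l y) ys) (Suc c) (D - 1) None (Suc (length ?L)) (length ?R))))"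
      if res: "(l', (a1, c1)) \<in> set_pmf (process x l (a, cost))" for l' a1 c1
    proof -
      have l': "sound l' a1" "off l' = off l" "width l' = width l" "contents a1 (off l) (width l) = insort x ?L"
        using IH res by blast+
      have out: "a1 i = a i" if "i < off l \<or> off l + width l \<le> i" for i
        using IH res that by blast
      have ar: "a1 i = a i" if "off r \<le> i" for i using out[of i] that h by simp
      have cr: "contents a1 (off r) (width r) = ?R" using ar by (intro contents_cong) auto
      note rc = region_cong[OF sr, of a1, OF ar]
      have cL: "contents a1 (off l') (width l') = insort x ?L" using l' by simp
      have hv: "halves lo len l' r" using halves l' by (simp add: halves_def)
      \<comment> \<open>\<open>x\<close> lies below the maximum of the left child, which therefore
        stays the same; this keeps the future directions fixed.\<close>
      have gl: "goes_left a1 l' = goes_left a l"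
      proof
        fix y
        have "Max (insert x (set ?L)) = max x (Max (set ?L))" using Lne by (intro Max_insert) auto
        then have "Max (insert x (set ?L)) = Max (set ?L)" using Lne(2) by (simp add: max_def less_imp_le)
        then show "goes_left a1 l' y = goes_left a l y"
          using Lne(1) by (simp add: goes_left_def Let_def cL set_insort_key)
      qed
      have ca: "contents a1 lo len = insort x (contents a lo len)"
        using contents_halves[OF hv, of a1] cL cr ins cont by simp
      have bal': "balanced len (Suc c) (length (contents a1 (off l') (width l'))) (length (contents a1 (off r) (width r)))"
        unfolding cL cr balanced_def using s diff by (intro conjI exI[of _ s]) auto
      have D': "\<bar>D - 1\<bar> \<le> int (Suc (c mod ?w))" using D by linarith
      have dens: "real (length (contents a1 lo len)) \<le> 17 / 20 * real len"
        unfolding ca using prems(3) cont by simp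
      have out': "a1 i = a i" if "i < lo \<or> lo + len \<le> i" for i using out[of i] that h by auto
      note fin = finish_node[OF size k c D' hv bal' l'(1) _ dens, of c1]
      have sr': "sound r a1" using rc by simp
      show ?thesis
      proof (intro conjI allI)
        show "\<forall>(t', (a', c')) \<in> set_pmf (finish_insertion (Node lo len k (Suc c) (D - 1) l' r) (a1, c1)).
          updated lo len (insort x (contents a lo len)) a t' a'"
          using fin(1)[OF sr'] ca out' by fastforce
        show "expect_le (finish_insertion (Node lo len k (Suc c) (D - 1) l' r) (a1, c1)) (outlay ys)
        (real c1 + budget l' a1 (filter (goes_left a l) (take q ys)) + (P + budget r a (filter (\<lambda>y. \<not> goes_left a l y) (take q ys))
         + resume len k (map (\<lambda>y. \<not> goes_left a l y) ys) (Suc c) (D - 1) None (Suc (length ?L)) (length ?R)))" for ys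
          using fin(2)[OF sr', of ys] rc by (simp add: gl cL cr q_def P_def add_ac)
      qed
    qed
    have "expect_le (process x (Node lo len k c D l r) (a, cost)) (outlay ys)
        (real cost + budget (Node lo len k c D l r) a (x # ys))" for ys
    proof -
      let ?C = "P + budget r a (filter (\<lambda>y. \<not> goes_left a l y) (take q ys))
         + resume len k (map (\<lambda>y. \<not> goes_left a l y) ys) (Suc c) (D - 1) None (Suc (length ?L)) (length ?R)"
      let ?zs = "filter (goes_left a l) (take q ys)"
      have "expect_le (process x l (a, cost)) (\<lambda>z. ?C + (case z of (l', (a1, c1)) \<Rightarrow> real c1 + budget l' a1 ?zs))
          (?C + (real cost + budget l a (x # ?zs)))"
        using IH P(1) budget_nonneg resume_nonneg by (intro expect_le_add_const) (auto intro!: add_nonneg_nonneg)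
      \<comment> \<open>The head \<open>x\<close> enters the list of the left child and contributes
        one \<open>node_charge\<close>, which raises the savings of the node to
        \<open>P\<close>.\<close>
      moreover have "?C + (real cost + budget l a (x # ?zs)) = real cost + budget (Node lo len k c D l r) a (x # ys)"
        using True by (simp add: q future_Cons P(2)[symmetric])
      ultimately have "expect_le (process x l (a, cost)) (\<lambda>z. ?C + (case z of (l', (a1, c1)) \<Rightarrow> real c1 + budget l' a1 ?zs))
          (real cost + budget (Node lo len k c D l r) a (x # ys))" by simp
      then show ?thesis unfolding step
      proof (rule expect_le_bind)
        fix z assume "z \<in> set_pmf (process x l (a, cost))"
        moreover obtain l' a1 c1 where z: "z = (l', (a1, c1))" by (metis surj_pair)
        ultimately have "(l', (a1, c1)) \<in> set_pmf (process x l (a, cost))" by simp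
        from F[OF this] show "expect_le ((\<lambda>(l', \<sigma>). finish_insertion (Node lo len k (Suc c) (D - 1) l' r) \<sigma>) z)
            (outlay ys) (?C + (case z of (l', (a1, c1)) \<Rightarrow> real c1 + budget l' a1 ?zs))"
          unfolding z prod.case by (simp add: add_ac)
      qed
    qed
    moreover have "updated lo len (insort x (contents a lo len)) a t' a'"
      if "(t', (a', c')) \<in> set_pmf (process x (Node lo len k c D l r) (a, cost))" for t' a' c'
    proof -
      from that obtain l' a1 c1 where "(l', (a1, c1)) \<in> set_pmf (process x l (a, cost))"
        "(t', (a', c')) \<in> set_pmf (finish_insertion (Node lo len k (Suc c) (D - 1) l' r) (a1, c1))"
        unfolding step by (auto simp: split_beta)
      with F show ?thesis by blast
    qed
    ultimately show ?thesis by (simp only: subproblem.sel) blast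
  next
    case False
    have step: "process x (Node lo len k c D l r) (a, cost) =
        process x r (a, cost) \<bind> (\<lambda>(r', \<sigma>). finish_insertion (Node lo len k (Suc c) (D + 1) l r') \<sigma>)"
      using False by simp
    note IH = Node.IH(2)[OF sr sorted(2) new(2) cap(2), of cost]
    \<comment> \<open>Vacuous for an empty left child, to which nothing is ever sent.\<close>
    have "\<forall>z\<in>set ?L. z < x"
    proof
      fix z assume z: "z \<in> set ?L"
      then have "\<not> x < Max (set ?L)" using False by (auto simp: goes_left_def Let_def)
      moreover have "z \<le> Max (set ?L)" using z by simp
      moreover have "z \<noteq> x" using z new by auto
      ultimately show "z < x" by simp
    qed
    then have ins: "insort x (?L @ ?R) = ?L @ insort x ?R" by (rule insort_append_right)
    have F: "(\<forall>(t', (a', c')) \<in> set_pmf (finish_insertion (Node lo len k (Suc c) (D + 1) l r') (a1, c1)).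
        updated lo len (insort x (contents a lo len)) a t' a')
      \<and> (\<forall>ys. expect_le (finish_insertion (Node lo len k (Suc c) (D + 1) l r') (a1, c1)) (outlay ys)
        (real c1 + budget r' a1 (filter (\<lambda>y. \<not> goes_left a l y) (take q ys)) + (P + budget l a (filter (goes_left a l) (take q ys))
         + resume len k (map (\<lambda>y. \<not> goes_left a l y) ys) (Suc c) (D + 1) None (length ?L) (Suc (length ?R)))))"
      if res: "(r', (a1, c1)) \<in> set_pmf (process x r (a, cost))" for r' a1 c1
    proof -
      have r': "sound r' a1" "off r' = off r" "width r' = width r" "contents a1 (off r) (width r) = insort x ?R"
        using IH res by blast+
      have out: "a1 i = a i" if "i < off r \<or> off r + width r \<le> i" for i
        using IH res that by blast
      have al: "a1 i = a i" if "i < off l + width l" for i using out[of i] that h by simp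
      have cl: "contents a1 (off l) (width l) = ?L" using al by (intro contents_cong) auto
      note lc = region_cong[OF sl, of a1, OF al]
      have cR: "contents a1 (off r') (width r') = insort x ?R" using r' by simp
      have hv: "halves lo len l r'" using halves r' by (simp add: halves_def)
      have gl: "goes_left a1 l = goes_left a l" using cl by (rule goes_left_cong)
      have ca: "contents a1 lo len = insort x (contents a lo len)"
        using contents_halves[OF hv, of a1] cR cl ins cont by simp
      have bal': "balanced len (Suc c) (length (contents a1 (off l) (width l))) (length (contents a1 (off r') (width r')))"
        unfolding cR cl balanced_def using s diff by (intro conjI exI[of _ s]) auto
      have D': "\<bar>D + 1\<bar> \<le> int (Suc (c mod ?w))" using D by linarith
      have dens: "real (length (contents a1 lo len)) \<le> 17 / 20 * real len"
        unfolding ca using prems(3) cont by simp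
      have out': "a1 i = a i" if "i < lo \<or> lo + len \<le> i" for i using out[of i] that h by auto
      note fin = finish_node[OF size k c D' hv bal' _ r'(1) dens, of c1]
      have sl': "sound l a1" using lc by simp
      show ?thesis
      proof (intro conjI allI)
        show "\<forall>(t', (a', c')) \<in> set_pmf (finish_insertion (Node lo len k (Suc c) (D + 1) l r') (a1, c1)).
          updated lo len (insort x (contents a lo len)) a t' a'"
          using fin(1)[OF sl'] ca out' by fastforce
        show "expect_le (finish_insertion (Node lo len k (Suc c) (D + 1) l r') (a1, c1)) (outlay ys)
        (real c1 + budget r' a1 (filter (\<lambda>y. \<not> goes_left a l y) (take q ys)) + (P + budget l a (filter (goes_left a l) (take q ys))
         + resume len k (map (\<lambda>y. \<not> goes_left a l y) ys) (Suc c) (D + 1) None (length ?L) (Suc (length ?R))))" for ys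
          using fin(2)[OF sl', of ys] lc by (simp add: gl cR cl q_def P_def add_ac)
      qed
    qed
    have "expect_le (process x (Node lo len k c D l r) (a, cost)) (outlay ys)
        (real cost + budget (Node lo len k c D l r) a (x # ys))" for ys
    proof -
      let ?C = "P + budget l a (filter (goes_left a l) (take q ys))
         + resume len k (map (\<lambda>y. \<not> goes_left a l y) ys) (Suc c) (D + 1) None (length ?L) (Suc (length ?R))"
      let ?zs = "filter (\<lambda>y. \<not> goes_left a l y) (take q ys)"
      have "expect_le (process x r (a, cost)) (\<lambda>z. ?C + (case z of (r', (a1, c1)) \<Rightarrow> real c1 + budget r' a1 ?zs))
          (?C + (real cost + budget r a (x # ?zs)))"
        using IH P(1) budget_nonneg resume_nonneg by (intro expect_le_add_const) (auto intro!: add_nonneg_nonneg)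
      moreover have "?C + (real cost + budget r a (x # ?zs)) = real cost + budget (Node lo len k c D l r) a (x # ys)"
        using False by (simp add: q future_Cons P(2)[symmetric])
      ultimately have "expect_le (process x r (a, cost)) (\<lambda>z. ?C + (case z of (r', (a1, c1)) \<Rightarrow> real c1 + budget r' a1 ?zs))
          (real cost + budget (Node lo len k c D l r) a (x # ys))" by simp
      then show ?thesis unfolding step
      proof (rule expect_le_bind)
        fix z assume "z \<in> set_pmf (process x r (a, cost))"
        moreover obtain r' a1 c1 where z: "z = (r', (a1, c1))" by (metis surj_pair)
        ultimately have "(r', (a1, c1)) \<in> set_pmf (process x r (a, cost))" by simp
        from F[OF this] show "expect_le ((\<lambda>(r', \<sigma>). finish_insertion (Node lo len k (Suc c) (D + 1) l r') \<sigma>) z)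
            (outlay ys) (?C + (case z of (r', (a1, c1)) \<Rightarrow> real c1 + budget r' a1 ?zs))"
          unfolding z prod.case by (simp add: add_ac)
      qed
    qed
    moreover have "updated lo len (insort x (contents a lo len)) a t' a'"
      if "(t', (a', c')) \<in> set_pmf (process x (Node lo len k c D l r) (a, cost))" for t' a' c'
    proof -
      from that obtain r' a1 c1 where "(r', (a1, c1)) \<in> set_pmf (process x r (a, cost))"
        "(t', (a', c')) \<in> set_pmf (finish_insertion (Node lo len k (Suc c) (D + 1) l r') (a1, c1))"
        unfolding step by (auto simp: split_beta)
      with F show ?thesis by blast
    qed
    ultimately show ?thesis by (simp only: subproblem.sel) blast
  qed
qed

end

section \<open>The whole run\<close>

context see_saw_large
begin

lemma m_large: "min_len \<le> real m" "real m \<ge> 1000000"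
proof -
  have n: "n > 0"
  proof (rule ccontr)
    assume "\<not> n > 0"
    then have "n = 0" unfolding n_def by simp
    then show False using lg_ge by (simp add: log_def)
  qed
  have "sqrt lg \<le> sqrt (lg\<^sup>2)" using lg_ge by (intro real_sqrt_le_mono) (simp add: power2_eq_square)
  then have "sqrt lg \<le> lg" using lg_ge by simp
  then have "2 powr sqrt lg \<le> 2 powr lg" by (intro powr_mono) auto
  also have "\<dots> = n" using n by simp
  finally show "min_len \<le> real m" using n unfolding min_len_def n_def by simp
  then show "real m \<ge> 1000000" using min_len_ge(2) by simp
qed

text \<open>The budget refers to insertions still to come, so the bound is stated for every
  continuation \<open>ys\<close>: the step for \<open>x\<close> turns the bound for
  \<open>x # ys\<close> into the one for \<open>ys\<close>.\<close>

lemma run_spec: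
  fixes S :: "'a::linorder set"
  assumes "finite S" "card S = m div 4" "length xs \<le> m div 4" "insertion_sequence S xs"
  shows "(\<forall>(t, (a, c)) \<in> set_pmf (run S xs). sound t a \<and> off t = 0 \<and> width t = m
      \<and> sorted_wrt (<) (contents a 0 m) \<and> set (contents a 0 m) = S \<union> set xs \<and> (\<forall>i\<ge>m. a i = None))
    \<and> (\<forall>ys. expect_le (run S xs) (outlay ys) (charges m (m div 4) (length xs + length ys)))"
  using assms(3,4)
proof (induction xs rule: rev_induct)
  case Nil
  let ?xs = "sorted_list_of_set S" and ?a = "spread 0 m (sorted_list_of_set S) (\<lambda>_. None)"
  have len: "length ?xs = m div 4" using assms by simp
  have le: "length ?xs \<le> m" unfolding len by simp
  have dens: "real (length ?xs) \<le> 17 / 20 * real m" unfolding len by linarith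
  have m0: "m > 0" using m_large by (cases m) auto
  have cont: "contents ?a 0 m = ?xs" using le by (rule contents_spread)
  have init: "run S [] = map_pmf (\<lambda>t. (t, (?a, 0))) (grow ?a 0 m)"
    by (simp add: run_def init_def create_subtree_def place_def Let_def map_pmf_comp)
  note grown = grow_spec[OF evenly_spread[OF le m0, of 0 "\<lambda>_. None"] m_large(1) order_refl, unfolded cont, OF dens]
  have "\<forall>i\<ge>m. ?a i = None" using spread_outside[of _ 0 m ?xs "\<lambda>_. None"] by auto
  moreover have "sorted_wrt (<) ?xs" by (rule strict_sorted_list_of_set)
  ultimately show ?case
    using grown assms(1) unfolding init by (auto simp: cont assms(2) intro!: expect_le_map)
next
  case (snoc x xs)
  have IH: "\<forall>(t, (a, c)) \<in> set_pmf (run S xs). sound t a \<and> off t = 0 \<and> width t = m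
      \<and> sorted_wrt (<) (contents a 0 m) \<and> set (contents a 0 m) = S \<union> set xs \<and> (\<forall>i\<ge>m. a i = None)"
    "expect_le (run S xs) (outlay ys) (charges m (m div 4) (length xs + length ys))" for ys
    using snoc by (auto simp: insertion_sequence_def)
  have run: "run S (xs @ [x]) = run S xs \<bind> (\<lambda>(t, \<sigma>). process x t \<sigma>)" by (simp add: run_def)
  have step: "(\<forall>(t', (a', c')) \<in> set_pmf (process x t (a, c)). sound t' a' \<and> off t' = 0 \<and> width t' = m
      \<and> contents a' 0 m = insort x (contents a 0 m) \<and> (\<forall>i. m \<le> i \<longrightarrow> a' i = a i))
    \<and> (\<forall>ys. expect_le (process x t (a, c)) (outlay ys) (real c + budget t a (x # ys)))
    \<and> sorted_wrt (<) (contents a 0 m) \<and> x \<notin> set (contents a 0 m)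
    \<and> set (contents a 0 m) = S \<union> set xs \<and> (\<forall>i\<ge>m. a i = None)"
    if "(t, (a, c)) \<in> set_pmf (run S xs)" for t a c
  proof -
    have st: "sound t a" "off t = 0" "width t = m" "sorted_wrt (<) (contents a 0 m)"
      "set (contents a 0 m) = S \<union> set xs" "\<forall>i\<ge>m. a i = None" using IH(1) that by blast+
    have new: "x \<notin> set (contents a 0 m)" using snoc.prems(2) by (auto simp: st(5) insertion_sequence_def)
    have "distinct (contents a 0 m)" using st(4) by (simp add: strict_sorted_iff)
    then have "length (contents a 0 m) = card (S \<union> set xs)" using st(5) by (metis distinct_card)
    also have "\<dots> \<le> m div 4 + length xs" using card_Un_le[of S "set xs"] card_length[of xs] assms by linarith
    \<comment> \<open>At most m div 4 initial elements and fewer than m div 4 earlier insertions: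
      even with \<open>x\<close> the array is at most half full.\<close>
    finally have "4 * (length (contents a 0 m) + 1) \<le> 2 * m" using snoc.prems(1) by simp
    then have "real (4 * (length (contents a 0 m) + 1)) \<le> real (2 * m)" by (simp only: of_nat_le_iff)
    then have "real (length (contents a 0 m)) + 1 \<le> 17 / 20 * real m" by simp
    from process_spec[of t a x c, unfolded st(2,3), OF st(1,4) new this] show ?thesis
      using st new by auto
  qed
  have A: "sound t' a' \<and> off t' = 0 \<and> width t' = m
      \<and> sorted_wrt (<) (contents a' 0 m) \<and> set (contents a' 0 m) = S \<union> set (xs @ [x]) \<and> (\<forall>i\<ge>m. a' i = None)"
    if res: "(t', (a', c')) \<in> set_pmf (run S (xs @ [x]))" for t' a' c'
  proof -
    from res obtain t a c where 1: "(t, (a, c)) \<in> set_pmf (run S xs)" "(t', (a', c')) \<in> set_pmf (process x t (a, c))"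
      unfolding run by (auto simp: split_beta)
    have "sound t' a'" "off t' = 0" "width t' = m" "contents a' 0 m = insort x (contents a 0 m)" "\<forall>i. m \<le> i \<longrightarrow> a' i = a i"
      using step[OF 1(1)] 1(2) by blast+
    then show ?thesis using step[OF 1(1)] by (auto simp: sorted_wrt_insort set_insort_key)
  qed
  have B: "expect_le (run S (xs @ [x])) (outlay ys) (charges m (m div 4) (length (xs @ [x]) + length ys))" for ys
  proof -
    have "expect_le (run S xs) (\<lambda>(t, (a, c)). real c + budget t a (x # ys)) (charges m (m div 4) (length (xs @ [x]) + length ys))"
      using IH(2)[of "x # ys"] by simp
    then show ?thesis unfolding run
    proof (rule expect_le_bind)
      fix z assume "z \<in> set_pmf (run S xs)"
      moreover obtain t a c where z: "z = (t, (a, c))" by (metis surj_pair)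
      ultimately have "(t, (a, c)) \<in> set_pmf (run S xs)" by simp
      from step[OF this] show "expect_le ((\<lambda>(t, \<sigma>). process x t \<sigma>) z) (outlay ys)
          (case z of (t, (a, c)) \<Rightarrow> real c + budget t a (x # ys))"
        unfolding z prod.case by blast
    qed
  qed
  show ?case using A B by blast
qed

text \<open>At the root the density is at most 1/2, so the exponential part is bounded by a
  constant. The rebuilding term \<alpha> * \<open>k_max\<close> * depth determines the order log n
  (log log n)^3.\<close>

lemma charge_root:
  assumes "real s \<le> real m / 2"
  shows "charge m (real s) \<le> (26 * C\<alpha> + 400 + 8000 * exp 3) * (lg * llg ^ 3)"
proof -
  define y where "y = depth m"
  have m: "real m \<ge> 1000000" by (rule m_large)
  have n: "n > 0" using m by (simp add: n_def)
  have y0: "y \<ge> 0" unfolding y_def by (rule depth_nonneg)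
  have lm: "log 2 (real m) = lg + 1"
  proof -
    have "real m = 2 * n" by (simp add: n_def)
    then show ?thesis using n by (simp add: log_mult)
  qed
  \<comment> \<open>As (3/2)^2 > 2, logarithms to base 3/2 are at most twice those to base 2, and 2
    (log n + 1) \<le> 3 log n.\<close>
  have y: "y \<le> 3 * lg"
  proof -
    have "log 2 2 \<le> log 2 ((3 / 2 :: real)\<^sup>2)" by (subst log_le_cancel_iff) (auto simp: power2_eq_square)
    then have b: "log 2 (3 / 2 :: real) \<ge> 1 / 2" by (simp add: log_nat_power)
    have "y = log 2 (real m) / log 2 (3 / 2)"
      using m log_base_change[of 2 "3 / 2" "real m"] by (simp add: y_def depth_def max_absorb2)
    also have "\<dots> \<le> log 2 (real m) / (1 / 2)" using b lm lg_ge by (intro divide_left_mono) auto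
    finally show ?thesis using lm lg_ge by simp
  qed
  then have "exp (y / lg) \<le> exp 3" using lg_ge by (simp add: field_simps)
  moreover have "lg\<^sup>2 * (exp (- 3 / 4 * \<mu>) * (exp (\<mu> * real s / real m) + y * exp (\<mu> / 3))) \<le> 4"
  proof -
    have lnlg: "exp (ln lg) = lg" using lg_ge by simp
    \<comment> \<open>\<mu> / 4 is 2 ln (log n) and 3 \<mu> / 8 is 3 ln (log n). The latter serves
      for the exponent 3/4 - 1/3 = 5/12, which exceeds 3/8.\<close>
    have e2: "exp (- \<mu> / 4) = 1 / lg\<^sup>2"
      using lnlg by (simp add: \<mu>_def exp_minus exp_of_nat_mult[of 2, simplified] inverse_eq_divide)
    have e3: "exp (- (3 * \<mu> / 8)) = 1 / lg ^ 3"
      using lnlg by (simp add: \<mu>_def exp_minus exp_of_nat_mult[of 3, simplified] inverse_eq_divide)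
    have "real s / real m \<le> 1 / 2" using assms m by (simp add: field_simps)
    then have "\<mu> * (real s / real m) \<le> \<mu> * (1 / 2)" using \<mu>_bounds by (intro mult_left_mono) auto
    then have "exp (- 3 / 4 * \<mu> + \<mu> * real s / real m) \<le> exp (- \<mu> / 4)" by simp
    then have 1: "exp (- 3 / 4 * \<mu>) * exp (\<mu> * real s / real m) \<le> 1 / lg\<^sup>2" by (simp only: e2 exp_add)
    have "exp (- 3 / 4 * \<mu> + \<mu> / 3) \<le> exp (- (3 * \<mu> / 8))" using \<mu>_bounds by simp
    then have "exp (- 3 / 4 * \<mu>) * exp (\<mu> / 3) \<le> 1 / lg ^ 3" by (simp only: e3 exp_add)
    then have "y * (exp (- 3 / 4 * \<mu>) * exp (\<mu> / 3)) \<le> (3 * lg) * (1 / lg ^ 3)"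
      using y y0 lg_ge by (intro mult_mono) auto
    also have "\<dots> = 3 / lg\<^sup>2" using lg_ge by (simp add: power2_eq_square power3_eq_cube)
    finally have "exp (- 3 / 4 * \<mu>) * (exp (\<mu> * real s / real m) + y * exp (\<mu> / 3)) \<le> 1 / lg\<^sup>2 + 3 / lg\<^sup>2"
      using 1 by (simp add: algebra_simps)
    then have "lg\<^sup>2 * (exp (- 3 / 4 * \<mu>) * (exp (\<mu> * real s / real m) + y * exp (\<mu> / 3))) \<le> lg\<^sup>2 * (1 / lg\<^sup>2 + 3 / lg\<^sup>2)"
      by (intro mult_left_mono) auto
    also have "\<dots> = 4" using lg_ge by (simp add: distrib_left)
    finally show ?thesis .
  qed
  ultimately have "2000 * exp (y / lg) * (lg\<^sup>2 * (exp (- 3 / 4 * \<mu>) * (exp (\<mu> * real s / real m) + y * exp (\<mu> / 3)))) \<le> 2000 * exp 3 * 4"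
    using y0 by (intro mult_mono) auto
  then have t4: "2000 * lg\<^sup>2 * exp (y / lg) * exp (- 3 / 4 * \<mu>) * (exp (\<mu> * real s / real m) + y * exp (\<mu> / 3)) \<le> 8000 * exp 3"
  proof -
    have "2000 * lg\<^sup>2 * e * f * h = 2000 * e * (lg\<^sup>2 * (f * h))" for e f h :: real by simp
    then show ?thesis using \<open>_ \<le> 2000 * exp 3 * 4\<close> by simp
  qed
  define G where "G = lg * llg ^ 3"
  have l1: "llg \<ge> 1" "lg \<ge> 1" using loglog_ge lg_ge by simp_all
  have l3: "llg ^ 3 = llg\<^sup>2 * llg" by (simp add: power3_eq_cube power2_eq_square)
  have p2: "llg\<^sup>2 \<ge> 1" "llg ^ 3 \<ge> 1" using l1 by simp_all
  have C: "C\<alpha> > 0" using C\<alpha>_ge by simp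
  have G1: "1 \<le> G" "lg \<le> G"
    using mult_mono[of 1 lg 1 "llg ^ 3"] mult_left_mono[of 1 "llg ^ 3" lg] l1 p2 by (simp_all add: G_def)
  have "llg\<^sup>2 * 1 \<le> llg\<^sup>2 * (llg * lg)"
    using mult_mono[of 1 llg 1 lg] l1 by (intro mult_left_mono) auto
  then have "\<alpha> \<le> C\<alpha> * G" unfolding \<alpha>_eq G_def l3 using C by (simp add: mult_ac)
  then have t1: "2 * \<alpha> \<le> 2 * C\<alpha> * G" by simp
  have "real k_max + 2 \<le> 4 * llg" using k_max_bounds loglog_ge by linarith
  then have "2 * \<alpha> * (real k_max + 2) * y \<le> 2 * \<alpha> * (4 * llg) * (3 * lg)"
    using y y0 \<alpha>_large by (intro mult_mono) auto
  also have "\<dots> = 24 * C\<alpha> * G" unfolding \<alpha>_eq G_def l3 by simp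
  finally have t3: "2 * \<alpha> * (real k_max + 2) * y \<le> 24 * C\<alpha> * G" .
  have "8000 * exp 3 * 1 \<le> 8000 * exp 3 * G" using G1 by (intro mult_left_mono) auto
  then have "charge m (real s) \<le> 2 * C\<alpha> * G + 400 * G + 24 * C\<alpha> * G + 8000 * exp 3 * G"
    using t1 t3 t4 G1 unfolding charge_def y_def[symmetric] by linarith
  then show ?thesis unfolding G_def[symmetric] by (simp add: algebra_simps)
qed

lemma see_saw_correct:
  fixes S :: "'a::linorder set"
  assumes "finite S" "card S = m div 4" "length xs \<le> m div 4" "insertion_sequence S xs"
  shows "\<forall>a \<in> set_pmf (array_after S xs). stores_sorted m (S \<union> set xs) a"
    and "integrable (measure_pmf (total_cost S xs)) real"
    and "measure_pmf.expectation (total_cost S xs) real \<le> (26 * C\<alpha> + 400 + 8000 * exp 3) * real (length xs) * (lg * llg ^ 3)"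
proof -
  note spec = run_spec[OF assms]
  show "\<forall>a \<in> set_pmf (array_after S xs). stores_sorted m (S \<union> set xs) a"
  proof
    fix a assume "a \<in> set_pmf (array_after S xs)"
    then obtain t c where "(t, (a, c)) \<in> set_pmf (run S xs)" by (auto simp: array_after_def)
    then have "sorted_wrt (<) (contents a 0 m)" "set (contents a 0 m) = S \<union> set xs" "\<forall>i\<ge>m. a i = None"
      using spec by blast+
    then show "stores_sorted m (S \<union> set xs) a" by (intro stores_sorted_contents) auto
  qed
  let ?C = "(26 * C\<alpha> + 400 + 8000 * exp 3) * (lg * llg ^ 3)"
  let ?V = "?C * real (length xs)"
  have C: "?C \<ge> 0" using C\<alpha>_ge loglog_ge lg_ge by (intro mult_nonneg_nonneg) auto
  have "real (m div 4 + t) \<le> real m / 2" if "t < length xs" for t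
  proof -
    define d where "d = m div 4"
    have "4 * d \<le> m" "t < d" using that assms(3) by (simp_all add: d_def)
    have "2 * (d + t) \<le> 4 * d" using \<open>t < d\<close> by simp
    also have "\<dots> \<le> m" by fact
    finally have "2 * (m div 4 + t) \<le> m" unfolding d_def .
    then have "real (2 * (m div 4 + t)) \<le> real m" by (simp only: of_nat_le_iff)
    then show ?thesis by simp
  qed
  then have "charges m (m div 4) (length xs) \<le> (\<Sum>t<length xs. ?C)"
    unfolding charges_def by (intro sum_mono charge_root) simp
  then have ch: "charges m (m div 4) (length xs) \<le> ?V" by (simp add: mult.commute)
  have "expect_le (run S xs) (\<lambda>(t, (a, c)). real c + budget t a []) (charges m (m div 4) (length xs))"
    using conjunct2[OF spec, rule_format, of "[]"] by simp
  then have "expect_le (run S xs) (\<lambda>(t, (a, c)). real c) ?V"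
    using ch budget_nonneg by (elim expect_le_mono) (auto simp: split_beta)
  then have "expect_le (total_cost S xs) real ?V"
    unfolding total_cost_def by (intro expect_le_map) (simp add: split_def)
  from expect_le_expectation[OF this] C
  show "integrable (measure_pmf (total_cost S xs)) real"
    "measure_pmf.expectation (total_cost S xs) real \<le> (26 * C\<alpha> + 400 + 8000 * exp 3) * real (length xs) * (lg * llg ^ 3)"
    by (simp_all add: mult_ac)
qed

end

text \<open>2 powr sqrt (log n) outgrows every power of log n. Hence subarrays longer than that have
  windows of many insertions, while the shorter ones can be left to the classical algorithm.\<close>

lemma eventually_see_saw_large:
  fixes C\<alpha> C\<beta> :: real
  assumes "C\<alpha> \<ge> 100000" "C\<beta> \<ge> 100000" "C\<alpha> \<ge> 100000 * C\<beta>"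
  shows "eventually (\<lambda>m. see_saw_large C\<alpha> C\<beta> m) sequentially"
proof -
  have 1: "eventually (\<lambda>m::nat. log 2 (log 2 (real m / 2)) \<ge> 10) sequentially" by real_asymp
  have 2: "eventually (\<lambda>m::nat. 1000 * log 2 (log 2 (real m / 2)) \<le> log 2 (real m / 2)) sequentially" by real_asymp
  have "C\<alpha> > 0" using assms by simp
  then have 3: "eventually (\<lambda>m::nat. 1000000 * (C\<alpha> * (log 2 (log 2 (real m / 2)))\<^sup>2) * (log 2 (real m / 2)) ^ 3
      \<le> 2 powr sqrt (log 2 (real m / 2))) sequentially" by real_asymp
  from 1 2 3 show ?thesis
  proof eventually_elim
    case (elim m)
    then show ?case using assms
      by unfold_locales (simp_all add: see_saw.n_def see_saw.\<alpha>_def)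
  qed
qed

theorem theorem3:
  shows "\<exists>B > 0. \<forall>C\<alpha> C\<beta> :: real.
    C\<alpha> \<ge> B \<and> C\<beta> \<ge> B \<and> C\<alpha> / C\<beta> \<ge> B \<longrightarrow>
    (\<exists>K :: real. \<exists>m\<^sub>0 :: nat. \<forall>m \<ge> m\<^sub>0.
      \<forall>(S :: 'a::linorder set) xs.
        finite S \<and> card S = m div 4 \<and> length xs = m div 4 \<and> insertion_sequence S xs \<longrightarrow>
        (\<forall>i \<le> length xs.
          (\<forall>a \<in> set_pmf (see_saw.array_after C\<alpha> C\<beta> m S (take i xs)).
             stores_sorted m (S \<union> set (take i xs)) a) \<and>
          integrable (measure_pmf (see_saw.total_cost C\<alpha> C\<beta> m S (take i xs))) real \<and>
          measure_pmf.expectation (see_saw.total_cost C\<alpha> C\<beta> m S (take i xs)) real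
            \<le> K * real i * (log 2 (real m / 2) * (log 2 (log 2 (real m / 2))) ^ 3)))"
proof (rule exI[of _ 100000], intro conjI allI impI)
  fix C\<alpha> C\<beta> :: real
  assume "C\<alpha> \<ge> 100000 \<and> C\<beta> \<ge> 100000 \<and> C\<alpha> / C\<beta> \<ge> 100000"
  then have C: "C\<alpha> \<ge> 100000" "C\<beta> \<ge> 100000" "C\<alpha> \<ge> 100000 * C\<beta>" by (auto simp: field_simps)
  obtain m\<^sub>0 where m\<^sub>0: "\<And>m. m \<ge> m\<^sub>0 \<Longrightarrow> see_saw_large C\<alpha> C\<beta> m"
    using eventually_see_saw_large[OF C] by (auto simp: eventually_sequentially)
  show "\<exists>K :: real. \<exists>m\<^sub>0 :: nat. \<forall>m \<ge> m\<^sub>0.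
      \<forall>(S :: 'a::linorder set) xs.
        finite S \<and> card S = m div 4 \<and> length xs = m div 4 \<and> insertion_sequence S xs \<longrightarrow>
        (\<forall>i \<le> length xs.
          (\<forall>a \<in> set_pmf (see_saw.array_after C\<alpha> C\<beta> m S (take i xs)).
             stores_sorted m (S \<union> set (take i xs)) a) \<and>
          integrable (measure_pmf (see_saw.total_cost C\<alpha> C\<beta> m S (take i xs))) real \<and>
          measure_pmf.expectation (see_saw.total_cost C\<alpha> C\<beta> m S (take i xs)) real
            \<le> K * real i * (log 2 (real m / 2) * (log 2 (log 2 (real m / 2))) ^ 3))"
  \<comment> \<open>The constant is that of \<open>charge_root\<close>. A prefix of an insertion
    sequence is again one, so \<open>see_saw_correct\<close> covers every \<open>i\<close>.\<close>
  proof (rule exI[of _ "26 * C\<alpha> + 400 + 8000 * exp 3"], rule exI[of _ m\<^sub>0], intro allI impI)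
    fix m S xs i
    assume m: "m \<ge> m\<^sub>0" and i: "i \<le> length xs"
      and asm: "finite S \<and> card S = m div 4 \<and> length xs = m div 4 \<and> insertion_sequence (S :: 'a set) xs"
    interpret see_saw_large C\<alpha> C\<beta> m by (rule m\<^sub>0) fact
    have seq: "finite S" "card S = m div 4" "length (take i xs) \<le> m div 4" "insertion_sequence S (take i xs)"
      using asm i by (auto simp: insertion_sequence_def dest: in_set_takeD)
    have "length (take i xs) = i" using i by simp
    with see_saw_correct[OF seq]
    show "(\<forall>a \<in> set_pmf (array_after S (take i xs)). stores_sorted m (S \<union> set (take i xs)) a) \<and>
          integrable (measure_pmf (total_cost S (take i xs))) real \<and>
          measure_pmf.expectation (total_cost S (take i xs)) real
            \<le> (26 * C\<alpha> + 400 + 8000 * exp 3) * real i * (log 2 (real m / 2) * (log 2 (log 2 (real m / 2))) ^ 3)"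
      unfolding n_def by simp
  qed
qed simp

end
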